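(* Let $q$ be a prime power, $n\ge 2$, and let $f\in\mathbb F_q[X_1,\ldots,X_n]$ be an absolutely irreducible polynomial of degree $\delta>1$ with $\delta\notin[6,37]$. For $j\ge 1$ let $\Pi_j$ be the set of affine planes $L$ for which the restriction $f_L$ has exactly $j+1$ absolutely irreducible $\mathbb F_q$-factors. Then $$\sum_{j=1}^{\delta-1} j\,\#(\Pi_j)\le 1.99\,\delta^{13/3}\,\frac{q^{3n-3}}{q^3(q-1)}.$$
   Context: An affine plane $L$ here is a $2$-dimensional affine subspace of $\mathbb F_q^n$, i.e. $L=\{v_0+sv_1+tv_2\}$ with $v_0,v_1,v_2\in\mathbb F_q^n$ and $v_1,v_2$ linearly independent. The restriction $f_L$ is the bivariate polynomial $f(v_0+Sv_1+Tv_2)\in\mathbb F_q[S,T]$ (for a chosen parametrization of $L$). An absolutely irreducible $\mathbb F_q$-factor of $f_L$ is a factor of $f_L$ in $\mathbb F_q[S,T]$ which remains irreducible over the algebraic closure $\overline{\mathbb F}_q$. *)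

theory Defs
  imports "HOL-Library.Poly_Mapping" "HOL-Library.Cardinality" "HOL-Algebra.Algebraic_Closure_Type"
begin

text \<open>Multivariate polynomials over a field 'a in the variables indexed by the
  finite type 'n (so n = CARD('n)): finitely supported maps from exponent vectors
  to coefficients, with the convolution ring structure of Poly_Mapping.\<close>

type_synonym ('n, 'a) mpoly = "('n \<Rightarrow>\<^sub>0 nat) \<Rightarrow>\<^sub>0 'a"

definition total_degree :: "('n::finite, 'a::zero) mpoly \<Rightarrow> nat" where
  "total_degree f = Max (insert 0 ((\<lambda>m. \<Sum>i\<in>UNIV. Poly_Mapping.lookup m i) ` Poly_Mapping.keys f))"

definition abs_irreducible_mpoly :: "('n::finite, 'a::field) mpoly \<Rightarrow> bool" where
  "abs_irreducible_mpoly f \<longleftrightarrow> irreducible (Poly_Mapping.map to_ac f)"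

text \<open>Bivariate polynomials in S, T over 'a: 'a poly poly, inner variable S,
  outer variable T. An absolutely irreducible factor of a bivariate polynomial.\<close>
definition abs_irreducible_biv :: "'a::field poly poly \<Rightarrow> bool" where
  "abs_irreducible_biv g \<longleftrightarrow> irreducible (map_poly (map_poly to_ac) g)"

definition restrict_plane ::
  "('n::finite, 'a::field) mpoly \<Rightarrow> ('n \<Rightarrow> 'a) \<Rightarrow> ('n \<Rightarrow> 'a) \<Rightarrow> ('n \<Rightarrow> 'a) \<Rightarrow> 'a poly poly" where
  "restrict_plane f v0 v1 v2 =
     (\<Sum>m\<in>Poly_Mapping.keys f. [:[:Poly_Mapping.lookup f m:]:] *
        (\<Prod>i\<in>UNIV. ([:[:v0 i, v1 i:]:] + [:0, [:v2 i:]:]) ^ Poly_Mapping.lookup m i))"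

definition num_abs_irr_factors :: "'a::field poly poly \<Rightarrow> nat" where
  "num_abs_irr_factors g =
     card {{h'. h' dvd h \<and> h dvd h'} | h. h dvd g \<and> abs_irreducible_biv h}"

definition lin_indep2 :: "('n \<Rightarrow> 'a::field) \<Rightarrow> ('n \<Rightarrow> 'a) \<Rightarrow> bool" where
  "lin_indep2 v1 v2 \<longleftrightarrow> (\<forall>a b. (\<forall>i. a * v1 i + b * v2 i = 0) \<longrightarrow> a = 0 \<and> b = 0)"

definition affine_plane_of :: "('n \<Rightarrow> 'a::field) \<Rightarrow> ('n \<Rightarrow> 'a) \<Rightarrow> ('n \<Rightarrow> 'a) \<Rightarrow> ('n \<Rightarrow> 'a) set" where
  "affine_plane_of v0 v1 v2 = {(\<lambda>i. v0 i + s * v1 i + t * v2 i) | s t. True}"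

definition Pi_planes :: "('n::finite, 'a::field) mpoly \<Rightarrow> nat \<Rightarrow> ('n \<Rightarrow> 'a) set set" where
  "Pi_planes f j = {L. \<exists>v0 v1 v2. lin_indep2 v1 v2 \<and> L = affine_plane_of v0 v1 v2 \<and>
                         num_abs_irr_factors (restrict_plane f v0 v1 v2) = j + 1}"

end

(* The theorem is an effective Bertini theorem. Work over the algebraic closure k and write
   d for the degree of f. Fix v and w such that f(v + X w) has degree d and d distinct roots x,
   and let g = f(v + X w + Y Z) with indeterminate direction Z. Since f is irreducible, so is
   f(v + X w + Z), and hence g, over the fraction field of k[Z]. By Hensel lifting
   g = c * prod (X - A_x) with A_x in k[Z][[Y]], where the coefficient of Y^i in A_x has degree
   at most i in Z.

   A factorisation g_z = h u of a special section gives the combination h' u of the cofactors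
   g_z / (X - A_x), with coefficients 1 on the roots of h and 0 on the others; it has degree at
   most d in Y. So the coefficients of the cofactors at Y^i for d < i < (2d-1)d + 1 form a matrix
   with a kernel vector that vanishes at one root. For the generic g there is none, because a
   resultant of g and the combination would vanish to too high an order. Hence some minor, of
   degree at most (d-1)(2d-1)d in Z, is nonzero, and it vanishes at every z with g_z reducible.

   By Schwartz-Zippel at most a proportion B(d)/q of the triples (w, v, z) over F_q, with
   B(d) = bad_bound d, gives a reducible section. A plane has at least q^2 (q^2-1)(q^2-q)
   parametrisations, and those of a plane in Pi_j with j >= 1 are all reducible. Bounding j by d - 1,
   the claim becomes (d-1) B(d) q^2/(q^2-1) <= 1.99 d^(13/3), where q^2/(q^2-1) <= 4/3 and,
   for d >= 3, (d-1) B(d) <= 2 d^4. *)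

theory Submission
  imports Defs "Berlekamp_Zassenhaus.Unique_Factorization_Poly" "Jordan_Normal_Form.Determinant"
begin

text \<open>A factor h is a product over an unknown subset of the branches, whereas h' u is a sum of
  cofactors over that subset. This makes reducibility a linear condition, detected by minors, which
  are polynomials in Z. The sum of all cofactors is the derivative of g, also of degree at most d in
  Y; hence the all-ones vector lies in every kernel, and a factorisation yields a second,
  independent vector. Subtracting a multiple of the all-ones vector makes the entry at one chosen
  root vanish, which leaves d - 1 columns.

  In positive characteristic f can be inseparable on all lines of a given direction w. This is
  excluded by asking that the derivative of f along w be nonzero: an irreducible f is not a p-th
  power, so some partial derivative is nonzero, and the nonvanishing of one linear form in w
  suffices. This is the summand 1 in \<open>bad_bound\<close>.

  Resultants enter only through an identity a g + b W = r with r of bounded degree, once in Y for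
  the kernel of the generic matrix and once in Z for the separability of the line sections.\<close>

hide_const (open) module.smult Divisibility.prime


section \<open>Degree filtrations\<close>

text \<open>\<open>P d a\<close> reads as "a has degree at most d". The instances are the degree in
  Y, the total degree in Z and coefficientwise versions of these, so that the bounds for
  determinants and for substitutions are proved once.\<close>

locale filtration =
  fixes P :: "nat \<Rightarrow> 's::comm_ring_1 \<Rightarrow> bool"
  assumes zero: "P d 0"
    and one: "P 0 1"
    and add: "P d a \<Longrightarrow> P d b \<Longrightarrow> P d (a + b)"
    and uminus: "P d a \<Longrightarrow> P d (- a)"
    and mult: "P d a \<Longrightarrow> P e b \<Longrightarrow> P (d + e) (a * b)"
    and mono: "P d a \<Longrightarrow> d \<le> e \<Longrightarrow> P e a"
begin

lemma diff: "P d a \<Longrightarrow> P d b \<Longrightarrow> P d (a - b)"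
  using add[of d a "- b"] uminus[of d b] by simp

lemma sum: "(\<And>i. i \<in> A \<Longrightarrow> P d (f i)) \<Longrightarrow> P d (sum f A)"
  by (induction A rule: infinite_finite_induct) (auto intro: zero add)

lemma prod: "(\<And>i. i \<in> A \<Longrightarrow> P (d i) (f i)) \<Longrightarrow> P (sum d A) (prod f A)"
  by (induction A rule: infinite_finite_induct) (auto intro: one mult)

lemma power: "P d a \<Longrightarrow> P (n * d) (a ^ n)"
  by (induction n) (auto intro: one mult)

lemma scale: "P 0 c \<Longrightarrow> P d a \<Longrightarrow> P d (c * a)"
  using mult[of 0 c d a] by simp

lemma det:
  assumes A: "A \<in> carrier_mat n n"
    and e: "\<And>i j. i < n \<Longrightarrow> j < n \<Longrightarrow> P d (A $$ (i, j))"
  shows "P (n * d) (det A)"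
proof -
  have "P (n * d) (\<Prod>i = 0..<n. A $$ (i, p i))" if "p permutes {0..<n}" for p
  proof -
    have "P (sum (\<lambda>_. d) {0..<n}) (\<Prod>i = 0..<n. A $$ (i, p i))"
      using e permutes_in_image[OF that] by (intro prod) auto
    thus ?thesis by simp
  qed
  moreover have "P 0 (signof p)" for p :: "nat \<Rightarrow> nat"
    by (auto simp: sign_def intro: one uminus)
  ultimately show ?thesis
    unfolding det_def'[OF A] by (intro sum scale) auto
qed

end

lemma filtration_degree: "filtration (\<lambda>d (p :: 's::comm_ring_1 poly). degree p \<le> d)"
  by unfold_locales (auto intro: degree_add_le order_trans[OF degree_mult_le])

lemma filtration_coeffs:
  assumes "filtration P"
  shows "filtration (\<lambda>d p. \<forall>i. P d (coeff p i))"
proof -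
  interpret filtration P by fact
  show ?thesis
  proof
    fix d e :: nat and a b :: "'a poly"
    assume "\<forall>i. P d (coeff a i)" "\<forall>i. P e (coeff b i)"
    thus "\<forall>i. P (d + e) (coeff (a * b) i)"
      unfolding coeff_mult by (auto intro!: sum mult)
  qed (auto intro: zero add uminus mono one simp: coeff_1)
qed

text \<open>Series whose coefficient at Y^k has weight at most k form a subring, so the index of the
  new filtration is ignored. The condition reflects that Y enters the generic section only through
  the product Y Z.\<close>

lemma filtration_fps:
  assumes "filtration P"
  shows "filtration (\<lambda>_ a. \<forall>k. P k (fps_nth a k))"
proof -
  interpret filtration P by fact
  show ?thesis
  proof
    fix a b :: "'a fps"
    assume *: "\<forall>k. P k (fps_nth a k)" "\<forall>k. P k (fps_nth b k)"
    have "P k (fps_nth a i * fps_nth b (k - i))" if "i \<le> k" for i k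
      using mult[of i "fps_nth a i" "k - i" "fps_nth b (k - i)"] * that by simp
    thus "\<forall>k. P k (fps_nth (a * b) k)"
      unfolding fps_mult_nth by (auto intro!: sum)
  qed (auto intro: zero add uminus mono mono[OF one])
qed

section \<open>Linear algebra over integral domains\<close>

text \<open>Induction on the number of columns: the cofactors of the last row of the enlarged matrices
  do not depend on that row, so if all enlarged minors vanished they would form a kernel vector.\<close>

lemma nonzero_minor_exists:
  fixes a :: "'i \<Rightarrow> nat \<Rightarrow> 's::idom"
  assumes "\<And>\<mu>. (\<And>i. i \<in> I \<Longrightarrow> (\<Sum>j<m. a i j * \<mu> j) = 0) \<Longrightarrow> (\<And>j. j < m \<Longrightarrow> \<mu> j = 0)"
  shows "\<exists>\<rho>. (\<forall>r<m. \<rho> r \<in> I) \<and> det (mat m m (\<lambda>(r, j). a (\<rho> r) j)) \<noteq> 0"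
  using assms
proof (induction m)
  case 0
  show ?case by (simp add: det_def)
next
  case (Suc m)
  have "\<mu> j = 0" if ker: "\<And>i. i \<in> I \<Longrightarrow> (\<Sum>j<m. a i j * \<mu> j) = 0" and j: "j < m" for \<mu> j
  proof -
    have "(\<mu>(m := 0)) j = 0"
    proof (rule Suc.prems)
      fix i assume "i \<in> I"
      have "(\<Sum>j<m. a i j * (\<mu>(m := 0)) j) = (\<Sum>j<m. a i j * \<mu> j)"
        by (rule sum.cong) auto
      with ker[OF \<open>i \<in> I\<close>] show "(\<Sum>j<Suc m. a i j * (\<mu>(m := 0)) j) = 0"
        by simp
    qed (use j in auto)
    with j show ?thesis by simp
  qed
  hence "\<exists>\<rho>. (\<forall>r<m. \<rho> r \<in> I) \<and> det (mat m m (\<lambda>(r, j). a (\<rho> r) j)) \<noteq> 0"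
    by (rule Suc.IH)
  then obtain \<rho> where \<rho>: "\<And>r. r < m \<Longrightarrow> \<rho> r \<in> I"
    and nz: "det (mat m m (\<lambda>(r, j). a (\<rho> r) j)) \<noteq> 0" by blast
  define M where "M i = mat (Suc m) (Suc m) (\<lambda>(r, j). a ((\<rho>(m := i)) r) j)" for i
  define \<mu> where "\<mu> j = (-1) ^ (m + j) * det (mat m m (\<lambda>(r, j'). a (\<rho> r) (if j' < j then j' else Suc j')))" for j
  have del: "mat_delete (M i) m j = mat m m (\<lambda>(r, j'). a (\<rho> r) (if j' < j then j' else Suc j'))"
    if "j < Suc m" for i j
    using that by (intro eq_matI) (auto simp: mat_delete_def M_def)
  have "det (M i) = (\<Sum>j<Suc m. a i j * \<mu> j)" for i
  proof -
    have "det (M i) = (\<Sum>j<Suc m. M i $$ (m, j) * cofactor (M i) m j)"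
      by (rule laplace_expansion_row) (auto simp: M_def)
    also have "\<dots> = (\<Sum>j<Suc m. a i j * \<mu> j)"
      by (intro sum.cong) (auto simp: cofactor_def del \<mu>_def, auto simp: M_def)
    finally show ?thesis .
  qed
  \<comment> \<open>Deleting the last column leaves the nonzero minor of the induction hypothesis,
    so the vector of cofactors is nonzero and some row \<open>i\<close> must detect it.\<close>
  moreover have "\<mu> m \<noteq> 0"
  proof -
    have "mat m m (\<lambda>(r, j'). a (\<rho> r) (if j' < m then j' else Suc j')) = mat m m (\<lambda>(r, j). a (\<rho> r) j)"
      by (intro eq_matI) auto
    with nz show ?thesis by (simp add: \<mu>_def)
  qed
  ultimately obtain i where "i \<in> I" "det (M i) \<noteq> 0"
    using Suc.prems[of \<mu> m] by auto
  with \<rho> show ?case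
    by (intro exI[of _ "\<rho>(m := i)"]) (auto simp: M_def less_Suc_eq)
qed

lemma det_nonzero_imp_kernel_trivial:
  fixes a :: "nat \<Rightarrow> nat \<Rightarrow> 's::idom"
  assumes "det (mat m m (\<lambda>(r, j). a r j)) \<noteq> 0"
    and "\<And>r. r < m \<Longrightarrow> (\<Sum>j<m. a r j * \<mu> j) = 0" and "j < m"
  shows "\<mu> j = 0"
proof -
  let ?A = "mat m m (\<lambda>(r, j). a r j)"
  have "?A *\<^sub>v vec m \<mu> = 0\<^sub>v m"
    using assms(2) by (intro eq_vecI) (auto simp: scalar_prod_def lessThan_atLeast0)
  with assms(1) have "vec m \<mu> = 0\<^sub>v m"
    using det_0_iff_vec_prod_zero[of ?A m] by (metis mat_carrier vec_carrier)
  thus ?thesis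
    using assms(3) by (metis index_vec index_zero_vec(1))
qed

text \<open>The resultant, without reference to its value: the matrix below is the Sylvester matrix.\<close>

lemma elimination:
  fixes f g :: "'s::idom poly"
  assumes "filtration P"
    and f: "degree f \<le> m" "\<And>i. P d (coeff f i)" and g: "degree g \<le> n" "\<And>i. P d (coeff g i)"
    and mn: "0 < m + n"
  obtains (common) a b where "a \<noteq> 0 \<or> b \<noteq> 0" "a * f + b * g = 0"
      "\<And>i. i \<ge> n \<Longrightarrow> coeff a i = 0" "\<And>i. i \<ge> m \<Longrightarrow> coeff b i = 0"
  | (combination) a b r where "r \<noteq> 0" "a * f + b * g = [:r:]" "P ((m + n) * d) r"
proof -
  interpret filtration P by fact
  define N where "N = m + n"
  define col where "col j = (if j < n then monom 1 j * f else monom 1 (j - n) * g)" for j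
  define A where "A = mat N N (\<lambda>(i, j). coeff (col j) i)"
  define pa where "pa c = (\<Sum>j<n. monom (c j) j)" for c :: "nat \<Rightarrow> 's"
  define pb where "pb c = (\<Sum>j<m. monom (c (n + j)) j)" for c :: "nat \<Rightarrow> 's"
  have A: "A \<in> carrier_mat N N" by (simp add: A_def)
  have split: "(\<Sum>j<n + l. h j) = (\<Sum>j<n. h j) + (\<Sum>j<l. h (n + j))" for h :: "nat \<Rightarrow> 's poly" and l
    by (induction l) (auto simp: add_ac)
  have comb: "pa c * f + pb c * g = (\<Sum>j<N. smult (c j) (col j))" for c
  proof -
    have "(\<Sum>j<N. smult (c j) (col j))
        = (\<Sum>j<n. smult (c j) (col j)) + (\<Sum>j<m. smult (c (n + j)) (col (n + j)))"
      using split[of "\<lambda>j. smult (c j) (col j)" m] by (simp add: N_def add.commute)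
    thus ?thesis
      by (simp add: pa_def pb_def col_def sum_distrib_right smult_monom flip: mult_smult_left)
  qed
  have high: "coeff (col j) i = 0" if "j < N" "i \<ge> N" for i j
  proof (rule coeff_eq_0)
    have "degree (col j) \<le> (if j < n then j + m else j - n + n)"
      using f(1) g(1) unfolding col_def
      by (auto intro!: order_trans[OF degree_mult_le] add_mono simp: degree_monom_eq)
    with that show "degree (col j) < i" by (auto simp: N_def split: if_splits)
  qed
  have coeff_comb: "coeff (pa c * f + pb c * g) i = (if i < N then (\<Sum>j<N. A $$ (i, j) * c j) else 0)"
    for c i
    unfolding comb by (auto simp: coeff_sum A_def high mult.commute intro!: sum.cong)
  have pa0: "coeff (pa c) i = (if i < n then c i else 0)" for c i
    by (simp add: pa_def coeff_sum)
  have pb0: "coeff (pb c) i = (if i < m then c (n + i) else 0)" for c i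
    by (simp add: pb_def coeff_sum)
  show thesis
  proof (cases "det A = 0")
    case True
    then obtain v where v: "v \<in> carrier_vec N" "v \<noteq> 0\<^sub>v N" "A *\<^sub>v v = 0\<^sub>v N"
      using det_0_iff_vec_prod_zero[OF A] by blast
    let ?c = "vec_index v"
    have "(\<Sum>j<N. A $$ (i, j) * ?c j) = 0" if "i < N" for i
    proof -
      have "(A *\<^sub>v v) $ i = 0" using v(3) that by simp
      thus ?thesis using that v(1) A
        by (simp add: scalar_prod_def lessThan_atLeast0)
    qed
    hence "pa ?c * f + pb ?c * g = 0"
      by (intro poly_eqI) (auto simp only: coeff_comb coeff_0 split: if_split)
    moreover have "pa ?c \<noteq> 0 \<or> pb ?c \<noteq> 0"
    proof -
      obtain j where j: "j < N" "v $ j \<noteq> 0"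
        using v(1,2) by (metis carrier_vecD eq_vecI index_zero_vec)
      have "coeff (pa ?c) j \<noteq> 0 \<or> coeff (pb ?c) (j - n) \<noteq> 0"
        using j by (auto simp: pa0 pb0 N_def)
      thus ?thesis by auto
    qed
    ultimately show thesis
      using common[of "pa ?c" "pb ?c"] by (auto simp: pa0 pb0)
  next
    case False
    \<comment> \<open>The first column of the adjugate is mapped by \<open>A\<close> to
      \<open>det A\<close> times the first unit vector; read as polynomials, this is the Bezout
      identity with right-hand side the resultant.\<close>
    define c where "c j = adj_mat A $$ (j, 0)" for j
    have N0: "0 < N" using mn by (simp add: N_def)
    have "(\<Sum>j<N. A $$ (i, j) * c j) = (if i = 0 then det A else 0)" if "i < N" for i
    proof -
      have "(A * adj_mat A) $$ (i, 0) = (\<Sum>j<N. A $$ (i, j) * c j)"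
        using that A adj_mat(1)[OF A] N0 by (simp add: c_def scalar_prod_def lessThan_atLeast0)
      moreover have "(A * adj_mat A) $$ (i, 0) = (if i = 0 then det A else 0)"
        using that N0 by (simp add: adj_mat(2)[OF A])
      ultimately show ?thesis by simp
    qed
    hence "pa c * f + pb c * g = [:det A:]"
      by (intro poly_eqI)
        (use N0 in \<open>auto simp only: coeff_comb coeff_pCons coeff_0 split: nat.splits if_split\<close>)
    moreover have "P (N * d) (det A)"
    proof (rule det[OF A])
      fix i j assume "i < N" "j < N"
      thus "P d (A $$ (i, j))"
        using f(2) g(2) by (auto simp: A_def col_def coeff_monom_mult zero)
    qed
    ultimately show thesis
      using combination[OF False] by (simp add: N_def)
  qed
qed

section \<open>Evaluation of multivariate polynomials\<close>

text \<open>The coefficient map is a parameter, so that lines, planes, translations and renamings of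
  variables are all evaluations in suitable polynomial rings, and their compositions reduce to
  \<open>hom_mpeval\<close>.\<close>

definition mpeval :: "('k::zero \<Rightarrow> 's) \<Rightarrow> ('n \<Rightarrow> 's) \<Rightarrow> ('n::finite, 'k) mpoly \<Rightarrow> 's::comm_ring_1" where
  "mpeval c x p = (\<Sum>m\<in>Poly_Mapping.keys p. c (Poly_Mapping.lookup p m) * (\<Prod>i\<in>UNIV. x i ^ Poly_Mapping.lookup m i))"

definition mconst :: "'k::zero \<Rightarrow> ('n, 'k) mpoly" where
  "mconst a = Poly_Mapping.single 0 a"

definition mvar :: "'n \<Rightarrow> ('n, 'k::zero_neq_one) mpoly" where
  "mvar i = Poly_Mapping.single (Poly_Mapping.single i 1) 1"

definition expo_degree :: "('n::finite \<Rightarrow>\<^sub>0 nat) \<Rightarrow> nat" where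
  "expo_degree m = (\<Sum>i\<in>UNIV. Poly_Mapping.lookup m i)"

definition degree_le :: "nat \<Rightarrow> ('n::finite, 'k::zero) mpoly \<Rightarrow> bool" where
  "degree_le d p \<longleftrightarrow> (\<forall>m\<in>Poly_Mapping.keys p. expo_degree m \<le> d)"

definition homogeneous_part :: "nat \<Rightarrow> ('n::finite, 'k::comm_monoid_add) mpoly \<Rightarrow> ('n, 'k) mpoly" where
  "homogeneous_part d p =
     (\<Sum>m\<in>{m\<in>Poly_Mapping.keys p. expo_degree m = d}. Poly_Mapping.single m (Poly_Mapping.lookup p m))"

lemma expo_degree_add: "expo_degree (m + m') = expo_degree m + expo_degree m'"
  by (simp add: expo_degree_def lookup_add sum.distrib)

lemma expo_degree_single [simp]: "expo_degree (Poly_Mapping.single i a) = a"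
  by (simp add: expo_degree_def lookup_single when_def)

lemma expo_degree_zero [simp]: "expo_degree 0 = 0"
  by (simp add: expo_degree_def)

lemma mpoly_sum_monomials:
  "p = (\<Sum>m\<in>Poly_Mapping.keys p. Poly_Mapping.single m (Poly_Mapping.lookup p m))"
proof (rule poly_mapping_eqI)
  fix k
  show "Poly_Mapping.lookup p k = Poly_Mapping.lookup (\<Sum>m\<in>Poly_Mapping.keys p. Poly_Mapping.single m (Poly_Mapping.lookup p m)) k"
    by (simp add: lookup_sum lookup_single when_def in_keys_iff)
qed

lemma lookup_homogeneous_part:
  "Poly_Mapping.lookup (homogeneous_part d p) m = (if expo_degree m = d then Poly_Mapping.lookup p m else 0)"
  by (auto simp: homogeneous_part_def lookup_sum lookup_single when_def in_keys_iff)

lemma mpeval_superset: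
  assumes "finite A" "Poly_Mapping.keys p \<subseteq> A" "c 0 = 0"
  shows "mpeval c x p = (\<Sum>m\<in>A. c (Poly_Mapping.lookup p m) * (\<Prod>i\<in>UNIV. x i ^ Poly_Mapping.lookup m i))"
  unfolding mpeval_def using assms
  by (intro sum.mono_neutral_left) (auto simp: in_keys_iff)

context comm_ring_hom
begin

lemma mpeval_single:
  "mpeval hom x (Poly_Mapping.single m a) = hom a * (\<Prod>i\<in>UNIV. x i ^ Poly_Mapping.lookup m i)"
  by (simp add: mpeval_def)

lemma mpeval_mconst [simp]: "mpeval hom x (mconst a) = hom a"
  by (simp add: mconst_def mpeval_single)

lemma mpeval_mvar [simp]: "mpeval hom x (mvar i) = x i"
proof -
  have "(\<Prod>j\<in>UNIV. x j ^ Poly_Mapping.lookup (Poly_Mapping.single i 1) j) = (\<Prod>j\<in>UNIV. if j = i then x i else 1)"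
    by (intro prod.cong) (auto simp: lookup_single when_def)
  thus ?thesis by (simp add: mvar_def mpeval_single)
qed

lemma mpeval_add: "mpeval hom x (p + q) = mpeval hom x p + mpeval hom x q"
proof -
  let ?A = "Poly_Mapping.keys p \<union> Poly_Mapping.keys q"
  have "mpeval hom x r = (\<Sum>m\<in>?A. hom (Poly_Mapping.lookup r m) * (\<Prod>i\<in>UNIV. x i ^ Poly_Mapping.lookup m i))"
    if "Poly_Mapping.keys r \<subseteq> ?A" for r
    using that by (intro mpeval_superset) auto
  from this[of p] this[of q] this[of "p + q"] keys_add[of p q] show ?thesis
    by (simp add: lookup_add hom_add ring_distribs sum.distrib)
qed

lemma mpeval_sum: "mpeval hom x (sum f A) = (\<Sum>i\<in>A. mpeval hom x (f i))"
  by (induction A rule: infinite_finite_induct) (auto simp: mpeval_add, auto simp: mpeval_def)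

lemma mpeval_mult: "mpeval hom x (p * q) = mpeval hom x p * mpeval hom x q"
proof -
  have single: "mpeval hom x (Poly_Mapping.single m a * Poly_Mapping.single m' b) =
      mpeval hom x (Poly_Mapping.single m a) * mpeval hom x (Poly_Mapping.single m' b)" for m m' a b
    by (simp add: mult_single mpeval_single hom_mult lookup_add power_add prod.distrib mult_ac)
  have "mpeval hom x (p * q) =
      (\<Sum>m\<in>Poly_Mapping.keys p. \<Sum>m'\<in>Poly_Mapping.keys q.
         mpeval hom x (Poly_Mapping.single m (Poly_Mapping.lookup p m)) * mpeval hom x (Poly_Mapping.single m' (Poly_Mapping.lookup q m')))"
    by (subst mpoly_sum_monomials[of p], subst mpoly_sum_monomials[of q])
      (simp only: sum_product mpeval_sum single)
  also have "\<dots> = mpeval hom x p * mpeval hom x q"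
    by (subst (2) mpoly_sum_monomials[of p], subst (2) mpoly_sum_monomials[of q])
      (simp only: sum_product mpeval_sum)
  finally show ?thesis .
qed

lemma comm_ring_hom_mpeval: "comm_ring_hom (mpeval hom x)"
proof
  show "mpeval hom x 1 = 1"
    using mpeval_mconst[of x 1] by (simp add: mconst_def)
qed (simp_all add: mpeval_add mpeval_mult, simp add: mpeval_def)

lemma hom_mpeval: "hom (mpeval c x p) = mpeval (\<lambda>a. hom (c a)) (\<lambda>i. hom (x i)) p"
  by (simp add: mpeval_def hom_sum hom_mult hom_prod hom_power)

end

section \<open>Constants, variables and the standard ring homomorphisms\<close>

lemma comm_ring_hom_mconst: "comm_ring_hom (mconst :: 'k::comm_ring_1 \<Rightarrow> ('n, 'k) mpoly)"
  by unfold_locales (auto simp: mconst_def single_add mult_single)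

lemma mvar_power: "mvar i ^ n = Poly_Mapping.single (Poly_Mapping.single i n) (1::'k::comm_ring_1)"
  by (induction n) (auto simp: mvar_def mult_single simp flip: single_add)

lemma prod_mvar_power:
  "(\<Prod>i\<in>A. mvar i ^ e i) = Poly_Mapping.single (\<Sum>i\<in>A. Poly_Mapping.single i (e i)) (1::'k::comm_ring_1)"
  by (induction A rule: infinite_finite_induct) (simp_all add: mvar_power mult_single)

lemma expo_sum_single: "(\<Sum>i\<in>UNIV. Poly_Mapping.single i (e i)) = m" if "\<And>i. Poly_Mapping.lookup m i = e i"
  for m :: "'n::finite \<Rightarrow>\<^sub>0 nat"
  by (rule poly_mapping_eqI) (simp add: lookup_sum lookup_single when_def that)

lemma mpeval_mconst_mvar:
  "mpeval mconst mvar p = (p :: ('n::finite, 'k::comm_ring_1) mpoly)"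
  by (subst (2) mpoly_sum_monomials)
    (simp add: mpeval_def prod_mvar_power expo_sum_single mconst_def mult_single)

lemma comm_ring_hom_const_poly: "comm_ring_hom (\<lambda>a. [:a:])"
  by unfold_locales (auto simp: one_pCons)

lemma comm_ring_hom_comp:
  assumes "comm_ring_hom f" "comm_ring_hom g"
  shows "comm_ring_hom (\<lambda>a. f (g a))"
proof -
  interpret f: comm_ring_hom f by fact
  interpret g: comm_ring_hom g by fact
  show ?thesis by unfold_locales (auto simp: f.hom_add f.hom_mult g.hom_add g.hom_mult)
qed

lemma comm_ring_hom_map_poly:
  assumes "comm_ring_hom f"
  shows "comm_ring_hom (map_poly f)"
proof -
  interpret f: comm_ring_hom f by fact
  interpret map_poly_comm_ring_hom f ..
  show ?thesis ..
qed

lemma comm_ring_hom_poly: "comm_ring_hom (\<lambda>p. poly p a)"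
  by unfold_locales auto

lemma comm_ring_hom_fps_of_poly: "comm_ring_hom fps_of_poly"
  by unfold_locales (auto simp: fps_of_poly_add fps_of_poly_mult)

lemma comm_ring_hom_fps_nth_0: "comm_ring_hom (\<lambda>a. fps_nth a 0)"
  by unfold_locales auto

lemma comm_ring_hom_id: "comm_ring_hom (\<lambda>x. x)"
  by unfold_locales auto

section \<open>Degrees of multivariate polynomials\<close>

lemma filtration_degree_le: "filtration (degree_le :: nat \<Rightarrow> ('n::finite, 'k::comm_ring_1) mpoly \<Rightarrow> bool)"
proof
  fix d e and a b :: "('n, 'k) mpoly"
  assume "degree_le d a" "degree_le e b"
  thus "degree_le (d + e) (a * b)"
    using keys_mult[of a b] by (fastforce simp: degree_le_def expo_degree_add intro: add_mono)
next
  fix d and a b :: "('n, 'k) mpoly"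
  assume "degree_le d a" "degree_le d b"
  thus "degree_le d (a + b)"
    using keys_add[of a b] by (auto simp: degree_le_def)
qed (auto simp: degree_le_def in_keys_iff)

lemma degree_le_mconst: "degree_le d (mconst a)"
  by (auto simp: degree_le_def mconst_def)

lemma degree_le_mvar: "degree_le 1 (mvar i)"
  by (auto simp: degree_le_def mvar_def)

lemma degree_le_homogeneous_part: "degree_le d (homogeneous_part d p)"
  by (auto simp: degree_le_def in_keys_iff lookup_homogeneous_part split: if_splits)

lemma (in filtration) mpeval:
  assumes "\<And>a. P 0 (c a)" "\<And>i. P 1 (x i)" "degree_le d p"
  shows "P d (mpeval c x p)"
  unfolding mpeval_def
proof (intro sum scale assms)
  fix m assume "m \<in> Poly_Mapping.keys p"
  have "P (\<Sum>i\<in>UNIV. Poly_Mapping.lookup m i * 1) (\<Prod>i\<in>UNIV. x i ^ Poly_Mapping.lookup m i)"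
    by (intro prod power assms)
  thus "P d (\<Prod>i\<in>UNIV. x i ^ Poly_Mapping.lookup m i)"
    using assms(3) \<open>m \<in> _\<close> by (intro mono[of _ _ d]) (auto simp: degree_le_def expo_degree_def)
qed

lemma degree_le_total_degree: "degree_le (total_degree p) p"
  unfolding degree_le_def total_degree_def expo_degree_def by auto

lemma homogeneous_part_total_degree_nonzero:
  assumes "total_degree p > 0"
  shows "homogeneous_part (total_degree p) p \<noteq> 0"
proof -
  have "total_degree p \<in> insert 0 (expo_degree ` Poly_Mapping.keys p)"
    unfolding total_degree_def expo_degree_def by (intro Max_in) auto
  then obtain m where "m \<in> Poly_Mapping.keys p" "expo_degree m = total_degree p"
    using assms by auto
  hence "Poly_Mapping.lookup (homogeneous_part (total_degree p) p) m \<noteq> 0"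
    by (simp add: lookup_homogeneous_part in_keys_iff)
  thus ?thesis by auto
qed

lemma coeff_mult_degree_le_sum:
  fixes p q :: "'s::comm_ring_1 poly"
  assumes "degree p \<le> n" "degree q \<le> m"
  shows "coeff (p * q) (n + m) = coeff p n * coeff q m"
proof -
  have "(\<Sum>i\<le>n + m. coeff p i * coeff q (n + m - i)) = (\<Sum>i\<in>{n}. coeff p i * coeff q (n + m - i))"
  proof (intro sum.mono_neutral_right ballI)
    fix i assume "i \<in> {..n + m} - {n}"
    hence "i > n \<or> n + m - i > m" by auto
    with assms show "coeff p i * coeff q (n + m - i) = 0" by (auto simp: coeff_eq_0)
  qed auto
  thus ?thesis by (simp add: coeff_mult)
qed

text \<open>A monomial of degree e contributes degree at most e in the new variable, and its
  coefficient there is the monomial evaluated at \<open>b\<close>. Only the monomials of degree d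
  reach the d-th power.\<close>

lemma mpeval_linear_poly:
  fixes c :: "'k::comm_ring_1 \<Rightarrow> 's::comm_ring_1"
  assumes c: "comm_ring_hom c" and d: "degree_le d p"
  shows "degree (mpeval (\<lambda>a. [:c a:]) (\<lambda>i. [:a i, b i:]) p) \<le> d" (is "degree ?q \<le> d")
    and "coeff (mpeval (\<lambda>a. [:c a:]) (\<lambda>i. [:a i, b i:]) p) d = mpeval c b (homogeneous_part d p)"
proof -
  interpret c: comm_ring_hom c by fact
  interpret F: filtration "\<lambda>d (p :: 's poly). degree p \<le> d" by (rule filtration_degree)
  show "degree ?q \<le> d"
    by (rule F.mpeval) (auto intro: d)
  note top_mult = coeff_mult_degree_le_sum
  define t where "t m = (\<Prod>i\<in>UNIV. [:a i, b i:] ^ Poly_Mapping.lookup m i)" for m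
  have pw: "degree ([:u, v:] ^ n) \<le> n \<and> coeff ([:u, v:] ^ n) n = v ^ n" for u v :: 's and n
  proof (induction n)
    case (Suc n)
    have "degree ([:u, v:] * [:u, v:] ^ n) \<le> 1 + n"
      using Suc by (intro F.mult) auto
    moreover have "coeff ([:u, v:] * [:u, v:] ^ n) (1 + n) = v * v ^ n"
      using Suc by (subst top_mult) auto
    ultimately show ?case by simp
  qed auto
  have pr: "degree (\<Prod>i\<in>A. [:a i, b i:] ^ Poly_Mapping.lookup m i) \<le> (\<Sum>i\<in>A. Poly_Mapping.lookup m i) \<and>
     coeff (\<Prod>i\<in>A. [:a i, b i:] ^ Poly_Mapping.lookup m i) (\<Sum>i\<in>A. Poly_Mapping.lookup m i) = (\<Prod>i\<in>A. b i ^ Poly_Mapping.lookup m i)" for A m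
  proof (induction A rule: infinite_finite_induct)
    case (insert x A)
    have "degree ([:a x, b x:] ^ Poly_Mapping.lookup m x * (\<Prod>i\<in>A. [:a i, b i:] ^ Poly_Mapping.lookup m i))
        \<le> Poly_Mapping.lookup m x + (\<Sum>i\<in>A. Poly_Mapping.lookup m i)"
      using insert pw by (intro F.mult) auto
    with insert pw show ?case
      by (simp add: top_mult)
  qed auto
  have t: "degree (t m) \<le> expo_degree m" "coeff (t m) (expo_degree m) = (\<Prod>i\<in>UNIV. b i ^ Poly_Mapping.lookup m i)" for m
    using pr[of m UNIV] by (auto simp: t_def expo_degree_def)
  have "coeff ?q d = (\<Sum>m\<in>Poly_Mapping.keys p. c (Poly_Mapping.lookup p m) * coeff (t m) d)"
    by (simp add: mpeval_def coeff_sum t_def)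
  also have "\<dots> = (\<Sum>m\<in>Poly_Mapping.keys p. c (Poly_Mapping.lookup (homogeneous_part d p) m) * (\<Prod>i\<in>UNIV. b i ^ Poly_Mapping.lookup m i))"
  proof (intro sum.cong refl)
    fix m assume "m \<in> Poly_Mapping.keys p"
    with d have "expo_degree m \<le> d" by (auto simp: degree_le_def)
    with t[of m] show "c (Poly_Mapping.lookup p m) * coeff (t m) d =
        c (Poly_Mapping.lookup (homogeneous_part d p) m) * (\<Prod>i\<in>UNIV. b i ^ Poly_Mapping.lookup m i)"
      by (cases "expo_degree m = d") (auto simp: lookup_homogeneous_part coeff_eq_0)
  qed
  also have "\<dots> = mpeval c b (homogeneous_part d p)"
    by (rule mpeval_superset[symmetric])
      (auto simp: in_keys_iff lookup_homogeneous_part split: if_splits)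
  finally show "coeff ?q d = mpeval c b (homogeneous_part d p)" .
qed

section \<open>Counting zeros\<close>

lemma restrict_UNIV: "restrict f UNIV = f"
  by (rule ext) simp

text \<open>Schwartz-Zippel for a sum of monomials whose exponents are pairwise different on \<open>A\<close>;
  in this form the coefficient of a power of one variable is again such a sum.\<close>

lemma card_zeros_monomial_sum_le:
  fixes c :: "('n \<Rightarrow> nat) \<Rightarrow> 'k::idom"
  assumes "finite A" "finite S" "finite K" "K \<noteq> {}" "\<And>m. m \<in> K \<Longrightarrow> c m \<noteq> 0"
    and "inj_on (\<lambda>m. restrict m A) K" "\<And>m. m \<in> K \<Longrightarrow> (\<Sum>i\<in>A. m i) \<le> d"
  shows "card {z \<in> A \<rightarrow>\<^sub>E S. (\<Sum>m\<in>K. c m * (\<Prod>i\<in>A. z i ^ m i)) = 0} * card S \<le> d * card S ^ card A"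
  using assms(1,3-)
proof (induction A arbitrary: K d rule: finite_induct)
  case empty
  obtain m where m: "m \<in> K" using empty by auto
  have "m' = m" if "m' \<in> K" for m'
    using inj_onD[OF empty.prems(4), of m' m] m that by (simp add: restrict_def)
  hence "K = {m}" using m by blast
  thus ?case using empty.prems(3)[OF m] by simp
next
  case (insert x A)
  define e where "e = Max ((\<lambda>m. m x) ` K)"
  have e: "m x \<le> e" if "m \<in> K" for m
    unfolding e_def using insert.prems(1) that by auto
  obtain m0 where m0: "m0 \<in> K" "m0 x = e"
  proof -
    have "e \<in> (\<lambda>m. m x) ` K"
      unfolding e_def using insert.prems(1,2) by (intro Max_in) auto
    thus thesis using that by auto
  qed
  \<comment> \<open>\<open>pe\<close> is the leading coefficient with respect to the variable
    \<open>x\<close>. The exponents in \<open>Ke\<close> agree at \<open>x\<close>, so they remain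
    pairwise different on \<open>A\<close> and the induction hypothesis applies.\<close>
  define Ke where "Ke = {m \<in> K. m x = e}"
  define pe where "pe z = (\<Sum>m\<in>Ke. c m * (\<Prod>i\<in>A. z i ^ m i))" for z
  define q where "q z = (\<Sum>m\<in>K. monom (c m * (\<Prod>i\<in>A. z i ^ m i)) (m x))" for z
  let ?s = "card S"
  have sum_x: "m x + (\<Sum>i\<in>A. m i) \<le> d" if "m \<in> K" for m
    using insert.prems(5)[OF that] insert.hyps by simp
  have ed: "e \<le> d" using sum_x[OF m0(1)] m0(2) by simp
  have IH: "card {z \<in> A \<rightarrow>\<^sub>E S. pe z = 0} * ?s \<le> (d - e) * ?s ^ card A"
    unfolding pe_def
  proof (rule insert.IH)
    show "inj_on (\<lambda>m. restrict m A) Ke"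
    proof (rule inj_onI)
      fix m m' assume mm: "m \<in> Ke" "m' \<in> Ke" and eq: "restrict m A = restrict m' A"
      have "restrict m (insert x A) = restrict m' (insert x A)"
      proof
        fix i show "restrict m (insert x A) i = restrict m' (insert x A) i"
          using fun_cong[OF eq, of i] mm by (auto simp: restrict_def Ke_def split: if_splits)
      qed
      thus "m = m'" using inj_onD[OF insert.prems(4), of m m'] mm by (simp add: Ke_def)
    qed
    show "(\<Sum>i\<in>A. m i) \<le> d - e" if "m \<in> Ke" for m
      using sum_x[of m] that by (auto simp: Ke_def)
    show "finite Ke" using insert.prems(1) by (simp add: Ke_def)
    show "Ke \<noteq> {}" using m0 by (auto simp: Ke_def)
    show "c m \<noteq> 0" if "m \<in> Ke" for m using insert.prems(3) that by (simp add: Ke_def)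
  qed
  have poly_q: "poly (q z) t = (\<Sum>m\<in>K. c m * (\<Prod>i\<in>insert x A. (z(x := t)) i ^ m i))" for z t
  proof -
    have "(\<Prod>i\<in>A. (z(x := t)) i ^ m i) = (\<Prod>i\<in>A. z i ^ m i)" for m :: "'n \<Rightarrow> nat"
      using insert.hyps by (intro prod.cong) auto
    thus ?thesis
      using insert.hyps by (simp add: q_def poly_sum poly_monom mult_ac)
  qed
  have coeff_q: "coeff (q z) e = pe z" for z
    using insert.prems(1) by (simp add: q_def pe_def Ke_def coeff_sum sum.inter_filter)
  have deg_q: "degree (q z) \<le> e" for z
    unfolding q_def
    by (rule degree_sum_le[OF insert.prems(1)]) (rule order_trans[OF degree_monom_le e])
  have roots: "card {t \<in> S. poly (q z) t = 0} \<le> e" if "pe z \<noteq> 0" for z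
  proof -
    have "q z \<noteq> 0" using that coeff_q[of z] by auto
    hence "card {t. poly (q z) t = 0} \<le> degree (q z)" "finite {t. poly (q z) t = 0}"
      by (auto intro: poly_roots_degree poly_roots_finite)
    moreover from this(2) have "card {t \<in> S. poly (q z) t = 0} \<le> card {t. poly (q z) t = 0}"
      by (rule card_mono) blast
    ultimately show ?thesis using deg_q[of z] by linarith
  qed
  let ?Z = "{z \<in> insert x A \<rightarrow>\<^sub>E S. (\<Sum>m\<in>K. c m * (\<Prod>i\<in>insert x A. z i ^ m i)) = 0}"
  \<comment> \<open>\<open>?B\<close> covers the zeros lying over zeros of the leading coefficient
    \<open>pe\<close>, which the induction hypothesis counts; \<open>?G\<close> covers the others,
    with at most \<open>e\<close> of them in each fibre.\<close>
  let ?B = "(\<lambda>(z, t). z(x := t)) ` ({z \<in> A \<rightarrow>\<^sub>E S. pe z = 0} \<times> S)"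
  let ?G = "(\<lambda>(z, t). z(x := t)) ` (SIGMA z:{z \<in> A \<rightarrow>\<^sub>E S. pe z \<noteq> 0}. {t \<in> S. poly (q z) t = 0})"
  have fin: "finite (A \<rightarrow>\<^sub>E S)"
    using insert.hyps assms(2) by (intro finite_PiE) auto
  have "?Z \<subseteq> ?B \<union> ?G"
  proof
    fix z assume z: "z \<in> ?Z"
    define z' where "z' = z(x := undefined)"
    have z': "z' \<in> A \<rightarrow>\<^sub>E S" "z'(x := z x) = z" "z x \<in> S"
      using z insert.hyps by (auto simp: z'_def PiE_def extensional_def)
    hence "poly (q z') (z x) = 0" using z unfolding poly_q by simp
    with z' have "(z', z x) \<in> ({z \<in> A \<rightarrow>\<^sub>E S. pe z = 0} \<times> S) \<union>
        (SIGMA z:{z \<in> A \<rightarrow>\<^sub>E S. pe z \<noteq> 0}. {t \<in> S. poly (q z) t = 0})"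
      by simp
    moreover have "z = (\<lambda>(z, t). z(x := t)) (z', z x)" using z'(2) by simp
    ultimately show "z \<in> ?B \<union> ?G" unfolding image_Un[symmetric] by (rule image_eqI[rotated])
  qed
  moreover have finBG: "finite ({z \<in> A \<rightarrow>\<^sub>E S. pe z = 0} \<times> S)"
    "finite (SIGMA z:{z \<in> A \<rightarrow>\<^sub>E S. pe z \<noteq> 0}. {t \<in> S. poly (q z) t = 0})"
    using fin assms(2) by (auto intro: finite_SigmaI)
  ultimately have "card ?Z \<le> card (?B \<union> ?G)"
    by (intro card_mono finite_UnI finite_imageI)
  with card_Un_le[of ?B ?G] have Z: "card ?Z \<le> card ?B + card ?G"
    by (rule order_trans[rotated])
  have B: "card ?B \<le> card {z \<in> A \<rightarrow>\<^sub>E S. pe z = 0} * ?s"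
    using card_image_le[OF finBG(1), of "\<lambda>(z, t). z(x := t)"] by (simp only: card_cartesian_product)
  have "card ?G \<le> card (SIGMA z:{z \<in> A \<rightarrow>\<^sub>E S. pe z \<noteq> 0}. {t \<in> S. poly (q z) t = 0})"
    by (rule card_image_le[OF finBG(2)])
  moreover have "card (SIGMA z:{z \<in> A \<rightarrow>\<^sub>E S. pe z \<noteq> 0}. {t \<in> S. poly (q z) t = 0})
      = (\<Sum>z\<in>{z \<in> A \<rightarrow>\<^sub>E S. pe z \<noteq> 0}. card {t \<in> S. poly (q z) t = 0})"
    using fin assms(2) by (intro card_SigmaI) auto
  moreover have "(\<Sum>z\<in>{z \<in> A \<rightarrow>\<^sub>E S. pe z \<noteq> 0}. card {t \<in> S. poly (q z) t = 0})
      \<le> card {z \<in> A \<rightarrow>\<^sub>E S. pe z \<noteq> 0} * e"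
    using roots by (intro sum_bounded_above[where K = e, simplified]) auto
  moreover have "card {z \<in> A \<rightarrow>\<^sub>E S. pe z \<noteq> 0} \<le> ?s ^ card A"
    using card_mono[OF fin, of "{z \<in> A \<rightarrow>\<^sub>E S. pe z \<noteq> 0}"] insert.hyps
    by (simp add: card_PiE Collect_conj_eq)
  hence "card {z \<in> A \<rightarrow>\<^sub>E S. pe z \<noteq> 0} * e \<le> ?s ^ card A * e"
    by (rule mult_le_mono1)
  ultimately have G: "card ?G \<le> ?s ^ card A * e" by linarith
  have "card ?Z \<le> (d - e) * ?s ^ card A + ?s ^ card A * e"
    using Z B G IH by linarith
  hence "card ?Z \<le> d * ?s ^ card A"
    using ed by (simp add: mult.commute flip: add_mult_distrib)
  hence "card ?Z * ?s \<le> d * ?s ^ card A * ?s" by (rule mult_le_mono1)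
  moreover have "d * ?s ^ card A * ?s = d * ?s ^ card (insert x A)"
    using insert.hyps by simp
  ultimately show ?case by (simp only:)
qed

lemma card_zeros_mpoly_le:
  fixes p :: "('n::finite, 'k::idom) mpoly"
  assumes "finite S" "p \<noteq> 0" "degree_le d p"
  shows "card {z. (\<forall>i. z i \<in> S) \<and> mpeval (\<lambda>a. a) z p = 0} * card S \<le> d * card S ^ CARD('n)"
proof -
  let ?l = "Poly_Mapping.lookup :: ('n \<Rightarrow>\<^sub>0 nat) \<Rightarrow> 'n \<Rightarrow> nat"
  have inj: "inj_on ?l A" for A
    by (auto intro!: inj_onI poly_mapping_eqI)
  let ?K = "?l ` Poly_Mapping.keys p"
  define c where "c m = Poly_Mapping.lookup p (inv_into UNIV ?l m)" for m
  have inv: "inv_into UNIV ?l (?l m) = m" for m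
    using inj[of UNIV] by (rule inv_f_f)
  have eval: "(\<Sum>m\<in>?K. c m * (\<Prod>i\<in>UNIV. z i ^ m i)) = mpeval (\<lambda>a. a) z p" for z
    by (simp add: sum.reindex[OF inj] inv mpeval_def o_def c_def)
  have "card {z \<in> UNIV \<rightarrow>\<^sub>E S. (\<Sum>m\<in>?K. c m * (\<Prod>i\<in>UNIV. z i ^ m i)) = 0} * card S
      \<le> d * card S ^ card (UNIV :: 'n set)"
    using assms by (intro card_zeros_monomial_sum_le)
      (auto simp: c_def inv in_keys_iff degree_le_def expo_degree_def restrict_UNIV
        intro!: inj_on_subset[OF inj subset_UNIV] inj_onI poly_mapping_eqI)
  thus ?thesis
    unfolding eval by (simp add: PiE_def Pi_def)
qed

lemma exists_nonzero_mpeval: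
  fixes p :: "('n::finite, 'k::idom) mpoly"
  assumes "infinite (UNIV :: 'k set)" "p \<noteq> 0"
  shows "\<exists>z. mpeval (\<lambda>a. a) z p \<noteq> 0"
proof (rule ccontr)
  assume "\<not> ?thesis"
  hence zero: "mpeval (\<lambda>a. a) z p = 0" for z by auto
  let ?d = "total_degree p"
  \<comment> \<open>One element more than the degree: were all values zero, Schwartz-Zippel would
    bound the size of the whole grid by less than itself.\<close>
  obtain S :: "'k set" where S: "card S = Suc ?d" "finite S"
    using infinite_arbitrarily_large[OF assms(1), of "Suc ?d"] by auto
  have "{z :: 'n \<Rightarrow> 'k. \<forall>i. z i \<in> S} = UNIV \<rightarrow>\<^sub>E S"
    by (auto simp: PiE_def)
  hence "card {z :: 'n \<Rightarrow> 'k. \<forall>i. z i \<in> S} = card S ^ CARD('n)"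
    by (simp add: card_PiE)
  moreover have "card {z :: 'n \<Rightarrow> 'k. \<forall>i. z i \<in> S} * card S \<le> ?d * card S ^ CARD('n)"
    using card_zeros_mpoly_le[OF S(2) assms(2) degree_le_total_degree] by (simp only: zero simp_thms)
  ultimately have "card S ^ CARD('n) * Suc ?d \<le> card S ^ CARD('n) * ?d"
    using S(1) by (simp only: mult.commute)
  moreover have "card S ^ CARD('n) > 0" using S(1) by simp
  ultimately show False by (metis mult_le_cancel1 not_less_eq_eq order_refl)
qed

section \<open>Irreducibility along the generic line\<close>

text \<open>Gauss's lemma. A unit leading coefficient makes \<open>p\<close> primitive, so
  \<open>a\<close> is up to a unit the product of the contents of \<open>q\<close> and
  \<open>r\<close>. Comparing leading coefficients, those of the primitive parts multiply to a unit,
  so the leading coefficient of \<open>q\<close> is associated to its content.\<close>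

lemma lead_coeff_dvd_of_factor:
  fixes p q r :: "'u::{factorial_ring_gcd,semiring_gcd_mult_normalize} poly"
  assumes eq: "smult a p = q * r" and "a \<noteq> 0" and unit: "is_unit (lead_coeff p)"
  shows "[:lead_coeff q:] dvd q"
proof -
  have p: "p \<noteq> 0" using unit by auto
  hence "q \<noteq> 0" "r \<noteq> 0" using eq \<open>a \<noteq> 0\<close> by auto
  have "content p dvd 1"
    using unit content_dvd_coeff[of p "degree p"] dvd_trans by blast
  hence "content p = 1" by simp
  hence "normalize a = content q * content r"
    using arg_cong[OF eq, of content] by (simp add: content_mult)
  hence "normalize a dvd content q * content r" by simp
  hence a: "a dvd content q * content r" by simp
  have lc: "a * lead_coeff p = lead_coeff q * lead_coeff r"
    using arg_cong[OF eq, of lead_coeff] \<open>a \<noteq> 0\<close> by (simp add: lead_coeff_mult lead_coeff_smult)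
  obtain l where l: "lead_coeff q = content q * l"
    using content_dvd_coeff[of q "degree q"] by blast
  obtain m where m: "lead_coeff r = content r * m"
    using content_dvd_coeff[of r "degree r"] by blast
  have "content q * content r * (l * m) dvd content q * content r * 1"
  proof -
    have "content q * content r * (l * m) = a * lead_coeff p"
      using lc l m by (simp add: mult_ac)
    also have "\<dots> dvd a" using unit by (simp add: mult_unit_dvd_iff)
    also note a
    finally show ?thesis by simp
  qed
  hence "l * m dvd 1"
    using \<open>q \<noteq> 0\<close> \<open>r \<noteq> 0\<close> by (subst (asm) dvd_times_left_cancel_iff) auto
  hence "l dvd 1" by (rule dvd_mult_left)
  hence "lead_coeff q dvd content q"
    unfolding l by (simp add: mult_unit_dvd_iff)
  thus ?thesis by (simp add: const_poly_dvd_iff_dvd_content)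
qed

lemma fract_poly_common_denominator:
  fixes p :: "'r::idom fract poly"
  obtains b q where "b \<noteq> 0" "smult (to_fract b) p = map_poly to_fract q"
proof -
  have "\<exists>b q. b \<noteq> 0 \<and> smult (to_fract b) p = map_poly to_fract q"
  proof (induction p)
    case 0
    show ?case by (intro exI[of _ 1] exI[of _ 0]) auto
  next
    case (pCons a p)
    then obtain b q where bq: "b \<noteq> 0" "smult (to_fract b) p = map_poly to_fract q" by blast
    obtain x y where xy: "a = Fraction_Field.Fract x y" "y \<noteq> 0" by (cases a) auto
    have "to_fract y * a = to_fract x"
      using xy by (simp add: to_fract_def eq_fract)
    hence "smult (to_fract (b * y)) (pCons a p) = map_poly to_fract (pCons (b * x) (smult y q))"
      using arg_cong[OF bq(2), of "smult (to_fract y)"]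
      by (simp add: to_fract_hom.map_poly_pCons_hom mult_ac)
    with bq xy show ?case by (intro exI[of _ "b * y"] exI) auto
  qed
  with that show thesis by blast
qed

text \<open>With a unit constant coefficient, \<open>b\<close> is invertible as a power series over
  the base ring. The coefficients of the quotient, computed from the lowest upwards, therefore never
  leave that ring.\<close>

lemma poly_dvd_if_const_coeff_unit:
  fixes b p :: "'r::idom poly" and s :: "'r fract poly"
  assumes unit: "coeff b 0 dvd 1" and eq: "map_poly to_fract p = map_poly to_fract b * s"
  shows "b dvd p"
proof -
  define y where "y n = inv_into UNIV to_fract (coeff s n)" for n
  have range: "coeff s n \<in> range to_fract" for n
  proof (induction n rule: less_induct)
    case (less n)
    obtain e where e: "coeff b 0 * e = 1" using unit by (metis dvdE)
    have "to_fract (coeff p n) = (\<Sum>i\<le>n. to_fract (coeff b i) * coeff s (n - i))"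
      using arg_cong[OF eq, of "\<lambda>q. coeff q n"] by (simp add: coeff_map_poly coeff_mult)
    also have "\<dots> = to_fract (coeff b 0) * coeff s n
        + (\<Sum>i\<in>{..n} - {0}. to_fract (coeff b i) * coeff s (n - i))"
      by (subst sum.remove[of _ 0]) auto
    finally have main: "to_fract (coeff b 0) * coeff s n = to_fract (coeff p n)
        - (\<Sum>i\<in>{..n} - {0}. to_fract (coeff b i) * coeff s (n - i))"
      by simp
    have y: "coeff s (n - i) = to_fract (y (n - i))" if "i \<in> {..n} - {0}" for i
      using less[of "n - i"] that by (simp add: y_def f_inv_into_f)
    have "coeff s n = to_fract e * (to_fract (coeff b 0) * coeff s n)"
    proof -
      have "to_fract e * (to_fract (coeff b 0) * coeff s n) = to_fract (coeff b 0 * e) * coeff s n"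
        by (simp add: mult_ac)
      thus ?thesis by (simp add: e)
    qed
    also have "\<dots> = to_fract (e * (coeff p n - (\<Sum>i\<in>{..n} - {0}. coeff b i * y (n - i))))"
      unfolding main by (simp add: y)
    finally show ?case by blast
  qed
  have y: "coeff s n = to_fract (y n)" for n
    using range[of n] by (simp add: y_def f_inv_into_f)
  define q where "q = (\<Sum>n\<le>degree s. monom (y n) n)"
  have "s = map_poly to_fract q"
    by (rule poly_eqI) (auto simp: q_def coeff_map_poly coeff_sum y coeff_eq_0 simp flip: y)
  hence "map_poly to_fract p = map_poly to_fract (b * q)"
    using eq by (simp only: fract_poly_mult)
  hence "p = b * q" by (simp only: fract_poly_eq_iff)
  thus ?thesis by simp
qed


lemma infinite_UNIV_alg_closed: "infinite (UNIV :: 'k::alg_closed_field set)"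
proof
  assume fin: "finite (UNIV :: 'k set)"
  let ?p = "(\<Prod>a\<in>UNIV. [:- a, 1:]) + 1 :: 'k poly"
  have deg: "degree (\<Prod>a\<in>UNIV. [:- a, 1:] :: 'k poly) = card (UNIV :: 'k set)"
    by (subst degree_prod_eq_sum_degree) auto
  have "card (UNIV :: 'k set) > 0" using fin by (simp add: card_gt_0_iff)
  hence "degree ?p > 0"
    using deg by (subst degree_add_eq_left) auto
  then obtain x where "poly ?p x = 0" using alg_closed_imp_poly_has_root by blast
  moreover have "poly ?p x = 1"
    using fin by (simp add: poly_prod)
  ultimately show False by simp
qed

lemma is_unit_field_poly_iff_degree:
  "(p :: 'k::field poly) dvd 1 \<longleftrightarrow> p \<noteq> 0 \<and> degree p = 0"
  by (auto simp: is_unit_iff_degree)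

text \<open>This is f(v + Z + X w), as a polynomial in X over k[Z].\<close>

definition generic_line ::
  "('n \<Rightarrow> 'k) \<Rightarrow> ('n \<Rightarrow> 'k) \<Rightarrow> ('n::finite, 'k::comm_ring_1) mpoly \<Rightarrow> ('n, 'k) mpoly poly" where
  "generic_line v w = mpeval (\<lambda>a. [:mconst a:]) (\<lambda>i. [:mvar i + mconst (v i), mconst (w i):])"

lemma mconst_eq_0_iff: "mconst a = 0 \<longleftrightarrow> a = 0"
  unfolding mconst_def by (metis lookup_single_eq lookup_zero single_zero)

lemma comm_ring_hom_zero_one: "comm_ring_hom h \<Longrightarrow> h 0 = 0" "comm_ring_hom h \<Longrightarrow> h 1 = 1"
  by (simp_all add: comm_ring_hom_def ring_hom_def semiring_hom_def comm_monoid_add_hom_def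
    monoid_add_hom_def monoid_mult_hom_def zero_hom_def one_hom_def)

lemma map_poly_linear:
  assumes "comm_ring_hom h"
  shows "map_poly h [:a:] = [:h a:]" and "map_poly h [:a, b:] = [:h a, h b:]"
proof -
  interpret comm_ring_hom h by fact
  show "map_poly h [:a:] = [:h a:]" "map_poly h [:a, b:] = [:h a, h b:]"
    by (simp_all add: map_poly_pCons_hom)
qed

lemma comm_ring_hom_const_mconst:
  "comm_ring_hom (\<lambda>a. [:mconst a:] :: ('n::finite, 'k::comm_ring_1) mpoly poly)"
  by (rule comm_ring_hom_comp[OF comm_ring_hom_const_poly comm_ring_hom_mconst])

text \<open>The direction \<open>w\<close> is not a zero of the leading form, so f has exact degree
  \<open>d\<close> on every line of direction \<open>w\<close>, with a leading coefficient
  \<open>top\<close> in k that does not depend on the base point. Leading coefficients of factors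
  are then units wherever k is contained in the coefficients as invertible constants.\<close>

locale irreducible_form =
  fixes f :: "('n::{finite,linorder}, 'k::alg_closed_field) mpoly" and d :: nat and w :: "'n \<Rightarrow> 'k"
  assumes irreducible: "irreducible f"
    and degree_le: "degree_le d f"
    and degree_pos: "0 < d"
    and top_nonzero: "mpeval (\<lambda>a. a) w (homogeneous_part d f) \<noteq> 0"
begin

definition top :: 'k where
  "top = mpeval (\<lambda>a. a) w (homogeneous_part d f)"

lemma generic_line_degree: "degree (generic_line v w f) = d"
  and generic_line_lead_coeff: "lead_coeff (generic_line v w f) = mconst top"
proof -
  note gl = mpeval_linear_poly[OF comm_ring_hom_mconst degree_le,
    of "\<lambda>i. mvar i + mconst (v i)" "\<lambda>i. mconst (w i)", folded generic_line_def]
  interpret mconst: comm_ring_hom "mconst :: 'k \<Rightarrow> ('n, 'k) mpoly" by (rule comm_ring_hom_mconst)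
  have c: "coeff (generic_line v w f) d = mconst top"
    using gl(2) mconst.hom_mpeval[of "\<lambda>a. a" w "homogeneous_part d f"] by (simp add: top_def)
  moreover have "mconst top \<noteq> (0 :: ('n, 'k) mpoly)"
    using top_nonzero by (simp add: top_def mconst_eq_0_iff)
  ultimately show "degree (generic_line v w f) = d"
    using gl(1) le_degree[of "generic_line v w f" d] by auto
  with c show "lead_coeff (generic_line v w f) = mconst top" by simp
qed

text \<open>The automorphism \<open>Z \<mapsto> Z - v - X w\<close> of \<open>k[Z][X]\<close> maps the generic line to the constant \<open>f\<close>.\<close>

lemma generic_line_no_factorization:
  assumes "generic_line v w f = p * q"
  shows "degree p = 0 \<or> degree q = 0"
proof -
  define \<Theta> :: "('n \<Rightarrow> ('n, 'k) mpoly poly) \<Rightarrow> ('n, 'k) mpoly poly \<Rightarrow> ('n, 'k) mpoly poly"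
    where "\<Theta> y r = poly (map_poly (mpeval (\<lambda>a. [:mconst a:]) y) r) [:0, 1:]" for y r
  interpret c: comm_ring_hom "\<lambda>a. [:mconst a:] :: ('n, 'k) mpoly poly"
    by (rule comm_ring_hom_const_mconst)
  interpret mconst: comm_ring_hom "mconst :: 'k \<Rightarrow> ('n, 'k) mpoly" by (rule comm_ring_hom_mconst)
  have hom: "comm_ring_hom (\<Theta> y)" for y
    unfolding \<Theta>_def
    by (intro comm_ring_hom_comp[OF comm_ring_hom_poly] comm_ring_hom_map_poly c.comm_ring_hom_mpeval)
  have \<Theta>_const: "\<Theta> y [:a:] = mpeval (\<lambda>a. [:mconst a:]) y a"
    and \<Theta>_lin: "\<Theta> y [:a, b:] = mpeval (\<lambda>a. [:mconst a:]) y a + [:0, 1:] * mpeval (\<lambda>a. [:mconst a:]) y b"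
    for y a b
    by (simp_all only: \<Theta>_def map_poly_linear[OF c.comm_ring_hom_mpeval]) simp_all
  have \<Theta>_mconst: "\<Theta> y [:mconst a:] = [:mconst a:]" for y a
    by (simp add: \<Theta>_const)
  have \<Theta>_X: "\<Theta> y [:0, 1:] = [:0, 1:]" for y
    using \<Theta>_lin[of y 0 1] comm_ring_hom_zero_one[OF c.comm_ring_hom_mpeval[of y]] by simp
  have \<Theta>_var: "\<Theta> y [:mvar i + mconst a, mconst b:] = y i + [:mconst a, mconst b:]" for y i a b
    by (simp add: \<Theta>_lin c.mpeval_add)
  define y1 where "y1 i = [:mvar i + mconst (- v i), mconst (- w i):]" for i
  define y2 where "y2 i = [:mvar i + mconst (v i), mconst (w i):]" for i
  have var12: "\<Theta> y1 (y2 i) = [:mvar i:]" "\<Theta> y2 (y1 i) = [:mvar i:]" for i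
    by (simp_all add: y1_def[of i] y2_def[of i] \<Theta>_var) (simp_all add: y1_def y2_def mconst.hom_uminus)
  have const_eval: "mpeval (\<lambda>a. [:mconst a:]) (\<lambda>i. [:mvar i:]) a = [:a:]" for a :: "('n, 'k) mpoly"
    using comm_ring_hom.hom_mpeval[OF comm_ring_hom_const_poly, of mconst mvar a] by (simp add: mpeval_mconst_mvar)
  have inv: "\<Theta> y2 (\<Theta> y1 r) = r" for r
  proof (induction r)
    case 0
    show ?case using hom[THEN comm_ring_hom.axioms(1)] by (simp add: \<Theta>_def)
  next
    case (pCons a r)
    interpret t1: comm_ring_hom "\<Theta> y1" by (rule hom)
    interpret t2: comm_ring_hom "\<Theta> y2" by (rule hom)
    have "\<Theta> y2 (\<Theta> y1 [:a:]) = [:a:]"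
      by (simp only: \<Theta>_const[of y1] t2.hom_mpeval \<Theta>_mconst var12 const_eval)
    moreover have "pCons a r = [:a:] + [:0, 1:] * r" by simp
    ultimately show ?case
      using pCons.IH by (simp only: t1.hom_add t1.hom_mult t2.hom_add t2.hom_mult \<Theta>_X)
  qed
  interpret t1: comm_ring_hom "\<Theta> y1" by (rule hom)
  interpret t2: comm_ring_hom "\<Theta> y2" by (rule hom)
  have "\<Theta> y1 (generic_line v w f) = [:f:]"
    unfolding generic_line_def
    by (simp only: t1.hom_mpeval \<Theta>_mconst var12(1)[unfolded y2_def] const_eval)
  hence prod: "\<Theta> y1 p * \<Theta> y1 q = [:f:]"
    using assms by (simp only: t1.hom_mult)
  have f0: "f \<noteq> 0" using irreducible by auto
  hence "\<Theta> y1 p \<noteq> 0" "\<Theta> y1 q \<noteq> 0" using prod by auto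
  hence "degree (\<Theta> y1 p) + degree (\<Theta> y1 q) = 0"
    using prod by (metis degree_mult_eq degree_pCons_0)
  then obtain a b where ab: "\<Theta> y1 p = [:a:]" "\<Theta> y1 q = [:b:]"
    by (meson add_is_0 degree_eq_zeroE)
  hence "[:f:] = [:a * b:]" using prod by (simp add: mult.commute)
  hence "f = a * b" by simp
  hence "a dvd 1 \<or> b dvd 1" using irreducible irreducibleD by blast
  moreover have unit: "degree r = 0" if "\<Theta> y1 r = [:u:]" "u dvd 1" for r u
  proof -
    have "[:u:] dvd 1" using that(2) by (simp add: is_unit_const_poly_iff)
    hence "\<Theta> y2 [:u:] dvd 1" by (rule t2.hom_dvd_1)
    hence "r dvd 1" unfolding that(1)[symmetric] inv .
    thus ?thesis by (auto simp: is_unit_poly_iff)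
  qed
  ultimately show ?thesis using unit[OF ab(1)] unit[OF ab(2)] by auto
qed

text \<open>Factors over the fraction field have coefficients with a common denominator \<open>b\<close>. After the
  substitution \<open>Z \<mapsto> u + Y Z\<close> with \<open>b(u) \<noteq> 0\<close> the denominator becomes invertible as a power series in \<open>Y\<close>,
  whereas by Gauss's lemma the factors are polynomials in \<open>Y\<close>; so they have coefficients in \<open>k[Z][Y]\<close>,
  and \<open>Y = 1\<close> gives a factorisation over \<open>k[Z]\<close>.\<close>

lemma irreducible_generic_line_fract: "irreducible (map_poly to_fract (generic_line v w f))"
proof (rule irreducibleI)
  let ?F = "generic_line v w f"
  have top0: "top \<noteq> 0" using top_nonzero by (simp add: top_def)
  have F0: "?F \<noteq> 0" using generic_line_degree[of v] degree_pos by auto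
  thus "map_poly to_fract ?F \<noteq> 0" by simp
  have "degree (map_poly to_fract ?F) = d" by (simp add: generic_line_degree)
  thus "\<not> map_poly to_fract ?F dvd 1"
    using degree_pos by (auto simp: is_unit_poly_iff)
  fix G1 G2 assume G: "map_poly to_fract ?F = G1 * G2"
  have G0: "G1 \<noteq> 0" "G2 \<noteq> 0" using F0 G by auto
  show "G1 dvd 1 \<or> G2 dvd 1"
  proof (rule ccontr)
    assume "\<not> ?thesis"
    hence pos: "degree G1 > 0" "degree G2 > 0"
      using G0 by (auto simp: is_unit_field_poly_iff_degree)
    obtain b1 g1 where g1: "b1 \<noteq> 0" "smult (to_fract b1) G1 = map_poly to_fract g1"
      by (rule fract_poly_common_denominator)
    obtain b2 g2 where g2: "b2 \<noteq> 0" "smult (to_fract b2) G2 = map_poly to_fract g2"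
      by (rule fract_poly_common_denominator)
    have deg: "degree g1 > 0" "degree g2 > 0"
    proof -
      have "degree G1 = degree g1" "degree G2 = degree g2"
        using g1 g2 by (metis degree_smult_eq to_fract_eq_0_iff to_fract_hom.degree_map_poly_hom)+
      thus "degree g1 > 0" "degree g2 > 0" using pos by simp_all
    qed
    have "map_poly to_fract (smult (b1 * b2) ?F) = map_poly to_fract (g1 * g2)"
      using G by (simp add: mult_ac flip: g1(2) g2(2))
    hence prod: "smult (b1 * b2) ?F = g1 * g2" by (simp only: fract_poly_eq_iff)
    let ?l1 = "lead_coeff g1" and ?l2 = "lead_coeff g2"
    have l0: "?l1 \<noteq> 0" "?l2 \<noteq> 0" using deg by auto
    hence l12: "?l1 * ?l2 \<noteq> 0" by simp
    \<comment> \<open>The elements to be inverted are the leading coefficients of the cleared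
      factors. Since \<open>b1 * b2 * mconst top = ?l1 * ?l2\<close>, dividing by them makes both
      factors monic and removes the denominators, up to the constant \<open>top\<close>.\<close>
    obtain u where u: "mpeval (\<lambda>a. a) u (?l1 * ?l2) \<noteq> 0"
      using exists_nonzero_mpeval[OF infinite_UNIV_alg_closed l12] by blast
    define \<tau> :: "('n, 'k) mpoly \<Rightarrow> ('n, 'k) mpoly poly"
      where "\<tau> = mpeval (\<lambda>a. [:mconst a:]) (\<lambda>i. [:mconst (u i), mvar i:])"
    interpret c: comm_ring_hom "\<lambda>a. [:mconst a:] :: ('n, 'k) mpoly poly"
      by (rule comm_ring_hom_const_mconst)
    interpret mconst: comm_ring_hom "mconst :: 'k \<Rightarrow> ('n, 'k) mpoly" by (rule comm_ring_hom_mconst)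
    interpret id: comm_ring_hom "\<lambda>a :: 'k. a" by (rule comm_ring_hom_id)
    interpret eval: comm_ring_hom "mpeval (\<lambda>a :: 'k. a) u" by (rule id.comm_ring_hom_mpeval)
    interpret \<tau>: comm_ring_hom \<tau>
      unfolding \<tau>_def by (rule c.comm_ring_hom_mpeval)
    have \<tau>0: "coeff (\<tau> a) 0 = mconst (mpeval (\<lambda>a. a) u a)" for a
      using comm_ring_hom.hom_mpeval[OF comm_ring_hom_poly[of 0], of "\<lambda>a. [:mconst a:]" "\<lambda>i. [:mconst (u i), mvar i:]" a]
      by (simp add: \<tau>_def poly_0_coeff_0 mconst.hom_mpeval)
    have \<tau>1: "poly (\<tau> a) 1 = mpeval mconst (\<lambda>i. mvar i + mconst (u i)) a" for a
      using comm_ring_hom.hom_mpeval[OF comm_ring_hom_poly[of 1], of "\<lambda>a. [:mconst a:]" "\<lambda>i. [:mconst (u i), mvar i:]" a]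
      by (simp add: \<tau>_def add.commute)
    have unit0: "coeff (\<tau> ?l1) 0 dvd 1" "coeff (\<tau> ?l2) 0 dvd 1"
    proof -
      have "mpeval (\<lambda>a. a) u ?l1 dvd 1" "mpeval (\<lambda>a. a) u ?l2 dvd 1"
        using u unfolding eval.hom_mult mult_eq_0_iff dvd_field_iff by blast+
      from this[THEN mconst.hom_dvd_1] show "coeff (\<tau> ?l1) 0 dvd 1" "coeff (\<tau> ?l2) 0 dvd 1"
        unfolding \<tau>0 .
    qed
    hence \<tau>_nz: "\<tau> ?l1 \<noteq> 0" "\<tau> ?l2 \<noteq> 0" by auto
    interpret T: comm_ring_hom "map_poly \<tau>"
      by (rule comm_ring_hom_map_poly) (rule \<tau>.comm_ring_hom_axioms)
    define h1 where "h1 = map_poly \<tau> g1"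
    define h2 where "h2 = map_poly \<tau> g2"
    have coeff_h: "coeff h1 i = \<tau> (coeff g1 i)" "coeff h2 i = \<tau> (coeff g2 i)" for i
      by (simp_all add: h1_def h2_def coeff_map_poly)
    have dh: "degree h1 = degree g1" "degree h2 = degree g2"
    proof -
      have "degree h1 \<le> degree g1" "degree h2 \<le> degree g2"
        by (simp_all add: h1_def h2_def degree_map_poly_le)
      moreover have "degree g1 \<le> degree h1" "degree g2 \<le> degree h2"
        using \<tau>_nz by (auto intro!: le_degree simp: coeff_h)
      ultimately show "degree h1 = degree g1" "degree h2 = degree g2" by auto
    qed
    have prodh: "smult (\<tau> (b1 * b2)) (map_poly \<tau> ?F) = h1 * h2"
      using arg_cong[OF prod, of "map_poly \<tau>"] by (simp add: h1_def h2_def T.hom_mult \<tau>.map_poly_hom_smult)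
    have \<tau>_mconst: "\<tau> (mconst a) = [:mconst a:]" for a
      by (simp add: \<tau>_def)
    have lF: "coeff (map_poly \<tau> ?F) d = [:mconst top:]" "degree (map_poly \<tau> ?F) = d"
    proof -
      show c: "coeff (map_poly \<tau> ?F) d = [:mconst top:]"
        using generic_line_lead_coeff[of v] by (simp add: coeff_map_poly generic_line_degree \<tau>_mconst)
      have "degree (map_poly \<tau> ?F) \<le> d"
        using degree_map_poly_le[of \<tau> ?F] by (simp add: generic_line_degree)
      moreover have "d \<le> degree (map_poly \<tau> ?F)"
      proof (rule le_degree)
        show "coeff (map_poly \<tau> ?F) d \<noteq> 0"
          unfolding c pCons_eq_0_iff mconst_eq_0_iff using top0 by blast
      qed
      ultimately show "degree (map_poly \<tau> ?F) = d" by simp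
    qed
    have "b1 * b2 * mconst top = ?l1 * ?l2"
      using arg_cong[OF prod, of lead_coeff] by (simp only: lead_coeff_smult lead_coeff_mult generic_line_lead_coeff)
    hence \<tau>_lead: "\<tau> (b1 * b2) * [:mconst top:] = \<tau> ?l1 * \<tau> ?l2"
      by (metis \<tau>_mconst \<tau>.hom_mult)
    hence \<tau>b: "\<tau> (b1 * b2) \<noteq> 0"
      using \<tau>_nz by (metis mult_eq_0_iff)
    let ?\<iota> = "map_poly (map_poly to_fract) :: ('n, 'k) mpoly poly poly \<Rightarrow> _"
    interpret fp: inj_comm_ring_hom "map_poly to_fract :: ('n, 'k) mpoly poly \<Rightarrow> _"
      by unfold_locales (auto simp: fract_poly_add)
    interpret fpp: comm_ring_hom ?\<iota>
      by (rule comm_ring_hom_map_poly) (rule fp.comm_ring_hom_axioms)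
    have eqf: "smult (map_poly to_fract (\<tau> (b1 * b2))) (?\<iota> (map_poly \<tau> ?F)) = ?\<iota> h1 * ?\<iota> h2"
      using arg_cong[OF prodh, of ?\<iota>] by (simp only: fp.map_poly_hom_smult fpp.hom_mult)
    have ld: "degree (?\<iota> r) = degree r" for r by (rule fp.degree_map_poly_hom)
    have unitF: "is_unit (lead_coeff (?\<iota> (map_poly \<tau> ?F)))"
    proof -
      have "lead_coeff (?\<iota> (map_poly \<tau> ?F)) = [:to_fract (mconst top):]"
        unfolding ld fp.coeff_map_poly_hom lF
        by (rule map_poly_linear(1)) (rule to_fract_hom.comm_ring_hom_axioms)
      moreover have "to_fract (mconst top) \<noteq> (0 :: ('n, 'k) mpoly fract)"
        using top0 unfolding to_fract_eq_0_iff mconst_eq_0_iff .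
      hence "[:to_fract (mconst top) :: ('n, 'k) mpoly fract:] dvd 1"
        unfolding is_unit_const_poly_iff dvd_field_iff by blast
      ultimately show ?thesis by (rule ssubst)
    qed
    have nz: "map_poly to_fract (\<tau> (b1 * b2)) \<noteq> 0" using \<tau>b by simp
    note gauss1 = lead_coeff_dvd_of_factor[OF eqf nz unitF]
    note gauss2 = lead_coeff_dvd_of_factor[OF eqf[unfolded mult.commute[of "?\<iota> h1"]] nz unitF]
    \<comment> \<open>Gauss's lemma gives divisibility over k(Z)[Y]. As the constant coefficients in
      Y of the divisors are nonzero elements of k, the quotients have coefficients in k[Z].\<close>
    have dvd: "[:\<tau> ?l1:] dvd h1" "[:\<tau> ?l2:] dvd h2"
    proof -
      have "\<tau> ?l1 dvd coeff h1 i" for i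
      proof -
        have "map_poly to_fract (\<tau> ?l1) dvd map_poly to_fract (coeff h1 i)"
          using gauss1 by (simp add: const_poly_dvd_iff ld dh coeff_h)
        thus ?thesis using poly_dvd_if_const_coeff_unit[OF unit0(1)] by (metis dvdE)
      qed
      thus "[:\<tau> ?l1:] dvd h1" by (simp add: const_poly_dvd_iff)
      have "\<tau> ?l2 dvd coeff h2 i" for i
      proof -
        have "map_poly to_fract (\<tau> ?l2) dvd map_poly to_fract (coeff h2 i)"
          using gauss2 by (simp add: const_poly_dvd_iff ld dh coeff_h)
        thus ?thesis using poly_dvd_if_const_coeff_unit[OF unit0(2)] by (metis dvdE)
      qed
      thus "[:\<tau> ?l2:] dvd h2" by (simp add: const_poly_dvd_iff)
    qed
    then obtain p1 p2 where p: "h1 = smult (\<tau> ?l1) p1" "h2 = smult (\<tau> ?l2) p2"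
      by (auto elim!: dvdE)
    have "smult (\<tau> (b1 * b2)) (map_poly \<tau> ?F) = smult (\<tau> ?l1 * \<tau> ?l2) (p1 * p2)"
      using prodh by (simp add: p mult_ac)
    hence "smult (\<tau> (b1 * b2)) (map_poly \<tau> ?F) = smult (\<tau> (b1 * b2)) (smult [:mconst top:] (p1 * p2))"
      by (simp only: smult_smult \<tau>_lead)
    hence "map_poly \<tau> ?F = smult [:mconst top:] (p1 * p2)"
      using \<tau>b by (simp add: smult_cancel)
    hence fac: "map_poly \<tau> ?F = smult [:mconst top:] p1 * p2" by simp
    interpret E: comm_ring_hom "map_poly (\<lambda>q :: ('n, 'k) mpoly poly. poly q 1)"
      by (rule comm_ring_hom_map_poly) (rule comm_ring_hom_poly)
    have fac1: "map_poly (\<lambda>q. poly q 1) (map_poly \<tau> ?F) = map_poly (\<lambda>q. poly q 1) (smult [:mconst top:] p1)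
        * map_poly (\<lambda>q. poly q 1) p2"
      by (simp only: fac E.hom_mult)
    \<comment> \<open>At Y = 1 the substitution is the translation Z \<mapsto> u + Z, so the generic
      line reappears with a shifted base point.\<close>
    have shift: "map_poly (\<lambda>q. poly q 1) (map_poly \<tau> ?F) = generic_line (\<lambda>i. u i + v i) w f"
    proof -
      have \<tau>1_mconst: "poly (\<tau> (mconst a)) 1 = mconst a" for a
        by (simp add: \<tau>_mconst)
      have \<tau>1_var: "poly (\<tau> (mvar i + mconst a)) 1 = mvar i + mconst (u i + a)" for i a
        unfolding \<tau>1 mconst.mpeval_add mconst.mpeval_mvar mconst.mpeval_mconst mconst.hom_add
        by (rule add.assoc)
      show ?thesis
        unfolding generic_line_def T.hom_mpeval E.hom_mpeval map_poly_linear[OF \<tau>.comm_ring_hom_axioms]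
          map_poly_linear[OF comm_ring_hom_poly] \<tau>1_mconst \<tau>1_var by (rule refl)
    qed
    have no: "degree (map_poly (\<lambda>q. poly q 1) (smult [:mconst top:] p1)) = 0 \<or>
        degree (map_poly (\<lambda>q. poly q 1) p2) = 0"
      by (rule generic_line_no_factorization[OF trans[OF shift[symmetric] fac1]])
    \<comment> \<open>The two factors have leading coefficients \<open>top\<close> and 1 in X, so
      putting Y = 1 does not lower their degrees.\<close>
    have "coeff (map_poly (\<lambda>q. poly q 1) (smult [:mconst top:] p1)) (degree g1) = mconst top"
      "coeff (map_poly (\<lambda>q. poly q 1) p2) (degree g2) = 1"
    proof -
      have "\<tau> ?l1 * coeff p1 (degree g1) = \<tau> ?l1 * 1" "\<tau> ?l2 * coeff p2 (degree g2) = \<tau> ?l2 * 1"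
        using arg_cong[OF p(1), of "\<lambda>q. coeff q (degree g1)"] arg_cong[OF p(2), of "\<lambda>q. coeff q (degree g2)"]
        by (simp_all add: coeff_h)
      hence "coeff p1 (degree g1) = 1" "coeff p2 (degree g2) = 1"
        using \<tau>_nz by (simp_all only: mult_cancel_left) auto
      thus "coeff (map_poly (\<lambda>q. poly q 1) (smult [:mconst top:] p1)) (degree g1) = mconst top"
        "coeff (map_poly (\<lambda>q. poly q 1) p2) (degree g2) = 1"
        by (simp_all add: coeff_map_poly)
    qed
    hence "degree g1 \<le> degree (map_poly (\<lambda>q. poly q 1) (smult [:mconst top:] p1))"
      "degree g2 \<le> degree (map_poly (\<lambda>q. poly q 1) p2)"
      using top0 by (intro le_degree; simp only: mconst_eq_0_iff zero_neq_one[symmetric] not_False_eq_True)+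
    with no deg show False by linarith
  qed
qed

end

section \<open>Hensel lifting and bivariate polynomials\<close>

lemma fps_X_power_dvd_iff: "fps_X ^ n dvd (a :: 's::comm_ring_1 fps) \<longleftrightarrow> (\<forall>k<n. fps_nth a k = 0)"
proof
  assume "\<forall>k<n. fps_nth a k = 0"
  hence "a = fps_X ^ n * fps_shift n a"
    by (intro fps_ext) (simp add: fps_X_power_mult_nth)
  thus "fps_X ^ n dvd a" by (rule dvdI)
next
  assume "fps_X ^ n dvd a"
  then obtain b where "a = fps_X ^ n * b" by (rule dvdE)
  thus "\<forall>k<n. fps_nth a k = 0" by (simp add: fps_X_power_mult_nth)
qed

lemma poly_taylor_2:
  fixes p :: "'s::idom poly"
  shows "\<exists>r. poly p (a + h) = poly p a + h * poly (pderiv p) a + h\<^sup>2 * r"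
proof (induction p)
  case (pCons c p)
  then obtain r where r: "poly p (a + h) = poly p a + h * poly (pderiv p) a + h\<^sup>2 * r" by blast
  have "poly (pCons c p) (a + h) = poly (pCons c p) a + h * poly (pderiv (pCons c p)) a
      + h\<^sup>2 * (poly (pderiv p) a + a * r + h * r)"
    by (simp add: r pderiv_pCons algebra_simps power2_eq_square)
  thus ?case by blast
qed (auto intro: exI[of _ 0])

lemma dvd_poly_diff:
  fixes p :: "'s::idom poly"
  shows "a - b dvd poly p a - poly p b"
proof -
  obtain r where "poly p (b + (a - b)) = poly p b + (a - b) * poly (pderiv p) b + (a - b)\<^sup>2 * r"
    using poly_taylor_2 by blast
  hence "poly p a - poly p b = (a - b) * (poly (pderiv p) b + (a - b) * r)"
    by (simp add: algebra_simps power2_eq_square)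
  thus ?thesis by (rule dvdI)
qed

text \<open>Newton iteration with the inverse \<open>e\<close> of the derivative frozen at
  \<open>x0\<close>: each step gains one order in Y. Because \<open>e\<close> is a constant of
  weight 0, no division takes place and all iterates stay in the subring where the coefficient at
  Y^k has weight at most k.\<close>

lemma hensel_root:
  fixes p :: "'s::idom fps poly"
  assumes P: "filtration P" and coeffs: "\<And>i k. P k (fps_nth (coeff p i) k)"
    and x0: "P 0 x0" and e: "P 0 e"
    and root: "fps_nth (poly p (fps_const x0)) 0 = 0"
    and deriv: "fps_nth (poly (pderiv p) (fps_const x0)) 0 * e = 1"
  obtains A where "poly p A = 0" "fps_nth A 0 = x0" "\<And>k. P k (fps_nth A k)"
proof -
  define it where "it n = ((\<lambda>a. a - fps_const e * poly p a) ^^ n) (fps_const x0)" for n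
  have it_0: "it 0 = fps_const x0" and it_Suc: "it (Suc n) = it n - fps_const e * poly p (it n)" for n
    by (simp_all add: it_def)
  interpret n0: comm_ring_hom "\<lambda>a :: 's fps. fps_nth a 0" by (rule comm_ring_hom_fps_nth_0)
  have at0: "fps_nth (poly q a) 0 = fps_nth (poly q (fps_const x0)) 0" if "fps_nth a 0 = x0" for q a
    using n0.poly_map_poly[of q a] n0.poly_map_poly[of q "fps_const x0"] that by simp
  have inv: "fps_nth (it n) 0 = x0 \<and> fps_X ^ Suc n dvd poly p (it n)" for n
  proof (induction n)
    case 0
    show ?case using root unfolding it_0 fps_X_power_dvd_iff by simp
  next
    case (Suc n)
    let ?a = "it n" and ?h = "- (fps_const e * poly p (it n))"
    obtain r where r: "poly p (?a + ?h) = poly p ?a + ?h * poly (pderiv p) ?a + ?h\<^sup>2 * r"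
      using poly_taylor_2 by blast
    have "poly p (it (Suc n)) = poly p ?a * (1 - fps_const e * poly (pderiv p) ?a)
        + poly p ?a * poly p ?a * ((fps_const e)\<^sup>2 * r)"
      using r by (simp add: it_Suc algebra_simps power2_eq_square)
    moreover have "fps_X ^ 1 dvd 1 - fps_const e * poly (pderiv p) ?a"
      unfolding fps_X_power_dvd_iff using at0[of ?a "pderiv p"] Suc deriv by (simp add: mult.commute)
    hence "fps_X ^ Suc n * fps_X ^ 1 dvd poly p ?a * (1 - fps_const e * poly (pderiv p) ?a)"
      using Suc by (intro mult_dvd_mono) auto
    moreover have "fps_X ^ Suc n * fps_X ^ 1 dvd poly p ?a * poly p ?a"
      using Suc by (intro mult_dvd_mono) (auto intro: dvd_trans[OF le_imp_power_dvd])
    ultimately have "fps_X ^ Suc n * fps_X ^ 1 dvd poly p (it (Suc n))"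
      by (simp only: dvd_add dvd_mult2)
    hence "fps_X ^ Suc (Suc n) dvd poly p (it (Suc n))" by (simp add: mult_ac)
    moreover have "fps_nth (poly p ?a) 0 = 0" using Suc at0[of ?a p] root by simp
    ultimately show ?case using Suc by (simp add: it_Suc del: power_Suc)
  qed
  define A where "A = Abs_fps (\<lambda>k. fps_nth (it k) k)"
  have stable: "fps_nth (it n) k = fps_nth (it k) k" if "k \<le> n" for n k
    using that
  proof (induction n rule: dec_induct)
    case (step n)
    have "fps_X ^ Suc n dvd fps_const e * poly p (it n)" using inv[of n] by (simp add: dvd_mult)
    hence "fps_nth (fps_const e * poly p (it n)) k = 0"
      using step(1) by (simp add: fps_X_power_dvd_iff del: power_Suc fps_mult_left_const_nth)
    with step show ?case by (simp add: it_Suc)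
  qed simp
  have "poly p A = 0"
  proof (rule fps_ext)
    fix n
    have "fps_X ^ Suc n dvd A - it n"
      unfolding fps_X_power_dvd_iff
    proof (intro allI impI)
      fix k assume "k < Suc n"
      with stable[of k n] show "fps_nth (A - it n) k = 0" by (simp add: A_def)
    qed
    hence "fps_X ^ Suc n dvd (poly p A - poly p (it n)) + poly p (it n)"
      using inv[of n] dvd_poly_diff[of A "it n" p] dvd_trans by (blast intro: dvd_add)
    thus "fps_nth (poly p A) n = fps_nth 0 n"
      by (simp add: fps_X_power_dvd_iff del: power_Suc)
  qed
  moreover have "fps_nth A 0 = x0" by (simp add: A_def it_0)
  moreover have "P k (fps_nth A k)" for k
  proof -
    interpret P: filtration P by fact
    interpret Q: filtration "\<lambda>_ a. \<forall>k. P k (fps_nth a k)" by (rule filtration_fps[OF P])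
    have const: "\<forall>k. P k (fps_nth (fps_const c) k)" if "P 0 c" for c
      using that P.zero by auto
    have "\<forall>k. P k (fps_nth (it n) k)" for n
    proof (induction n)
      case (Suc n)
      have "\<forall>k. P k (fps_nth (poly p (it n)) k)"
        unfolding poly_altdef
        by (rule Q.sum, rule Q.mult) (use coeffs Q.power[OF Suc] in auto)
      thus ?case unfolding it_Suc by (intro Q.diff Suc Q.mult[OF const[OF e]])
    qed (simp add: it_0 const x0 del: fps_nth_fps_const)
    thus ?thesis by (simp add: A_def)
  qed
  ultimately show thesis by (rule that)
qed

text \<open>Over a domain the degrees in Y add: the coefficient of the top power of Y, as a
  polynomial in X, is nonzero for each factor, and the product of the two is the coefficient of the
  sum of these powers in the product.\<close>

lemma inner_degree_add:
  fixes p q :: "'s::idom poly poly"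
  assumes "p \<noteq> 0" "q \<noteq> 0" and deg: "\<And>i. degree (coeff (p * q) i) \<le> d"
  obtains a b where "\<And>i. degree (coeff p i) \<le> a" "\<And>i. degree (coeff q i) \<le> b" "a + b \<le> d"
proof -
  have max: "\<exists>a. (\<forall>i. degree (coeff r i) \<le> a) \<and> map_poly (\<lambda>c. coeff c a) r \<noteq> 0"
    if "r \<noteq> 0" for r :: "'s poly poly"
  proof -
    let ?N = "(\<lambda>i. degree (coeff r i)) ` {i. i \<le> degree r \<and> coeff r i \<noteq> 0}"
    have "degree r \<in> {i. i \<le> degree r \<and> coeff r i \<noteq> 0}" using that by simp
    hence N: "finite ?N" "?N \<noteq> {}" by (auto intro: finite_subset[of _ "{..degree r}"])
    have le: "degree (coeff r i) \<le> Max ?N" for i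
    proof (cases "coeff r i = 0")
      case False
      hence "i \<le> degree r" by (rule le_degree)
      thus ?thesis using False N(1) by (intro Max_ge) auto
    qed simp
    obtain i where "Max ?N = degree (coeff r i)" "coeff r i \<noteq> 0"
      using Max_in[OF N] by auto
    hence "coeff (map_poly (\<lambda>c. coeff c (Max ?N)) r) i \<noteq> 0"
      by (simp add: coeff_map_poly)
    thus ?thesis using le by (intro exI[of _ "Max ?N"]) auto
  qed
  obtain a where a: "\<And>i. degree (coeff p i) \<le> a" "map_poly (\<lambda>c. coeff c a) p \<noteq> 0"
    using max[OF assms(1)] by blast
  obtain b where b: "\<And>i. degree (coeff q i) \<le> b" "map_poly (\<lambda>c. coeff c b) q \<noteq> 0"
    using max[OF assms(2)] by blast
  have "coeff (coeff (p * q) n) (a + b) = (\<Sum>i\<le>n. coeff (coeff p i) a * coeff (coeff q (n - i)) b)" for n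
    unfolding coeff_mult[of p q n] coeff_sum by (intro sum.cong refl coeff_mult_degree_le_sum a(1) b(1))
  hence "map_poly (\<lambda>c. coeff c (a + b)) (p * q) = map_poly (\<lambda>c. coeff c a) p * map_poly (\<lambda>c. coeff c b) q"
    by (intro poly_eqI) (simp only: coeff_map_poly coeff_0 coeff_mult[of "map_poly _ _"])
  hence "map_poly (\<lambda>c. coeff c (a + b)) (p * q) \<noteq> 0" using a b by simp
  hence "lead_coeff (map_poly (\<lambda>c. coeff c (a + b)) (p * q)) \<noteq> 0" by simp
  then obtain i where "coeff (coeff (p * q) i) (a + b) \<noteq> 0"
    unfolding coeff_map_poly[of "\<lambda>c. coeff c (a + b)", OF coeff_0] by blast
  hence "a + b \<le> d" using le_degree deg le_trans by blast
  with a(1) b(1) show thesis by (rule that)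
qed

section \<open>Polynomials given by their roots\<close>

definition prod_roots :: "'s::idom \<Rightarrow> ('i \<Rightarrow> 's) \<Rightarrow> 'i set \<Rightarrow> 's poly" where
  "prod_roots c A S = smult c (\<Prod>t\<in>S. [:- A t, 1:])"

lemma degree_prod_roots: "c \<noteq> 0 \<Longrightarrow> finite S \<Longrightarrow> degree (prod_roots c A S) = card S"
  by (simp add: prod_roots_def degree_prod_eq_sum_degree)

lemma coeff_prod_roots_card: "finite S \<Longrightarrow> coeff (prod_roots c A S) (card S) = c"
proof -
  assume "finite S"
  hence deg: "degree (\<Prod>t\<in>S. [:- A t, 1:]) = card S"
    by (simp add: degree_prod_eq_sum_degree)
  have "lead_coeff (\<Prod>t\<in>S. [:- A t, 1:]) = 1"
    by (simp add: lead_coeff_prod)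
  thus ?thesis unfolding deg by (simp add: prod_roots_def)
qed

lemma poly_prod_roots_eq_0_iff:
  "finite S \<Longrightarrow> c \<noteq> 0 \<Longrightarrow> poly (prod_roots c A S) x = 0 \<longleftrightarrow> (\<exists>t\<in>S. x = A t)"
  by (auto simp: prod_roots_def poly_prod)

lemma poly_pderiv_prod_roots:
  assumes "finite S" "s \<in> S"
  shows "poly (pderiv (prod_roots c A S)) (A s) = poly (prod_roots c A (S - {s})) (A s)"
proof -
  have eq: "prod_roots c A S = [:- A s, 1:] * prod_roots c A (S - {s})"
    unfolding prod_roots_def prod.remove[OF assms] by (rule mult_smult_right[symmetric])
  show ?thesis unfolding eq pderiv_mult poly_add poly_mult by (simp add: pderiv_pCons)
qed

lemma eq_prod_roots:
  fixes p :: "'s::idom poly"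
  assumes "finite S" "inj_on A S" "degree p = card S" "\<And>s. s \<in> S \<Longrightarrow> poly p (A s) = 0"
  shows "p = prod_roots (lead_coeff p) A S"
proof (rule poly_eqI_degree_lead_coeff[where n = "card S" and A = "A ` S"])
  show "coeff p (card S) = coeff (prod_roots (lead_coeff p) A S) (card S)"
    using assms by (simp add: coeff_prod_roots_card)
  show "degree (prod_roots (lead_coeff p) A S) \<le> card S"
    unfolding prod_roots_def
    by (rule order_trans[OF degree_smult_le]) (simp add: degree_prod_eq_sum_degree)
  show "poly p x = poly (prod_roots (lead_coeff p) A S) x" if "x \<in> A ` S" for x
  proof -
    from that obtain s where s: "x = A s" "s \<in> S" by (rule imageE)
    hence "poly (prod_roots (lead_coeff p) A S) x = 0"
      using assms(1) by (auto simp: prod_roots_def poly_prod)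
    thus ?thesis using assms(4) s by simp
  qed
qed (use assms in \<open>auto simp: card_image\<close>)

lemma hom_prod_roots:
  assumes "comm_ring_hom h"
  shows "map_poly h (prod_roots c A S) = prod_roots (h c) (\<lambda>s. h (A s)) S"
proof -
  interpret h: comm_ring_hom h by fact
  interpret H: comm_ring_hom "map_poly h" by (rule comm_ring_hom_map_poly[OF assms])
  show ?thesis
    by (simp add: prod_roots_def h.map_poly_hom_smult H.hom_prod map_poly_linear[OF assms] h.hom_uminus)
qed

section \<open>Plane sections\<close>

text \<open>The section f(v + Y z + X w), with inner variable Y and outer variable X. The direction
  \<open>w\<close> of X and the base point are fixed before the direction \<open>z\<close> of Y,
  which is the one made generic.\<close>

definition plane_section ::
  "('k \<Rightarrow> 's) \<Rightarrow> ('n \<Rightarrow> 's) \<Rightarrow> ('n \<Rightarrow> 's) \<Rightarrow> ('n \<Rightarrow> 's) \<Rightarrow> ('n::finite, 'k::zero) mpoly \<Rightarrow> 's::comm_ring_1 poly poly" where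
  "plane_section c v z w = mpeval (\<lambda>a. [:[:c a:]:]) (\<lambda>i. [:[:v i, z i:], [:w i:]:])"

lemma comm_ring_hom_const_const:
  assumes "comm_ring_hom c"
  shows "comm_ring_hom (\<lambda>a. [:[:c a:]:])" "comm_ring_hom (\<lambda>a. [:c a:])"
  by (rule comm_ring_hom_comp[OF comm_ring_hom_const_poly comm_ring_hom_comp[OF comm_ring_hom_const_poly assms]],
      rule comm_ring_hom_comp[OF comm_ring_hom_const_poly assms])

lemma is_unit_poly_degree: "(p :: 's::idom poly) dvd 1 \<Longrightarrow> degree p = 0"
  by (auto simp: is_unit_poly_iff)

lemma plane_section_degree_le:
  assumes "comm_ring_hom c" "degree_le d f"
  shows "degree (plane_section c v z w f) \<le> d"
    and "coeff (plane_section c v z w f) d = [:mpeval c w (homogeneous_part d f):]"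
proof -
  note lin = mpeval_linear_poly[OF comm_ring_hom_const_const(2)[OF assms(1)] assms(2),
    of "\<lambda>i. [:v i, z i:]" "\<lambda>i. [:w i:]", folded plane_section_def]
  from lin(1) show "degree (plane_section c v z w f) \<le> d" .
  show "coeff (plane_section c v z w f) d = [:mpeval c w (homogeneous_part d f):]"
    unfolding lin(2) by (rule comm_ring_hom.hom_mpeval[OF comm_ring_hom_const_poly, symmetric])
qed

lemma plane_section_inner_degree_le:
  assumes "degree_le d f"
  shows "degree (coeff (plane_section c v z w f) i) \<le> d"
proof -
  interpret filtration "\<lambda>d p. \<forall>i. degree (coeff p i) \<le> d"
    by (rule filtration_coeffs[OF filtration_degree])
  have "\<forall>i. degree (coeff (plane_section c v z w f) i) \<le> d"
    unfolding plane_section_def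
    by (rule mpeval[OF _ _ assms]) (simp_all add: coeff_pCons split: nat.split)
  thus ?thesis by blast
qed

lemma hom_plane_section:
  assumes "comm_ring_hom h"
  shows "map_poly (map_poly h) (plane_section c v z w f) =
    plane_section (\<lambda>a. h (c a)) (\<lambda>i. h (v i)) (\<lambda>i. h (z i)) (\<lambda>i. h (w i)) f"
  unfolding plane_section_def
    comm_ring_hom.hom_mpeval[OF comm_ring_hom_map_poly[OF comm_ring_hom_map_poly[OF assms]]]
    map_poly_linear[OF comm_ring_hom_map_poly[OF assms]] map_poly_linear[OF assms] by (rule refl)

context irreducible_form
begin

abbreviation generic_plane :: "('n \<Rightarrow> 'k) \<Rightarrow> ('n, 'k) mpoly poly poly" where
  "generic_plane v \<equiv> plane_section mconst (\<lambda>i. mconst (v i)) mvar (\<lambda>i. mconst (w i)) f"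

lemma mconst_top_nonzero: "mconst top \<noteq> (0 :: ('n, 'k) mpoly)"
  using top_nonzero unfolding mconst_eq_0_iff top_def .

lemma mpeval_mconst_top: "mpeval mconst (\<lambda>i. mconst (w i)) (homogeneous_part d f) = (mconst top :: ('n, 'k) mpoly)"
  unfolding top_def by (rule comm_ring_hom.hom_mpeval[OF comm_ring_hom_mconst, symmetric])

lemma degree_generic_plane: "degree (generic_plane v) = d"
  and coeff_generic_plane: "coeff (generic_plane v) d = [:mconst top:]"
proof -
  note le = plane_section_degree_le[OF comm_ring_hom_mconst degree_le]
  show c: "coeff (generic_plane v) d = [:mconst top:]"
    unfolding le(2) mpeval_mconst_top by (rule refl)
  have "d \<le> degree (generic_plane v)"
    by (rule le_degree) (use mconst_top_nonzero in \<open>simp only: c pCons_eq_0_iff simp_thms\<close>)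
  with le(1) show "degree (generic_plane v) = d" by (rule antisym)
qed

lemma generic_plane_at_1: "map_poly (\<lambda>q. poly q 1) (generic_plane v) = generic_line v w f"
  unfolding plane_section_def generic_line_def
    comm_ring_hom.hom_mpeval[OF comm_ring_hom_map_poly[OF comm_ring_hom_poly]]
    map_poly_linear[OF comm_ring_hom_poly] by (simp add: add.commute)

text \<open>At Y = 1 the section becomes the generic line. The leading coefficient in X is a nonzero
  constant, so those of the factors are constants too and putting Y = 1 preserves degrees in X; a
  factor that becomes a unit is thus its own leading coefficient.\<close>

lemma irreducible_generic_plane_fract:
  "irreducible (map_poly (map_poly to_fract) (generic_plane v))" (is "irreducible ?G")
proof (rule irreducibleI)
  interpret fp: comm_ring_hom "map_poly to_fract :: ('n, 'k) mpoly poly \<Rightarrow> _"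
    by (rule comm_ring_hom_map_poly) (rule to_fract_hom.comm_ring_hom_axioms)
  interpret E: comm_ring_hom "map_poly (\<lambda>q :: ('n, 'k) mpoly fract poly. poly q 1)"
    by (rule comm_ring_hom_map_poly[OF comm_ring_hom_poly])
  have top: "to_fract (mconst top :: ('n, 'k) mpoly) \<noteq> 0"
    using mconst_top_nonzero unfolding to_fract_eq_0_iff .
  have cG: "coeff ?G d = [:to_fract (mconst top):]"
    unfolding fp.coeff_map_poly_hom coeff_generic_plane by (rule map_poly_linear[OF to_fract_hom.comm_ring_hom_axioms])
  have dG: "degree ?G = d"
  proof (rule antisym)
    show "degree ?G \<le> d" using degree_map_poly_le[of "map_poly to_fract" "generic_plane v"]
      unfolding degree_generic_plane .
    show "d \<le> degree ?G"
      by (rule le_degree) (use top in \<open>simp only: cG pCons_eq_0_iff simp_thms\<close>)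
  qed
  show "?G \<noteq> 0" using dG degree_pos by (metis degree_0 less_irrefl)
  show "\<not> ?G dvd 1"
  proof
    assume "?G dvd 1"
    hence "degree ?G = 0" by (rule is_unit_poly_degree)
    thus False using dG degree_pos by simp
  qed
  have EG: "map_poly (\<lambda>q. poly q 1) ?G = map_poly to_fract (generic_line v w f)"
  proof -
    have "map_poly (\<lambda>q. poly q 1) ?G = map_poly to_fract (map_poly (\<lambda>q. poly q 1) (generic_plane v))"
      using to_fract_hom.poly_map_poly[of _ 1] by (intro poly_eqI) (simp add: coeff_map_poly)
    thus ?thesis unfolding generic_plane_at_1 .
  qed
  fix h u assume hu: "?G = h * u"
  have h0: "h \<noteq> 0" "u \<noteq> 0" using hu \<open>?G \<noteq> 0\<close> by auto
  have "lead_coeff h * lead_coeff u = [:to_fract (mconst top):]"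
    using hu cG dG by (metis lead_coeff_mult)
  moreover have "[:to_fract (mconst top :: ('n, 'k) mpoly):] dvd 1"
    using top by (simp add: is_unit_field_poly_iff_degree)
  ultimately have lc: "lead_coeff h dvd 1" "lead_coeff u dvd 1"
    by (metis dvd_mult_left, metis dvd_mult_right)
  have unit: "r dvd 1" if "lead_coeff r dvd 1" "map_poly (\<lambda>q. poly q 1) r dvd 1"
    for r :: "('n, 'k) mpoly fract poly poly"
  proof -
    from that(1) have "\<exists>c. lead_coeff r = [:c:] \<and> c dvd 1"
      by (simp only: is_unit_poly_iff)
    then obtain c where c: "lead_coeff r = [:c:]" "c dvd 1" by blast
    have "coeff (map_poly (\<lambda>q. poly q 1) r) (degree r) = c"
      using c by (simp add: coeff_map_poly)
    hence "degree r \<le> degree (map_poly (\<lambda>q. poly q 1) r)"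
      using c(2) by (intro le_degree) (metis not_is_unit_0)
    also have "\<dots> = 0" using that(2) by (rule is_unit_poly_degree)
    finally have "degree r = 0" by simp
    then obtain e where "r = [:e:]" by (rule degree_eq_zeroE)
    thus ?thesis using that(1) by (simp add: is_unit_const_poly_iff)
  qed
  have "map_poly (\<lambda>q. poly q 1) h * map_poly (\<lambda>q. poly q 1) u = map_poly to_fract (generic_line v w f)"
    using EG hu by (simp only: E.hom_mult)
  hence "map_poly (\<lambda>q. poly q 1) h dvd 1 \<or> map_poly (\<lambda>q. poly q 1) u dvd 1"
    using irreducibleD[OF irreducible_generic_line_fract] by metis
  thus "h dvd 1 \<or> u dvd 1"
    using unit[OF lc(1)] unit[OF lc(2)] by blast
qed

text \<open>Over k(Z)[Y] the irreducible section is prime. It has degree \<open>d\<close> in X,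
  hence divides neither \<open>W\<close> nor a nonzero \<open>b\<close>, both of smaller
  degree.\<close>

lemma generic_plane_coprime:
  assumes "degree W < d" "W \<noteq> 0" "a * generic_plane v + b * W = 0"
    and "\<And>i. i \<ge> d \<Longrightarrow> coeff b i = 0"
  shows "a = 0 \<and> b = 0"
proof -
  let ?\<iota> = "map_poly (map_poly to_fract) :: ('n, 'k) mpoly poly poly \<Rightarrow> _"
  interpret fp: inj_comm_ring_hom "map_poly to_fract :: ('n, 'k) mpoly poly \<Rightarrow> _"
    by unfold_locales (auto simp: fract_poly_add)
  interpret fpp: comm_ring_hom ?\<iota>
    by (rule comm_ring_hom_map_poly) (rule fp.comm_ring_hom_axioms)
  have ld: "degree (?\<iota> r) = degree r" for r by (rule fp.degree_map_poly_hom)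
  have inj0: "r = 0" if "?\<iota> r = 0" for r
  proof (rule poly_eqI)
    fix n show "coeff r n = coeff 0 n"
      using arg_cong[OF that, of "\<lambda>q. coeff q n"] unfolding fp.coeff_map_poly_hom by simp
  qed
  have G0: "generic_plane v \<noteq> 0"
    using degree_generic_plane[of v] degree_pos by auto
  have "b = 0"
  proof (rule ccontr)
    assume "b \<noteq> 0"
    hence "degree b < d" using assms(4)[of "degree b"] by (meson leading_coeff_0_iff not_le)
    have "?\<iota> (generic_plane v) * ?\<iota> (- a) = ?\<iota> b * ?\<iota> W"
      using assms(3) unfolding fpp.hom_mult[symmetric]
      by (intro arg_cong[where f = ?\<iota>]) (simp add: algebra_simps add_eq_0_iff)
    hence "?\<iota> (generic_plane v) dvd ?\<iota> b * ?\<iota> W" by (metis dvd_triv_left)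
    hence "?\<iota> (generic_plane v) dvd ?\<iota> b \<or> ?\<iota> (generic_plane v) dvd ?\<iota> W"
      by (rule prime_elem_dvd_multD[OF irreducible_imp_prime_elem[OF irreducible_generic_plane_fract]])
    thus False
    proof
      assume "?\<iota> (generic_plane v) dvd ?\<iota> b"
      moreover have "?\<iota> b \<noteq> 0" using inj0 \<open>b \<noteq> 0\<close> by blast
      ultimately have "degree (?\<iota> (generic_plane v)) \<le> degree (?\<iota> b)" by (rule dvd_imp_degree_le)
      thus False using \<open>degree b < d\<close> by (simp only: ld degree_generic_plane)
    next
      assume "?\<iota> (generic_plane v) dvd ?\<iota> W"
      moreover have "?\<iota> W \<noteq> 0" using inj0 assms(2) by blast
      ultimately have "degree (?\<iota> (generic_plane v)) \<le> degree (?\<iota> W)" by (rule dvd_imp_degree_le)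
      thus False using assms(1) by (simp only: ld degree_generic_plane)
    qed
  qed
  with assms(3) G0 show ?thesis by simp
qed

end

section \<open>Reducible plane sections lie on a hypersurface\<close>

definition line_section ::
  "('n \<Rightarrow> 'k) \<Rightarrow> ('n \<Rightarrow> 'k) \<Rightarrow> ('n::finite, 'k::comm_ring_1) mpoly \<Rightarrow> 'k poly" where
  "line_section v w = mpeval (\<lambda>a. [:a:]) (\<lambda>i. [:v i, w i:])"

lemma mconst_eq_iff: "mconst a = mconst b \<longleftrightarrow> a = b"
  unfolding mconst_def by (metis lookup_single_eq)

text \<open>Only the inner variable Y passes to power series, which is where the branches live; X
  stays polynomial.\<close>

definition hat :: "'s::comm_ring_1 poly poly \<Rightarrow> 's fps poly" where
  "hat = map_poly fps_of_poly"

lemma comm_ring_hom_hat: "comm_ring_hom hat"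
  unfolding hat_def by (rule comm_ring_hom_map_poly[OF comm_ring_hom_fps_of_poly])

lemma coeff_hat: "coeff (hat p) i = fps_of_poly (coeff p i)"
  by (simp add: hat_def coeff_map_poly)

lemma degree_hat: "degree (hat p) = degree p"
proof (rule antisym)
  show "degree (hat p) \<le> degree p" unfolding hat_def by (rule degree_map_poly_le)
  show "degree p \<le> degree (hat p)"
  proof (cases "p = 0")
    case False
    hence "fps_nth (coeff (hat p) (degree p)) (degree (lead_coeff p)) \<noteq> 0"
      by (simp add: coeff_hat)
    thus ?thesis by (intro le_degree) force
  qed simp
qed

lemma map_poly_pderiv:
  fixes p :: "'s::idom poly" and h :: "'s \<Rightarrow> 't::idom"
  assumes "comm_ring_hom h"
  shows "map_poly h (pderiv p) = pderiv (map_poly h p)"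
proof (rule poly_eqI)
  interpret h: comm_ring_hom h by fact
  fix n show "coeff (map_poly h (pderiv p)) n = coeff (pderiv (map_poly h p)) n"
    by (simp add: coeff_pderiv h.hom_mult h.hom_of_nat h.hom_add)
qed

lemma poly_hat_at_0:
  "map_poly (\<lambda>a. fps_nth a 0) (hat p) = map_poly (\<lambda>q. poly q 0) p"
  by (rule poly_eqI) (simp add: coeff_map_poly coeff_hat poly_0_coeff_0)

lemma plane_section_at_0:
  assumes "comm_ring_hom c"
  shows "map_poly (\<lambda>q. poly q 0) (plane_section c (\<lambda>i. c (v i)) z (\<lambda>i. c (w i)) f)
    = map_poly c (line_section v w f)"
  unfolding plane_section_def line_section_def
    comm_ring_hom.hom_mpeval[OF comm_ring_hom_map_poly[OF comm_ring_hom_poly]]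
    comm_ring_hom.hom_mpeval[OF comm_ring_hom_map_poly[OF assms]]
    map_poly_linear[OF comm_ring_hom_poly] map_poly_linear[OF assms] by simp

lemma dvd_poly_if_dvd_coeffs:
  fixes p :: "'s::comm_ring_1 poly"
  assumes "\<And>i. a dvd coeff p i"
  shows "a dvd poly p x"
  unfolding poly_altdef by (intro dvd_sum dvd_mult2 assms)

definition truncate :: "nat \<Rightarrow> 's::comm_ring_1 fps \<Rightarrow> 's poly" where
  "truncate n a = (\<Sum>k\<le>n. monom (fps_nth a k) k)"

lemma coeff_truncate: "coeff (truncate n a) k = (if k \<le> n then fps_nth a k else 0)"
  by (simp add: truncate_def coeff_sum)

lemma degree_truncate: "degree (truncate n a) \<le> n"
  by (rule degree_le) (simp add: coeff_truncate)

context irreducible_form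
begin

text \<open>The Sylvester matrix for degrees d and d - 1 in X has size 2d - 1. With entries of
  degree at most d in Y, its determinant has degree at most (2d - 1)d, and so is zero once it
  vanishes to this order.\<close>

definition precision :: nat where
  "precision = (2 * d - 1) * d + 1"

text \<open>If the sum of cofactors \<open>\<Sum> \<mu>\<^sub>s g\<^sub>s\<close>, with \<open>g\<^sub>s = g / (X - A\<^sub>s)\<close>, is modulo \<open>Y\<close>-high order a polynomial \<open>W\<close>, then
  \<open>W\<close> vanishes to high order along the branch \<open>A\<^sub>s\<close> for which \<open>\<mu>\<^sub>s = 0\<close>. A resultant bound then shows
  that \<open>W\<close> and the irreducible \<open>g\<close> have a common factor.\<close>

lemma generic_kernel_trivial:
  fixes A :: "'k \<Rightarrow> ('n, 'k) mpoly fps"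
  assumes S: "finite S" "card S = d" "x0 \<in> S"
    and A0: "\<And>x. x \<in> S \<Longrightarrow> fps_nth (A x) 0 = mconst x"
    and G: "hat (generic_plane v) = prod_roots (fps_const (mconst top)) A S"
    and \<mu>0: "\<mu> x0 = 0"
    and ker: "\<And>i k. i < d \<Longrightarrow> d < k \<Longrightarrow> k < precision \<Longrightarrow>
      (\<Sum>s\<in>S. fps_nth (coeff (prod_roots (fps_const (mconst top)) A (S - {s})) i) k * \<mu> s) = 0"
    and s: "s \<in> S"
  shows "\<mu> s = 0"
proof -
  define g where "g s = prod_roots (fps_const (mconst top)) A (S - {s})" for s
  define W0 where "W0 = (\<Sum>s\<in>S. smult (fps_const (\<mu> s)) (g s))"
  define W where "W = map_poly (truncate d) W0"
  have topf: "fps_const (mconst top) \<noteq> (0 :: ('n, 'k) mpoly fps)"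
    using mconst_top_nonzero by simp
  have degW0: "degree W0 \<le> d - 1"
    unfolding W0_def
  proof (rule degree_sum_le[OF S(1)])
    fix s assume "s \<in> S"
    have "degree (smult (fps_const (\<mu> s)) (g s)) \<le> degree (g s)" by (rule degree_smult_le)
    also have "\<dots> = d - 1"
      unfolding g_def using S \<open>s \<in> S\<close> by (subst degree_prod_roots[OF topf]) auto
    finally show "degree (smult (fps_const (\<mu> s)) (g s)) \<le> d - 1" .
  qed
  have trunc0: "truncate d 0 = (0 :: ('n, 'k) mpoly poly)" by (simp add: truncate_def)
  have degW: "degree W \<le> d - 1"
    unfolding W_def using degree_map_poly_le[of "truncate d" W0] degW0 by (rule le_trans)
  have coeffW: "coeff W i = truncate d (coeff W0 i)" for i
    unfolding W_def by (simp add: coeff_map_poly trunc0)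
  have nthW0: "fps_nth (coeff W0 i) k = (\<Sum>s\<in>S. fps_nth (coeff (g s) i) k * \<mu> s)" for i k
    by (simp add: W0_def coeff_sum fps_sum_nth mult.commute)
  \<comment> \<open>Truncating after Y^d discards coefficients that vanish by hypothesis up to
    \<open>precision\<close>, so it changes only terms of at least that order.\<close>
  have close: "fps_X ^ precision dvd coeff (hat W - W0) i" for i
    unfolding fps_X_power_dvd_iff
  proof (intro allI impI)
    fix k assume k: "k < precision"
    have "fps_nth (coeff W0 i) k = 0" if "d < k"
    proof (cases "i < d")
      case True
      thus ?thesis unfolding nthW0 g_def using ker[OF True that k] by blast
    next
      case False
      hence "coeff W0 i = 0" using degW0 degree_pos by (intro coeff_eq_0) linarith
      thus ?thesis by simp
    qed
    thus "fps_nth (coeff (hat W - W0) i) k = 0"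
      by (cases "d < k") (simp_all add: coeff_hat coeffW coeff_truncate)
  qed
  have close_poly: "fps_X ^ precision dvd poly (hat W) a - poly W0 a" for a
    using dvd_poly_if_dvd_coeffs[of _ "hat W - W0" a, OF close] by simp
  have g_other: "poly (g s) (A t) = 0" if "s \<in> S" "t \<in> S" "s \<noteq> t" for s t
    using that S topf by (simp add: g_def poly_prod_roots_eq_0_iff) blast
  have poly_W0: "poly W0 (A t) = fps_const (\<mu> t) * poly (g t) (A t)" if "t \<in> S" for t
  proof -
    have "poly W0 (A t) = (\<Sum>s\<in>S. fps_const (\<mu> s) * poly (g s) (A t))"
      by (simp add: W0_def poly_sum)
    also have "\<dots> = fps_const (\<mu> t) * poly (g t) (A t)"
      using that S g_other by (subst sum.remove[of _ t]) (auto intro!: sum.neutral)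
    finally show ?thesis .
  qed
  have g_self: "fps_nth (poly (g t) (A t)) 0 \<noteq> 0" if "t \<in> S" for t
  proof -
    interpret n0: comm_ring_hom "\<lambda>a :: ('n, 'k) mpoly fps. fps_nth a 0" by (rule comm_ring_hom_fps_nth_0)
    have "fps_nth (poly (g t) (A t)) 0 = poly (map_poly (\<lambda>a. fps_nth a 0) (g t)) (fps_nth (A t) 0)"
      by (rule n0.poly_map_poly[symmetric])
    also have "\<dots> = poly (prod_roots (mconst top) (\<lambda>s. fps_nth (A s) 0) (S - {t})) (mconst t)"
      unfolding g_def hom_prod_roots[OF comm_ring_hom_fps_nth_0] A0[OF that] by simp
    also have "\<dots> \<noteq> 0"
    proof -
      have "mconst t \<noteq> fps_nth (A r) 0" if "r \<in> S - {t}" for r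
        using that A0[of r] by (auto simp: mconst_eq_iff)
      thus ?thesis using S(1) mconst_top_nonzero by (subst poly_prod_roots_eq_0_iff) auto
    qed
    finally show ?thesis .
  qed
  have W_zero: "W = 0"
  proof (rule ccontr)
    assume "W \<noteq> 0"
    have "fps_X ^ precision dvd poly (hat W) (A x0)"
      using close_poly[of "A x0"] poly_W0[OF S(3)] \<mu>0 by simp
    interpret hat: comm_ring_hom hat by (rule comm_ring_hom_hat)
    have dW: "degree (coeff W i) \<le> d" for i
      unfolding coeffW by (rule degree_truncate)
    have GA: "poly (hat (generic_plane v)) (A x0) = 0"
      unfolding G using poly_prod_roots_eq_0_iff[OF S(1) topf] S(3) by blast
    show False
    proof (rule elimination[OF filtration_degree, of "generic_plane v" d d W "d - 1"])
      show "degree (coeff (generic_plane v) i) \<le> d" for i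
        by (rule plane_section_inner_degree_le[OF degree_le])
    next
      fix a b assume "a \<noteq> 0 \<or> b \<noteq> 0" "a * generic_plane v + b * W = 0"
        "\<And>i. i \<ge> d \<Longrightarrow> coeff b i = 0"
      thus False using generic_plane_coprime[of W a v b] degW \<open>W \<noteq> 0\<close> degree_pos by auto
    next
      fix a b r assume r: "r \<noteq> 0" "a * generic_plane v + b * W = [:r:]" "degree r \<le> (d + (d - 1)) * d"
      have "poly (hat [:r:]) (A x0) = poly (hat b) (A x0) * poly (hat W) (A x0)"
        unfolding r(2)[symmetric] hat.hom_add hat.hom_mult poly_add poly_mult GA by simp
      moreover have "poly (hat [:r:]) (A x0) = fps_of_poly r"
        by (simp add: hat_def map_poly_linear[OF comm_ring_hom_fps_of_poly])
      ultimately have "fps_X ^ precision dvd fps_of_poly r"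
        using \<open>fps_X ^ precision dvd poly (hat W) (A x0)\<close> by simp
      hence "coeff r k = 0" if "k < precision" for k
        using that by (simp add: fps_X_power_dvd_iff)
      moreover have "degree r < precision"
        using r(3) degree_pos by (simp add: precision_def mult_2)
      ultimately have "lead_coeff r = 0" by blast
      with r(1) show False by simp
    qed (use degree_generic_plane[of v] degW degree_pos dW in auto)
  qed
  \<comment> \<open>As \<open>W = 0\<close>, the combination \<open>W0\<close> has high order. On
    the branch \<open>A s\<close> only the cofactor of \<open>s\<close> survives, and its constant
    coefficient is \<open>top\<close> times a product of differences of distinct roots.\<close>
  have "fps_X ^ precision dvd - poly W0 (A s)"
    using close_poly[of "A s"] unfolding W_zero by (simp add: hat_def)
  hence "\<forall>k<precision. fps_nth (- poly W0 (A s)) k = 0"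
    unfolding fps_X_power_dvd_iff .
  moreover have "0 < precision" by (simp add: precision_def)
  ultimately have "fps_nth (poly W0 (A s)) 0 = 0" by simp
  hence "\<mu> s * fps_nth (poly (g s) (A s)) 0 = 0"
    unfolding poly_W0[OF s] by simp
  thus ?thesis using g_self[OF s] by simp
qed

end

section \<open>Branches of the generic section and of its specialisations\<close>

lemma line_section_degree_le:
  assumes "degree_le d f"
  shows "degree (line_section v w f) \<le> d"
    and "coeff (line_section v w f) d = mpeval (\<lambda>a. a) w (homogeneous_part d f)"
  using mpeval_linear_poly[OF comm_ring_hom_id assms, of v w] by (simp_all add: line_section_def)

definition fps_map :: "('r \<Rightarrow> 's) \<Rightarrow> 'r fps \<Rightarrow> 's fps" where
  "fps_map h a = Abs_fps (\<lambda>k. h (fps_nth a k))"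

lemma fps_nth_fps_map [simp]: "fps_nth (fps_map h a) k = h (fps_nth a k)"
  by (simp add: fps_map_def)

lemma comm_ring_hom_fps_map:
  assumes "comm_ring_hom h"
  shows "comm_ring_hom (fps_map h)"
proof -
  interpret h: comm_ring_hom h by fact
  show ?thesis
    by unfold_locales
      (auto simp: fps_eq_iff fps_mult_nth h.hom_add h.hom_mult h.hom_sum fps_one_nth)
qed

lemma hat_map_poly:
  assumes "comm_ring_hom h"
  shows "hat (map_poly (map_poly h) p) = map_poly (fps_map h) (hat p)"
proof -
  interpret h: comm_ring_hom h by fact
  interpret H: comm_ring_hom "map_poly h" by (rule comm_ring_hom_map_poly[OF assms])
  interpret F: comm_ring_hom "fps_map h" by (rule comm_ring_hom_fps_map[OF assms])
  show ?thesis
    by (rule poly_eqI) (simp add: coeff_hat fps_eq_iff)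
qed

context irreducible_form
begin

lemma degree_line_section: "degree (line_section v w f) = d"
  and coeff_line_section: "coeff (line_section v w f) d = top"
proof -
  note le = line_section_degree_le[OF degree_le, of v w]
  show c: "coeff (line_section v w f) d = top" using le(2) by (simp add: top_def)
  have "d \<le> degree (line_section v w f)"
    using top_nonzero by (intro le_degree) (simp add: c top_def)
  with le(1) show "degree (line_section v w f) = d" by (rule antisym)
qed

text \<open>At Y = 0 the section is the line section, whose d distinct roots are simple and
  therefore lift. The bound on degrees in Z is inherited from the section, in which every Y is
  accompanied by one variable from Z.\<close>

lemma generic_plane_branches:
  assumes S: "S = {x. poly (line_section v w f) x = 0}" "card S = d"
  obtains A where "\<And>x. x \<in> S \<Longrightarrow> fps_nth (A x) 0 = mconst x"
    "\<And>x k. x \<in> S \<Longrightarrow> degree_le k (fps_nth (A x) k)"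
    "hat (generic_plane v) = prod_roots (fps_const (mconst top)) A S"
proof -
  let ?G = "generic_plane v" and ?g = "line_section v w f"
  have top0: "top \<noteq> 0" using top_nonzero by (simp add: top_def)
  have "?g \<noteq> 0" using degree_line_section[of v] degree_pos by auto
  hence fin: "finite S" unfolding S(1) by (rule poly_roots_finite)
  have g: "?g = prod_roots top (\<lambda>x. x) S"
  proof -
    have "?g = prod_roots (lead_coeff ?g) (\<lambda>x. x) S"
      by (rule eq_prod_roots[OF fin]) (simp_all add: degree_line_section S(2), simp add: S(1))
    thus ?thesis unfolding degree_line_section coeff_line_section .
  qed
  interpret n0: comm_ring_hom "\<lambda>a :: ('n, 'k) mpoly fps. fps_nth a 0" by (rule comm_ring_hom_fps_nth_0)
  interpret mconst: comm_ring_hom "mconst :: 'k \<Rightarrow> ('n, 'k) mpoly" by (rule comm_ring_hom_mconst)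
  have at0: "map_poly (\<lambda>a. fps_nth a 0) (hat ?G) = map_poly mconst ?g"
    unfolding poly_hat_at_0 by (rule plane_section_at_0[OF comm_ring_hom_mconst])
  have coeffs: "degree_le k (fps_nth (coeff (hat ?G) i) k)" for i k
  proof -
    interpret F: filtration "\<lambda>_ p. \<forall>i k. degree_le k (fps_nth (coeff p i) k)"
      by (rule filtration_coeffs[OF filtration_fps[OF filtration_degree_le]])
    have z: "degree_le k (0 :: ('n, 'k) mpoly)" for k by (simp add: degree_le_def)
    have "\<forall>i k. degree_le k (fps_nth (coeff (hat ?G) i) k)"
      unfolding plane_section_def comm_ring_hom.hom_mpeval[OF comm_ring_hom_hat]
      by (rule F.mpeval[OF _ _ degree_le])
        (auto simp: coeff_hat coeff_pCons z degree_le_mconst degree_le_mvar[simplified] split: nat.split)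
    thus ?thesis by blast
  qed
  have "\<exists>A. poly (hat ?G) A = 0 \<and> fps_nth A 0 = mconst x \<and> (\<forall>k. degree_le k (fps_nth A k))"
    if x: "x \<in> S" for x
  proof -
    have poly0: "fps_nth (poly p (fps_const (mconst x))) 0 = poly (map_poly (\<lambda>a. fps_nth a 0) p) (mconst x)"
      for p :: "('n, 'k) mpoly fps poly"
      using n0.poly_map_poly[of p "fps_const (mconst x)"] by simp
    have "poly (prod_roots top (\<lambda>x. x) (S - {x})) x \<noteq> 0"
      using fin top0 by (subst poly_prod_roots_eq_0_iff) auto
    hence der: "poly (pderiv ?g) x \<noteq> 0"
      unfolding g by (subst poly_pderiv_prod_roots[OF fin x])
    have r0: "fps_nth (poly (hat ?G) (fps_const (mconst x))) 0 = 0"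
      unfolding poly0 at0 mconst.poly_map_poly using x S(1) by simp
    have d0: "fps_nth (poly (pderiv (hat ?G)) (fps_const (mconst x))) 0 *
        mconst (inverse (poly (pderiv ?g) x)) = 1"
      unfolding poly0 map_poly_pderiv[OF comm_ring_hom_fps_nth_0] at0
        map_poly_pderiv[OF comm_ring_hom_mconst, symmetric] mconst.poly_map_poly mconst.hom_mult[symmetric]
      using der by simp
    obtain A where "poly (hat ?G) A = 0" "fps_nth A 0 = mconst x" "\<And>k. degree_le k (fps_nth A k)"
      by (rule hensel_root[OF filtration_degree_le coeffs degree_le_mconst degree_le_mconst r0 d0]) blast
    thus ?thesis by blast
  qed
  then obtain A where A: "\<And>x. x \<in> S \<Longrightarrow> poly (hat ?G) (A x) = 0"
    "\<And>x. x \<in> S \<Longrightarrow> fps_nth (A x) 0 = mconst x"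
    "\<And>x k. x \<in> S \<Longrightarrow> degree_le k (fps_nth (A x) k)"
    by metis
  have "inj_on A S"
  proof (rule inj_onI)
    fix x y assume "x \<in> S" "y \<in> S" "A x = A y"
    hence "mconst x = (mconst y :: ('n, 'k) mpoly)" using A(2) by metis
    thus "x = y" by (simp only: mconst_eq_iff)
  qed
  hence eq: "hat ?G = prod_roots (lead_coeff (hat ?G)) A S"
    using eq_prod_roots[OF fin _ _ A(1)] S(2) by (simp add: degree_hat degree_generic_plane)
  have "lead_coeff (hat ?G) = fps_const (mconst top)"
    by (simp add: degree_hat coeff_hat degree_generic_plane coeff_generic_plane)
  with eq have "hat ?G = prod_roots (fps_const (mconst top)) A S" by simp
  thus thesis using that[of A] A(2,3) by blast
qed

text \<open>A factor \<open>h\<close> of the section \<open>g\<^sub>z = h u\<close> yields the kernel vector \<open>\<mu>\<close> with \<open>h' u = \<Sum> \<mu>\<^sub>s g\<^sub>s\<close>, the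
  indicator of the branches on \<open>h\<close>.\<close>

lemma factor_kernel_vector:
  fixes A :: "'k \<Rightarrow> 'k fps"
  assumes S: "finite S" "card S = d" "inj_on A S"
    and G: "hat (plane_section (\<lambda>a. a) v z w f) = prod_roots (fps_const top) A S"
    and hu: "plane_section (\<lambda>a. a) v z w f = h * u" "\<not> h dvd 1" "\<not> u dvd 1"
  obtains \<mu> :: "'k \<Rightarrow> 'k" and s t where "s \<in> S" "t \<in> S" "\<mu> s \<noteq> \<mu> t"
    "\<And>i k. d < k \<Longrightarrow> (\<Sum>s\<in>S. fps_nth (coeff (prod_roots (fps_const top) A (S - {s})) i) k * \<mu> s) = 0"
proof -
  let ?P = "plane_section (\<lambda>a. a) v z w f"
  define g where "g s = prod_roots (fps_const top) A (S - {s})" for s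
  interpret hat: comm_ring_hom "hat :: 'k poly poly \<Rightarrow> _" by (rule comm_ring_hom_hat)
  have top0: "top \<noteq> 0" using top_nonzero by (simp add: top_def)
  hence topf: "fps_const top \<noteq> 0" by simp
  note le = plane_section_degree_le[OF comm_ring_hom_id degree_le, of v z w]
  have cP: "coeff ?P d = [:top:]" unfolding le(2) top_def by (rule refl)
  have dP: "degree ?P = d"
    using le(1) by (rule antisym) (rule le_degree, use top0 in \<open>simp add: cP\<close>)
  have P0: "?P \<noteq> 0" using dP degree_pos by auto
  hence hu0: "h \<noteq> 0" "u \<noteq> 0" using hu(1) by auto
  have deg_sum: "degree h + degree u = d"
    using degree_mult_eq[OF hu0] unfolding hu(1)[symmetric] dP by simp
  have "lead_coeff h * lead_coeff u = [:top:]"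
    using cP dP unfolding hu(1) lead_coeff_mult[symmetric] by simp
  moreover have "[:top:] dvd 1" using top0 by (simp add: is_unit_field_poly_iff_degree)
  ultimately have lc: "lead_coeff h dvd 1" "lead_coeff u dvd 1"
    by (metis dvd_mult_left, metis dvd_mult_right)
  have pos: "degree r > 0" if "lead_coeff r dvd 1" "\<not> r dvd 1" for r :: "'k poly poly"
  proof (rule ccontr)
    assume "\<not> degree r > 0"
    hence "degree r = 0" by simp
    then obtain e where "r = [:e:]" by (rule degree_eq_zeroE)
    thus False using that by (simp add: is_unit_const_poly_iff)
  qed
  from pos[OF lc(1) hu(2)] pos[OF lc(2) hu(3)] deg_sum
  have degs: "degree h < d" "degree u < d" by auto
  have vanish: "\<exists>s\<in>S. poly (hat r) (A s) \<noteq> 0" if "r \<noteq> 0" "degree r < d" for r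
  proof (rule ccontr)
    assume "\<not> ?thesis"
    hence "A ` S \<subseteq> {x. poly (hat r) x = 0}" by auto
    moreover have "hat r \<noteq> 0" using that(1) by (metis coeff_0 coeff_hat fps_of_poly_0 fps_of_poly_eq_iff poly_eqI)
    ultimately have "card (A ` S) \<le> degree (hat r)"
      using card_mono[OF poly_roots_finite[of "hat r"], of "A ` S"] poly_roots_degree[of "hat r"] by linarith
    thus False using that(2) S by (simp add: degree_hat card_image)
  qed
  have HU: "poly (hat h) (A s) * poly (hat u) (A s) = 0" if "s \<in> S" for s
  proof -
    have "poly (hat (h * u)) (A s) = 0"
      unfolding hu(1)[symmetric] G using that poly_prod_roots_eq_0_iff[OF S(1) topf] by blast
    thus ?thesis by (simp add: hat.hom_mult)
  qed
  define \<mu> where "\<mu> s = (if poly (hat h) (A s) = 0 then 1 else 0 :: 'k)" for s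
  let ?W = "pderiv h * u"
  let ?sum = "\<Sum>s\<in>S. smult (fps_const (\<mu> s)) (g s)"
  have hatW: "hat ?W = pderiv (hat h) * hat u"
    unfolding hat.hom_mult unfolding hat_def map_poly_pderiv[OF comm_ring_hom_fps_of_poly] by (rule refl)
  \<comment> \<open>Both sides have degree below d in X, so values on the d branches decide. Where h
    vanishes, h' u equals the derivative of h u, which is the value of the cofactor; elsewhere u
    vanishes and both sides are 0.\<close>
  have "hat ?W = ?sum"
  proof (rule poly_eqI_degree[of "A ` S"])
    fix x assume "x \<in> A ` S"
    then obtain s where s: "x = A s" "s \<in> S" by (rule imageE)
    have "poly (g r) (A s) = 0" if "r \<in> S" "r \<noteq> s" for r
      using that s S(1) topf by (simp add: g_def poly_prod_roots_eq_0_iff) blast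
    hence W0: "poly ?sum (A s) = fps_const (\<mu> s) * poly (g s) (A s)"
      using s S(1) by (simp add: poly_sum sum.remove[of S s] sum.neutral)
    have "poly (g s) (A s) = poly (pderiv (hat h * hat u)) (A s)"
      using poly_pderiv_prod_roots[OF S(1) s(2), of "fps_const top" A]
      unfolding G[symmetric] hu(1) hat.hom_mult g_def by simp
    also have "\<dots> = poly (hat h) (A s) * poly (pderiv (hat u)) (A s) + poly (hat u) (A s) * poly (pderiv (hat h)) (A s)"
      by (simp add: pderiv_mult)
    finally have gs: "poly (g s) (A s) = \<dots>" .
    show "poly (hat ?W) x = poly ?sum x"
      unfolding s(1) W0 gs hatW using HU[OF s(2)] by (cases "poly (hat h) (A s) = 0") (simp_all add: \<mu>_def)
  next
    have "degree (hat ?W) \<le> degree (pderiv h) + degree u"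
      unfolding degree_hat by (rule degree_mult_le)
    also have "\<dots> < d"
      using deg_sum degree_pderiv_le[of h] pos[OF lc(1) hu(2)] by linarith
    finally show "degree (hat ?W) < card (A ` S)" using S by (simp add: card_image)
    have "degree ?sum \<le> d - 1"
    proof (rule degree_sum_le[OF S(1)])
      fix s assume "s \<in> S"
      have "degree (smult (fps_const (\<mu> s)) (g s)) \<le> degree (g s)" by (rule degree_smult_le)
      also have "\<dots> = d - 1"
        unfolding g_def using S \<open>s \<in> S\<close> by (subst degree_prod_roots[OF topf]) auto
      finally show "degree (smult (fps_const (\<mu> s)) (g s)) \<le> d - 1" .
    qed
    thus "degree ?sum < card (A ` S)" using S degree_pos by (simp add: card_image)
  qed
  \<comment> \<open>Differentiation in X does not raise the degree in Y, and the degrees of h and u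
    in Y add up to at most d.\<close>
  moreover have "degree (coeff ?W i) \<le> d" for i
  proof -
    have inner: "degree (coeff (h * u) i) \<le> d" for i
      unfolding hu(1)[symmetric] by (rule plane_section_inner_degree_le[OF degree_le])
    obtain a b where ab: "\<And>i. degree (coeff h i) \<le> a" "\<And>i. degree (coeff u i) \<le> b" "a + b \<le> d"
      using inner_degree_add[OF hu0 inner] by blast
    interpret F: filtration "\<lambda>d p. \<forall>i. degree (coeff p i :: 'k poly) \<le> d"
      by (rule filtration_coeffs[OF filtration_degree])
    have "degree (coeff (pderiv h) i) \<le> a" for i
    proof -
      have "degree (of_nat (Suc i) * coeff h (Suc i)) \<le> degree (of_nat (Suc i) :: 'k poly) + degree (coeff h (Suc i))"
        by (rule degree_mult_le)
      also have "\<dots> \<le> a" using ab(1)[of "Suc i"] by (simp only: degree_of_nat add_0)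
      finally show ?thesis unfolding coeff_pderiv .
    qed
    with ab(2) have "\<forall>i. degree (coeff ?W i) \<le> a + b" by (intro F.mult) auto
    thus ?thesis using ab(3) by (meson le_trans)
  qed
  ultimately have "(\<Sum>s\<in>S. fps_nth (coeff (g s) i) k * \<mu> s) = 0" if "d < k" for i k
  proof -
    assume W: "hat ?W = ?sum" and dW: "\<And>i. degree (coeff ?W i) \<le> d"
    have "(\<Sum>s\<in>S. fps_nth (coeff (g s) i) k * \<mu> s) = fps_nth (coeff ?sum i) k"
      by (simp add: coeff_sum fps_sum_nth mult.commute)
    also have "\<dots> = coeff (coeff ?W i) k"
      unfolding W[symmetric] coeff_hat by simp
    also have "\<dots> = 0" using dW[of i] that by (intro coeff_eq_0) linarith
    finally show ?thesis .
  qed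
  \<comment> \<open>Neither factor can vanish on all d branches, having smaller degree in X. A
    branch not on u lies on h and has entry 1; a branch not on h has entry 0.\<close>
  moreover obtain s where s: "s \<in> S" "poly (hat u) (A s) \<noteq> 0" using vanish[OF hu0(2) degs(2)] by blast
  moreover obtain t where t: "t \<in> S" "poly (hat h) (A t) \<noteq> 0" using vanish[OF hu0(1) degs(1)] by blast
  moreover have "\<mu> s \<noteq> \<mu> t" using HU[OF s(1)] s t by (simp add: \<mu>_def)
  ultimately show thesis
    using that[of s t \<mu>] unfolding g_def by blast
qed

end

lemma pderiv_prod_roots:
  assumes "finite S"
  shows "pderiv (prod_roots c A S) = (\<Sum>s\<in>S. prod_roots c A (S - {s}))"
  unfolding prod_roots_def pderiv_smult pderiv_prod
  by (simp add: pderiv_pCons smult_sum2)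

context irreducible_form
begin

text \<open>The sum of all cofactors is the derivative of the section in X, whose degree in Y is at
  most d. The all-ones vector thus lies in the kernel and may be subtracted to normalise a kernel
  vector.\<close>

lemma cofactor_sum_kernel:
  fixes A :: "'k \<Rightarrow> 'k fps"
  assumes S: "finite S" and G: "hat (plane_section (\<lambda>a. a) v z w f) = prod_roots (fps_const top) A S"
    and k: "d < k"
  shows "(\<Sum>s\<in>S. fps_nth (coeff (prod_roots (fps_const top) A (S - {s})) i) k) = 0"
proof -
  let ?P = "plane_section (\<lambda>a. a) v z w f"
  have "(\<Sum>s\<in>S. fps_nth (coeff (prod_roots (fps_const top) A (S - {s})) i) k) =
      fps_nth (coeff (pderiv (hat ?P)) i) k"
    unfolding G pderiv_prod_roots[OF S] by (simp add: coeff_sum fps_sum_nth)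
  also have "\<dots> = of_nat (Suc i) * coeff (coeff ?P (Suc i)) k"
  proof -
    have "coeff (pderiv (hat ?P)) i = fps_const (of_nat (Suc i)) * fps_of_poly (coeff ?P (Suc i))"
      unfolding coeff_pderiv coeff_hat fps_of_nat[symmetric] by (rule refl)
    thus ?thesis by (simp del: of_nat_Suc)
  qed
  also have "\<dots> = 0"
    using plane_section_inner_degree_le[OF degree_le, of "\<lambda>a. a" v z w "Suc i"] k
    by (simp add: coeff_eq_0)
  finally show ?thesis .
qed

theorem reducible_sections_on_hypersurface:
  assumes card: "card {x. poly (line_section v w f) x = 0} = d"
  obtains Q where "Q \<noteq> 0" "degree_le ((d - 1) * ((2 * d - 1) * d)) Q"
    "\<And>z h u. mpeval (\<lambda>a. a) z Q \<noteq> 0 \<Longrightarrow> plane_section (\<lambda>a. a) v z w f = h * u \<Longrightarrow> h dvd 1 \<or> u dvd 1"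
proof -
  define S where "S = {x. poly (line_section v w f) x = 0}"
  have cardS: "card S = d" using card by (simp add: S_def)
  hence fin: "finite S" using degree_pos by (metis card_gt_0_iff)
  obtain A where A0: "\<And>x. x \<in> S \<Longrightarrow> fps_nth (A x) 0 = mconst x"
    and Adeg: "\<And>x k. x \<in> S \<Longrightarrow> degree_le k (fps_nth (A x) k)"
    and G: "hat (generic_plane v) = prod_roots (fps_const (mconst top)) A S"
    using generic_plane_branches[OF S_def cardS] by blast
  obtain x0 where x0: "x0 \<in> S" using cardS degree_pos by fastforce
  obtain en where en: "bij_betw en {0..<card (S - {x0})} (S - {x0})"
    using ex_bij_betw_nat_finite[of "S - {x0}"] fin by blast
  have card': "card (S - {x0}) = d - 1" using fin x0 cardS by simp
  have en: "bij_betw en {..<d - 1} (S - {x0})" using en unfolding card' lessThan_atLeast0 .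
  define e where "e s ik = (case ik of (i, k) \<Rightarrow> fps_nth (coeff (prod_roots (fps_const (mconst top)) A (S - {s})) i) k)"
    for s ik
  define I where "I = {(i, k). i < d \<and> d < k \<and> k < precision}"
  have sum_en: "(\<Sum>s\<in>S. h s) = (\<Sum>j<d - 1. h (en j))" if "h x0 = 0" for h :: "'k \<Rightarrow> 'b::comm_monoid_add"
  proof -
    have "(\<Sum>s\<in>S. h s) = (\<Sum>s\<in>S - {x0}. h s)" using fin x0 that by (simp add: sum.remove)
    also have "\<dots> = (\<Sum>j<d - 1. h (en j))" using sum.reindex_bij_betw[OF en, of h] by simp
    finally show ?thesis .
  qed
  \<comment> \<open>The column of \<open>x0\<close> is dropped: a kernel vector on the other
    columns, extended by 0 at \<open>x0\<close>, is one to which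
    \<open>generic_kernel_trivial\<close> applies.\<close>
  have "\<exists>\<rho>. (\<forall>r<d - 1. \<rho> r \<in> I) \<and> det (mat (d - 1) (d - 1) (\<lambda>(r, j). e (en j) (\<rho> r))) \<noteq> 0"
  proof (rule nonzero_minor_exists)
    fix \<mu> :: "nat \<Rightarrow> ('n, 'k) mpoly" and j
    assume ker: "\<And>ik. ik \<in> I \<Longrightarrow> (\<Sum>j<d - 1. e (en j) ik * \<mu> j) = 0" and j: "j < d - 1"
    define \<nu> where "\<nu> s = (if s = x0 then 0 else \<mu> (inv_into {..<d - 1} en s))" for s
    have inj: "inj_on en {..<d - 1}" using en by (rule bij_betw_imp_inj_on)
    have en_in: "en j \<in> S - {x0}" if "j < d - 1" for j using bij_betw_apply[OF en, of j] that by simp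
    have \<nu>: "\<nu> (en j) = \<mu> j" if "j < d - 1" for j
      using inv_into_f_f[OF inj, of j] en_in[OF that] that by (simp add: \<nu>_def)
    have "\<nu> (en j) = 0"
    proof (rule generic_kernel_trivial[OF fin cardS x0 A0 G])
      fix i k assume ik: "i < d" "d < k" "k < precision"
      have "(\<Sum>s\<in>S. fps_nth (coeff (prod_roots (fps_const (mconst top)) A (S - {s})) i) k * \<nu> s)
          = (\<Sum>j<d - 1. e (en j) (i, k) * \<mu> j)"
        by (subst sum_en) (simp_all add: \<nu>_def[of x0] e_def \<nu>)
      also have "\<dots> = 0" using ik by (intro ker) (simp add: I_def)
      finally show "(\<Sum>s\<in>S. fps_nth (coeff (prod_roots (fps_const (mconst top)) A (S - {s})) i) k * \<nu> s) = 0" .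
    qed (use en_in[OF j] in \<open>simp_all add: \<nu>_def\<close>)
    thus "\<mu> j = 0" using \<nu>[OF j] by simp
  qed
  then obtain \<rho> where \<rho>: "\<And>r. r < d - 1 \<Longrightarrow> \<rho> r \<in> I"
    and nz: "det (mat (d - 1) (d - 1) (\<lambda>(r, j). e (en j) (\<rho> r))) \<noteq> 0" by blast
  define M where "M = mat (d - 1) (d - 1) (\<lambda>(r, j). e (en j) (\<rho> r))"
  \<comment> \<open>The entry in row (i, k) is a coefficient at Y^k of a cofactor, so its degree in
    Z is at most k, and k < \<open>precision\<close>.\<close>
  have "degree_le ((d - 1) * ((2 * d - 1) * d)) (det M)"
  proof (rule filtration.det[OF filtration_degree_le])
    show "M \<in> carrier_mat (d - 1) (d - 1)" by (simp add: M_def)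
    fix r j assume rj: "r < d - 1" "j < d - 1"
    obtain i k where ik: "\<rho> r = (i, k)" by (cases "\<rho> r")
    hence k: "k \<le> (2 * d - 1) * d" using \<rho>[OF rj(1)] by (simp add: I_def precision_def)
    interpret F: filtration "\<lambda>_ p. \<forall>i k. degree_le k (fps_nth (coeff p i) k)"
      by (rule filtration_coeffs[OF filtration_fps[OF filtration_degree_le]])
    interpret D: filtration "degree_le :: nat \<Rightarrow> ('n, 'k) mpoly \<Rightarrow> bool" by (rule filtration_degree_le)
    have z: "degree_le k (0 :: ('n, 'k) mpoly)" for k by (simp add: degree_le_def)
    have lin: "\<forall>i k. degree_le k (fps_nth (coeff [:- A t, 1:] i) k)" if "t \<in> S" for t
      using Adeg[OF that]
      by (auto simp: coeff_pCons fps_one_nth D.zero D.uminus D.mono[OF D.one] split: nat.split)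
    have "\<forall>i k. degree_le k (fps_nth (coeff ([:fps_const (mconst top):] * (\<Prod>t\<in>S - {en j}. [:- A t, 1:])) i) k)"
    proof (intro F.mult F.prod)
      show "\<forall>i k. degree_le k (fps_nth (coeff [:fps_const (mconst top :: ('n, 'k) mpoly):] i) k)"
        by (auto simp: coeff_pCons z degree_le_mconst split: nat.split)
    qed (use lin in blast)
    hence "degree_le k (e (en j) (\<rho> r))"
      by (simp add: ik e_def prod_roots_def)
    hence "degree_le ((2 * d - 1) * d) (e (en j) (\<rho> r))" using k by (rule D.mono)
    thus "degree_le ((2 * d - 1) * d) (M $$ (r, j))" using rj by (simp add: M_def)
  qed
  moreover have "h dvd 1 \<or> u dvd 1"
    if Q: "mpeval (\<lambda>a. a) z (det M) \<noteq> 0" and hu: "plane_section (\<lambda>a. a) v z w f = h * u" for z h u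
  proof (rule ccontr)
    assume "\<not> ?thesis"
    hence nu: "\<not> h dvd 1" "\<not> u dvd 1" by auto
    define \<phi> where "\<phi> = mpeval (\<lambda>a :: 'k. a) z"
    have hom\<phi>: "comm_ring_hom \<phi>"
      unfolding \<phi>_def by (rule comm_ring_hom.comm_ring_hom_mpeval[OF comm_ring_hom_id])
    interpret \<phi>: comm_ring_hom \<phi> by (rule hom\<phi>)
    have \<phi>_const: "\<phi> (mconst a) = a" for a
      unfolding \<phi>_def by (rule comm_ring_hom.mpeval_mconst[OF comm_ring_hom_id])
    have \<phi>_var: "\<phi> (mvar i) = z i" for i
      unfolding \<phi>_def by (rule comm_ring_hom.mpeval_mvar[OF comm_ring_hom_id])
    define A' where "A' s = fps_map \<phi> (A s)" for s
    have fc: "fps_map \<phi> (fps_const (mconst top)) = fps_const top"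
      by (rule fps_ext) (simp add: \<phi>_const)
    have cof: "map_poly (fps_map \<phi>) (prod_roots (fps_const (mconst top)) A T) = prod_roots (fps_const top) A' T" for T
      unfolding hom_prod_roots[OF comm_ring_hom_fps_map[OF hom\<phi>]] fc A'_def by (rule refl)
    have G': "hat (plane_section (\<lambda>a. a) v z w f) = prod_roots (fps_const top) A' S"
    proof -
      have "plane_section (\<lambda>a. a) v z w f = map_poly (map_poly \<phi>) (generic_plane v)"
        unfolding hom_plane_section[OF hom\<phi>] \<phi>_const \<phi>_var by (rule refl)
      thus ?thesis unfolding hat_map_poly[OF hom\<phi>, symmetric] cof[symmetric] G[symmetric] by simp
    qed
    have inj: "inj_on A' S"
    proof (rule inj_onI)
      fix x y assume xy: "x \<in> S" "y \<in> S" "A' x = A' y"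
      have "fps_nth (A' t) 0 = t" if "t \<in> S" for t
        by (simp add: A'_def A0[OF that] \<phi>_const)
      thus "x = y" using xy by metis
    qed
    obtain \<mu> :: "'k \<Rightarrow> 'k" and s t where st: "s \<in> S" "t \<in> S" "\<mu> s \<noteq> \<mu> t"
      and ker: "\<And>i k. d < k \<Longrightarrow> (\<Sum>s\<in>S. fps_nth (coeff (prod_roots (fps_const top) A' (S - {s})) i) k * \<mu> s) = 0"
      by (rule factor_kernel_vector[OF fin cardS inj G' hu nu]) blast
    \<comment> \<open>Normalised to vanish at \<open>x0\<close>, the vector survives the removal of
      that column. The nonzero minor forces it to be 0, so \<open>\<mu>\<close> would be
      constant.\<close>
    define \<nu> where "\<nu> s = \<mu> s - \<mu> x0" for s
    have entry: "fps_nth (coeff (prod_roots (fps_const top) A' (S - {s})) i) k = \<phi> (e s (i, k))" for s i k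
    proof -
      interpret Fm: comm_ring_hom "fps_map \<phi>" by (rule comm_ring_hom_fps_map[OF hom\<phi>])
      show ?thesis unfolding cof[symmetric] Fm.coeff_map_poly_hom by (simp add: e_def)
    qed
    have ker\<nu>: "(\<Sum>j<d - 1. \<phi> (e (en j) (\<rho> r)) * \<nu> (en j)) = 0" if r: "r < d - 1" for r
    proof -
      obtain i k where ik: "\<rho> r = (i, k)" by (cases "\<rho> r")
      hence k: "d < k" using \<rho>[OF r] by (simp add: I_def)
      have "(\<Sum>s\<in>S. \<phi> (e s (i, k)) * \<nu> s) = (\<Sum>s\<in>S. \<phi> (e s (i, k)) * \<mu> s) - (\<Sum>s\<in>S. \<phi> (e s (i, k))) * \<mu> x0"
        by (simp add: \<nu>_def algebra_simps sum_subtractf sum_distrib_left)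
      also have "\<dots> = 0"
        using ker[OF k, of i] cofactor_sum_kernel[OF fin G' k, of i] unfolding entry by simp
      finally have "(\<Sum>s\<in>S. \<phi> (e s (i, k)) * \<nu> s) = 0" .
      thus ?thesis unfolding ik by (subst (asm) sum_en) (simp_all add: \<nu>_def)
    qed
    have "det (mat (d - 1) (d - 1) (\<lambda>(r, j). \<phi> (e (en j) (\<rho> r)))) = \<phi> (det M)"
    proof -
      have "mat (d - 1) (d - 1) (\<lambda>(r, j). \<phi> (e (en j) (\<rho> r))) = map_mat \<phi> M"
        by (rule eq_matI) (auto simp: M_def)
      thus ?thesis by simp
    qed
    hence detnz: "det (mat (d - 1) (d - 1) (\<lambda>(r, j). \<phi> (e (en j) (\<rho> r)))) \<noteq> 0"
      using Q unfolding \<phi>_def by simp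
    have "\<nu> (en j) = 0" if "j < d - 1" for j
      using det_nonzero_imp_kernel_trivial[OF detnz, of "\<lambda>j. \<nu> (en j)" j] ker\<nu> that by blast
    hence "\<nu> r = 0" if "r \<in> S - {x0}" for r
      using bij_betw_imp_surj_on[OF en] that by (metis imageE lessThan_iff)
    hence "\<mu> r = \<mu> x0" if "r \<in> S" for r
      using that by (cases "r = x0") (auto simp: \<nu>_def)
    with st show False by metis
  qed
  ultimately show thesis using that[of "det M"] nz unfolding M_def by blast
qed

end

section \<open>Separable line sections\<close>

lemma pderiv_at_0_linear_prod:
  fixes a b :: "'i \<Rightarrow> 's::idom"
  assumes "finite I"
  shows "coeff (\<Prod>i\<in>I. [:a i, b i:] ^ m i) 1 =
    (\<Sum>i\<in>I. b i * (of_nat (m i) * a i ^ (m i - 1) * (\<Prod>j\<in>I - {i}. a j ^ m j)))"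
proof -
  have "coeff (\<Prod>i\<in>I. [:a i, b i:] ^ m i) 1 = poly (pderiv (\<Prod>i\<in>I. [:a i, b i:] ^ m i)) 0"
    by (simp add: poly_0_coeff_0 coeff_pderiv)
  also have "\<dots> = (\<Sum>i\<in>I. b i * (of_nat (m i) * a i ^ (m i - 1) * (\<Prod>j\<in>I - {i}. a j ^ m j)))"
    unfolding pderiv_prod poly_sum
    by (intro sum.cong refl) (simp add: pderiv_power pderiv_pCons poly_prod mult_ac)
  finally show ?thesis .
qed

text \<open>For an exponent without \<open>i\<close> the truncated subtraction changes nothing, but
  the coefficient is then 0, so the term disappears as it should.\<close>

definition partial_deriv :: "'n \<Rightarrow> ('n::finite, 'k::comm_ring_1) mpoly \<Rightarrow> ('n, 'k) mpoly" where
  "partial_deriv i f = (\<Sum>m\<in>Poly_Mapping.keys f.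
     Poly_Mapping.single (m - Poly_Mapping.single i 1) (Poly_Mapping.lookup f m * of_nat (Poly_Mapping.lookup m i)))"

text \<open>The chain rule at X = 0: the coefficient of X in f(Z + X w) is the derivative of f along
  w. Its nonvanishing ensures that the generic line has nonzero derivative in X.\<close>

lemma coeff_1_generic_line:
  fixes f :: "('n::{finite,linorder}, 'k::idom) mpoly"
  shows "coeff (generic_line (\<lambda>_. 0) w f) 1 = (\<Sum>i\<in>UNIV. mconst (w i) * partial_deriv i f)"
proof -
  have z: "mconst 0 = (0 :: ('n, 'k) mpoly)" by (simp add: mconst_def)
  have mono: "(of_nat (Poly_Mapping.lookup m i) :: ('n, 'k) mpoly) * mvar i ^ (Poly_Mapping.lookup m i - 1)
      * (\<Prod>j\<in>UNIV - {i}. mvar j ^ Poly_Mapping.lookup m j)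
      = Poly_Mapping.single (m - Poly_Mapping.single i 1) (of_nat (Poly_Mapping.lookup m i) :: 'k)"
    for m :: "'n \<Rightarrow>\<^sub>0 nat" and i
  proof -
    have "mvar i ^ (Poly_Mapping.lookup m i - 1) * (\<Prod>j\<in>UNIV - {i}. mvar j ^ Poly_Mapping.lookup m j)
        = (\<Prod>j\<in>UNIV. mvar j ^ Poly_Mapping.lookup (m - Poly_Mapping.single i 1) j :: ('n, 'k) mpoly)"
      by (subst (2) prod.remove[of _ i]) (auto simp: lookup_minus lookup_single when_def intro!: arg_cong2[where f = "(*)"] prod.cong)
    also have "\<dots> = Poly_Mapping.single (m - Poly_Mapping.single i 1) 1"
      unfolding prod_mvar_power by (subst expo_sum_single) auto
    finally show ?thesis
      unfolding mult.assoc by (simp add: of_nat_single mult_single del: single_of_nat)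
  qed
  have "coeff (generic_line (\<lambda>_. 0) w f) 1 = (\<Sum>m\<in>Poly_Mapping.keys f. mconst (Poly_Mapping.lookup f m) *
      coeff (\<Prod>i\<in>UNIV. [:mvar i, mconst (w i):] ^ Poly_Mapping.lookup m i) 1)"
    by (simp add: generic_line_def mpeval_def coeff_sum z)
  also have "\<dots> = (\<Sum>m\<in>Poly_Mapping.keys f. \<Sum>i\<in>UNIV. mconst (w i) *
      Poly_Mapping.single (m - Poly_Mapping.single i 1) (Poly_Mapping.lookup f m * of_nat (Poly_Mapping.lookup m i)))"
    unfolding pderiv_at_0_linear_prod[OF finite] mono sum_distrib_left
    by (intro sum.cong refl) (simp add: mconst_def mult_single mult_ac)
  also have "\<dots> = (\<Sum>i\<in>UNIV. mconst (w i) * partial_deriv i f)"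
    unfolding partial_deriv_def sum_distrib_left by (rule sum.swap)
  finally show ?thesis .
qed

lemma CHAR_mpoly: "CHAR(('n, 'k::comm_ring_1) mpoly) = CHAR('k)"
proof (rule CHAR_eqI)
  show "of_nat CHAR('k) = (0 :: ('n, 'k) mpoly)"
    by (simp add: of_nat_single del: single_of_nat)
  fix n assume "of_nat n = (0 :: ('n, 'k) mpoly)"
  hence "Poly_Mapping.lookup (Poly_Mapping.single 0 (of_nat n :: 'k)) (0 :: 'n \<Rightarrow>\<^sub>0 nat) = 0"
    by simp
  hence "of_nat n = (0 :: 'k)" by (simp only: lookup_single_eq)
  thus "CHAR('k) dvd n" by (simp add: of_nat_eq_0_iff_char_dvd)
qed

text \<open>Otherwise all exponents are divisible by the characteristic, and \<open>f\<close> is a power.\<close>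

lemma irreducible_partial_deriv_nonzero:
  fixes f :: "('n::{finite,linorder}, 'k::alg_closed_field) mpoly"
  assumes irr: "irreducible f" and char: "CHAR('k) > 0"
  obtains i where "partial_deriv i f \<noteq> 0"
proof -
  let ?p = "CHAR('k)"
  have p: "prime ?p" using char by (rule prime_CHAR_semidom)
  have "\<exists>m\<in>Poly_Mapping.keys f. \<exists>i. of_nat (Poly_Mapping.lookup m i) \<noteq> (0 :: 'k)"
  proof (rule ccontr)
    assume "\<not> ?thesis"
    hence dvd: "?p dvd Poly_Mapping.lookup m i" if "m \<in> Poly_Mapping.keys f" for m i
      using that by (auto simp: of_nat_eq_0_iff_char_dvd)
    \<comment> \<open>Roots of the coefficients exist in the algebraically closed field; together
      with the exponents divided by p they give a \<open>g\<close> whose p-th power is f.\<close>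
    have "\<forall>a :: 'k. \<exists>b. b ^ ?p = a" using nth_root_exists[OF char] by blast
    then obtain rt where rt: "\<And>a :: 'k. rt a ^ ?p = a" by metis
    define e where "e m = (\<Sum>i\<in>UNIV. Poly_Mapping.single i (Poly_Mapping.lookup m i div ?p))" for m :: "'n \<Rightarrow>\<^sub>0 nat"
    define g where "g = (\<Sum>m\<in>Poly_Mapping.keys f. Poly_Mapping.single (e m) (rt (Poly_Mapping.lookup f m)))"
    have spow: "Poly_Mapping.single l a ^ n = Poly_Mapping.single (\<Sum>i\<in>UNIV. Poly_Mapping.single i (n * Poly_Mapping.lookup l i)) (a ^ n)"
      for l :: "'n \<Rightarrow>\<^sub>0 nat" and a :: 'k and n
    proof (induction n)
      case (Suc n)
      have "l + (\<Sum>i\<in>UNIV. Poly_Mapping.single i (n * Poly_Mapping.lookup l i))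
          = (\<Sum>i\<in>UNIV. Poly_Mapping.single i (Suc n * Poly_Mapping.lookup l i))"
        by (rule poly_mapping_eqI) (simp add: lookup_add lookup_sum lookup_single when_def)
      thus ?case using Suc by (simp add: mult_single)
    qed simp
    have "g ^ ?p = (\<Sum>m\<in>Poly_Mapping.keys f. Poly_Mapping.single (e m) (rt (Poly_Mapping.lookup f m)) ^ ?p)"
      unfolding g_def by (rule freshmans_dream_sum) (use p in \<open>simp_all add: CHAR_mpoly\<close>)
    also have "\<dots> = (\<Sum>m\<in>Poly_Mapping.keys f. Poly_Mapping.single m (Poly_Mapping.lookup f m))"
    proof (intro sum.cong refl)
      fix m assume m: "m \<in> Poly_Mapping.keys f"
      have "Poly_Mapping.lookup m i = ?p * Poly_Mapping.lookup (e m) i" for i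
        using dvd[OF m, of i] by (simp add: e_def lookup_sum lookup_single when_def)
      thus "Poly_Mapping.single (e m) (rt (Poly_Mapping.lookup f m)) ^ ?p = Poly_Mapping.single m (Poly_Mapping.lookup f m)"
        unfolding spow rt by (subst expo_sum_single) auto
    qed
    also have "\<dots> = f" by (rule mpoly_sum_monomials[symmetric])
    finally have f: "f = g * g ^ (?p - 1)" using char by (metis power_eq_if not_gr_zero)
    have "?p - 1 > 0" using p prime_gt_1_nat by simp
    have "g dvd g ^ (?p - 1)" using \<open>?p - 1 > 0\<close> by (rule dvd_power[OF disjI1])
    with irreducibleD[OF irr f] have "g dvd 1" using dvd_trans by blast
    hence "g * g ^ (?p - 1) dvd 1" using mult_dvd_mono[OF _ dvd_power_same, of g 1 g 1 "?p - 1"] by simp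
    hence "f dvd 1" using f by simp
    thus False using irr irreducible_not_unit by blast
  qed
  then obtain m i where m: "m \<in> Poly_Mapping.keys f" and nz: "of_nat (Poly_Mapping.lookup m i) \<noteq> (0 :: 'k)" by blast
  hence pos: "Poly_Mapping.lookup m i > 0" by (metis of_nat_0 not_gr_zero)
  let ?m1 = "m - Poly_Mapping.single i 1"
  \<comment> \<open>Lowering a positive i-th exponent is injective, and exponents whose i-th entry
    is 0 carry the coefficient 0; hence nothing cancels against the term of
    \<open>m\<close>.\<close>
  have "Poly_Mapping.lookup (partial_deriv i f) ?m1 =
      (\<Sum>m'\<in>Poly_Mapping.keys f. if m' = m then Poly_Mapping.lookup f m * of_nat (Poly_Mapping.lookup m i) else 0)"
    unfolding partial_deriv_def lookup_sum
  proof (intro sum.cong refl)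
    fix m' assume "m' \<in> Poly_Mapping.keys f"
    show "Poly_Mapping.lookup (Poly_Mapping.single (m' - Poly_Mapping.single i 1)
        (Poly_Mapping.lookup f m' * of_nat (Poly_Mapping.lookup m' i))) ?m1 =
        (if m' = m then Poly_Mapping.lookup f m * of_nat (Poly_Mapping.lookup m i) else 0)"
    proof (cases "Poly_Mapping.lookup m' i = 0")
      case True
      thus ?thesis using nz by (auto simp: lookup_single)
    next
      case False
      have "m' = m" if eq: "m' - Poly_Mapping.single i 1 = ?m1"
      proof (rule poly_mapping_eqI)
        fix j show "Poly_Mapping.lookup m' j = Poly_Mapping.lookup m j"
          using arg_cong[OF eq, of "\<lambda>l. Poly_Mapping.lookup l j"] False pos
          by (cases "j = i") (auto simp: lookup_minus lookup_single when_def)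
      qed
      thus ?thesis by (auto simp: lookup_single when_def)
    qed
  qed
  also have "\<dots> = Poly_Mapping.lookup f m * of_nat (Poly_Mapping.lookup m i)" using m by simp
  also have "\<dots> \<noteq> 0" using m nz by (simp add: in_keys_iff)
  finally have "partial_deriv i f \<noteq> 0" by (metis lookup_zero)
  thus thesis by (rule that)
qed


context irreducible_form
begin

text \<open>An elimination of \<open>X\<close> between the generic line and its derivative plays the role of the discriminant.\<close>

lemma discriminant_exists:
  assumes sep: "pderiv (generic_line (\<lambda>_. 0) w f) \<noteq> 0"
  obtains D where "D \<noteq> 0" "degree_le ((2 * d - 1) * d) D"
    "\<And>v. mpeval (\<lambda>a. a) v D \<noteq> 0 \<Longrightarrow> card {x. poly (line_section v w f) x = 0} = d"
proof -
  let ?F = "generic_line (\<lambda>_. 0) w f"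
  have z: "mconst 0 = (0 :: ('n, 'k) mpoly)" by (simp add: mconst_def)
  interpret R: filtration "degree_le :: nat \<Rightarrow> ('n, 'k) mpoly \<Rightarrow> bool" by (rule filtration_degree_le)
  interpret F: filtration "\<lambda>d p. \<forall>i. degree_le d (coeff p i :: ('n, 'k) mpoly)"
    by (rule filtration_coeffs[OF filtration_degree_le])
  have "\<forall>i. degree_le d (coeff ?F i)"
    unfolding generic_line_def
  proof (rule F.mpeval[OF _ _ degree_le])
    show "\<forall>i. degree_le 0 (coeff [:mconst a :: ('n, 'k) mpoly:] i)" for a
      by (auto simp: coeff_pCons R.zero degree_le_mconst split: nat.split)
    show "\<forall>j. degree_le 1 (coeff [:mvar i + mconst 0, mconst (w i) :: ('n, 'k) mpoly:] j)" for i
      unfolding z add_0_right using degree_le_mvar[of i]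
      by (auto simp: coeff_pCons R.zero degree_le_mconst split: nat.split)
  qed
  hence cF: "degree_le d (coeff ?F i)" for i by blast
  have cF': "degree_le d (coeff (pderiv ?F) i)" for i
  proof -
    have "degree_le 0 (of_nat (Suc i) :: ('n, 'k) mpoly)"
      using degree_le_mconst[of 0 "of_nat (Suc i)"] unfolding mconst_def single_of_nat .
    from R.scale[OF this cF[of "Suc i"]] show ?thesis unfolding coeff_pderiv .
  qed
  \<comment> \<open>Only an upper bound, as the characteristic may divide d. Since
    \<open>elimination\<close> works with formal degrees, the bound is all it asks for.\<close>
  have dF': "degree (pderiv ?F) \<le> d - 1"
    using degree_pderiv_le[of ?F] unfolding generic_line_degree .
  show thesis
  proof (rule elimination[OF filtration_degree_le, of ?F d d "pderiv ?F" "d - 1"])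
    show "degree ?F \<le> d" by (simp add: generic_line_degree)
  next
    fix a b assume ab: "a \<noteq> 0 \<or> b \<noteq> 0" "a * ?F + b * pderiv ?F = 0" "\<And>i. i \<ge> d \<Longrightarrow> coeff b i = 0"
    let ?\<iota> = "map_poly to_fract :: ('n, 'k) mpoly poly \<Rightarrow> _"
    have F0: "?F \<noteq> 0" using generic_line_degree[of "\<lambda>_. 0"] degree_pos by auto
    have ld: "degree (?\<iota> r) = degree r" for r by (rule to_fract_hom.degree_map_poly_hom)
    have "b = 0"
    proof (rule ccontr)
      assume "b \<noteq> 0"
      hence "degree b < d" using ab(3)[of "degree b"] by (meson leading_coeff_0_iff not_le)
      have "?F * (- a) = b * pderiv ?F"
        using ab(2) by (simp add: algebra_simps add_eq_0_iff)
      hence "?\<iota> ?F * ?\<iota> (- a) = ?\<iota> b * ?\<iota> (pderiv ?F)"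
        unfolding fract_poly_mult[symmetric] by (rule arg_cong)
      hence "?\<iota> ?F dvd ?\<iota> b * ?\<iota> (pderiv ?F)" by (metis dvd_triv_left)
      hence "?\<iota> ?F dvd ?\<iota> b \<or> ?\<iota> ?F dvd ?\<iota> (pderiv ?F)"
        by (rule prime_elem_dvd_multD[OF irreducible_imp_prime_elem[OF irreducible_generic_line_fract]])
      thus False
      proof
        assume "?\<iota> ?F dvd ?\<iota> b"
        moreover have "?\<iota> b \<noteq> 0" using \<open>b \<noteq> 0\<close> by (simp only: fract_poly_eq_0_iff simp_thms)
        ultimately have "degree (?\<iota> ?F) \<le> degree (?\<iota> b)" by (rule dvd_imp_degree_le)
        thus False using \<open>degree b < d\<close> by (simp only: ld generic_line_degree)
      next
        assume "?\<iota> ?F dvd ?\<iota> (pderiv ?F)"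
        moreover have "?\<iota> (pderiv ?F) \<noteq> 0" using sep by (simp only: fract_poly_eq_0_iff simp_thms)
        ultimately have "degree (?\<iota> ?F) \<le> degree (?\<iota> (pderiv ?F))" by (rule dvd_imp_degree_le)
        thus False using dF' degree_pos by (simp only: ld generic_line_degree)
      qed
    qed
    with ab F0 show thesis by simp
  next
    fix a b r assume r: "r \<noteq> 0" "a * ?F + b * pderiv ?F = [:r:]" "degree_le ((d + (d - 1)) * d) r"
    have "card {x. poly (line_section v w f) x = 0} = d" if v: "mpeval (\<lambda>a. a) v r \<noteq> 0" for v
    proof -
      let ?g = "line_section v w f"
      define \<phi> where "\<phi> = mpeval (\<lambda>a :: 'k. a) v"
      have hom\<phi>: "comm_ring_hom \<phi>"
        unfolding \<phi>_def by (rule comm_ring_hom.comm_ring_hom_mpeval[OF comm_ring_hom_id])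
      interpret \<Phi>: comm_ring_hom "map_poly \<phi>" by (rule comm_ring_hom_map_poly[OF hom\<phi>])
      have "map_poly \<phi> ?F = ?g"
      proof -
        have "\<phi> (mconst a) = a" for a
          unfolding \<phi>_def by (rule comm_ring_hom.mpeval_mconst[OF comm_ring_hom_id])
        moreover have "\<phi> (mvar i) = v i" for i
          unfolding \<phi>_def by (rule comm_ring_hom.mpeval_mvar[OF comm_ring_hom_id])
        ultimately show ?thesis
          unfolding generic_line_def \<Phi>.hom_mpeval map_poly_linear[OF hom\<phi>] z add_0_right line_section_def
          by simp
      qed
      hence comb: "map_poly \<phi> a * ?g + map_poly \<phi> b * pderiv ?g = [:\<phi> r:]"
        using arg_cong[OF r(2), of "map_poly \<phi>"]
        unfolding \<Phi>.hom_add \<Phi>.hom_mult map_poly_pderiv[OF hom\<phi>] map_poly_linear[OF hom\<phi>] by simp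
      have no_common: "poly (pderiv ?g) x \<noteq> 0" if "poly ?g x = 0" for x
      proof
        assume "poly (pderiv ?g) x = 0"
        with that arg_cong[OF comb, of "\<lambda>p. poly p x"] have "\<phi> r = 0" by simp
        with v show False by (simp add: \<phi>_def)
      qed
      have g0: "?g \<noteq> 0" using degree_line_section[of v] degree_pos by auto
      obtain M where M: "size M = d" "?g = smult top (\<Prod>x\<in>#M. [:- x, 1:])"
        using alg_closed_imp_factorization[OF g0] unfolding degree_line_section coeff_line_section by blast
      have roots: "{x. poly ?g x = 0} = set_mset M"
        using top_nonzero unfolding M(2) by (auto simp: poly_prod_mset prod_mset_zero_iff top_def)
      have "count M x \<le> 1" for x
      proof (rule ccontr)
        assume "\<not> count M x \<le> 1"
        hence "{#x, x#} \<subseteq># M" by (simp add: subseteq_mset_def)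
        then obtain N where "M = {#x, x#} + N" by (metis mset_subset_eq_exists_conv)
        hence "?g = [:- x, 1:] * ([:- x, 1:] * smult top (\<Prod>x\<in>#N. [:- x, 1:]))"
          unfolding M(2) by simp
        hence "poly ?g x = 0 \<and> poly (pderiv ?g) x = 0"
          by (simp only: pderiv_mult) simp
        with no_common show False by blast
      qed
      hence "M = mset_set (set_mset M)"
        by (intro multiset_eqI) (metis count_eq_zero_iff count_mset_set(1) count_mset_set(3) finite_set_mset le_antisym less_one not_le)
      hence "size M = card (set_mset M)" by (metis size_mset_set)
      thus ?thesis using M(1) roots by simp
    qed
    moreover have "degree_le ((2 * d - 1) * d) r"
      using r(3) degree_pos by (simp add: mult_2)
    ultimately show thesis using r(1) that by blast
  qed (use cF cF' dF' degree_pos in auto)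
qed

end

section \<open>Counting reducible plane sections\<close>

text \<open>Zero counts as reducible, being 0 * 0, so planes on which f vanishes identically are
  included in the bad triples.\<close>

definition reducible :: "'s::comm_semiring_1 \<Rightarrow> bool" where
  "reducible g \<longleftrightarrow> (\<exists>h u. g = h * u \<and> \<not> h dvd 1 \<and> \<not> u dvd 1)"

text \<open>The section along \<open>(w, v, z)\<close> is controlled off the zeros of the leading form of \<open>f\<close> at \<open>w\<close> (degree \<open>d\<close>),
  of a partial derivative of \<open>f\<close> along \<open>w\<close> (degree 1), of a discriminant at \<open>v\<close>, and of a minor at \<open>z\<close>.\<close>

definition bad_bound :: "nat \<Rightarrow> nat" where
  "bad_bound d = d + 1 + (2 * d - 1) * d + (d - 1) * ((2 * d - 1) * d)"

lemma card_Sigma_mult_le: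
  fixes q b :: nat
  assumes "finite I" "\<And>i. i \<in> I \<Longrightarrow> finite (F i)" "\<And>i. i \<in> I \<Longrightarrow> card (F i) * q \<le> b"
  shows "card (SIGMA i:I. F i) * q \<le> card I * b"
proof -
  have "card (SIGMA i:I. F i) * q = (\<Sum>i\<in>I. card (F i) * q)"
    using assms(1,2) by (simp add: card_SigmaI sum_distrib_right)
  also have "\<dots> \<le> (\<Sum>i\<in>I. b)" by (rule sum_mono) (rule assms(3))
  finally show ?thesis by simp
qed

text \<open>The vectors are chosen in the order w, v, z because the discriminant depends on w, and
  the minor on both w and v. Schwartz-Zippel is applied in each fibre. The finite set
  \<open>S\<close> stands for the copy of the finite field inside its closure.\<close>

theorem card_reducible_sections_le:
  fixes f :: "('n::{finite,linorder}, 'k::alg_closed_field) mpoly" and S :: "'k set"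
  assumes irr: "irreducible f" and deg: "degree_le d f" and d: "0 < d"
    and top: "homogeneous_part d f \<noteq> 0" and char: "CHAR('k) > 0" and S: "finite S"
  defines "V \<equiv> {z :: 'n \<Rightarrow> 'k. \<forall>i. z i \<in> S}"
  shows "card {(w, v, z) \<in> V \<times> V \<times> V. reducible (plane_section (\<lambda>a. a) v z w f)} * card S
    \<le> bad_bound d * (card S ^ CARD('n)) ^ 3"
proof -
  let ?q = "card S" and ?N = "card S ^ CARD('n)"
  let ?z = "\<lambda>p z. mpeval (\<lambda>a. a) z p = (0 :: 'k)"
  have VPi: "V = UNIV \<rightarrow>\<^sub>E S" by (auto simp: V_def PiE_def)
  have finV: "finite V" unfolding VPi using S by (intro finite_PiE) auto
  have cardV: "card V = ?N" unfolding VPi by (simp add: card_PiE)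
  have zeros: "card {z \<in> V. ?z p z} * ?q \<le> e * ?N" if "p \<noteq> 0" "degree_le e p" for p :: "('n, 'k) mpoly" and e
    using card_zeros_mpoly_le[OF S that] unfolding V_def by simp
  obtain i0 where i0: "partial_deriv i0 f \<noteq> 0"
    using irreducible_partial_deriv_nonzero[OF irr char] by blast
  have "\<exists>m0. Poly_Mapping.lookup (partial_deriv i0 f) m0 \<noteq> 0"
  proof (rule ccontr)
    assume "\<not> ?thesis"
    hence "partial_deriv i0 f = 0" by (intro poly_mapping_eqI) simp
    with i0 show False by blast
  qed
  then obtain m0 where m0: "Poly_Mapping.lookup (partial_deriv i0 f) m0 \<noteq> 0" by blast
  \<comment> \<open>\<open>L\<close> evaluated at w is the coefficient of the monomial
    \<open>m0\<close> in the derivative of f along w. It is a nonzero linear form because its entry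
    at \<open>i0\<close> is nonzero.\<close>
  define l where "l i = Poly_Mapping.lookup (partial_deriv i f) m0" for i
  define L :: "('n, 'k) mpoly" where "L = (\<Sum>i\<in>UNIV. mconst (l i) * mvar i)"
  note eval = comm_ring_hom.mpeval_sum[OF comm_ring_hom_id] comm_ring_hom.mpeval_mult[OF comm_ring_hom_id]
    comm_ring_hom.mpeval_mconst[OF comm_ring_hom_id] comm_ring_hom.mpeval_mvar[OF comm_ring_hom_id]
  have evL: "mpeval (\<lambda>a. a) w L = (\<Sum>i\<in>UNIV. w i * l i)" for w
    unfolding L_def eval
    by (rule sum.cong[OF refl], rule mult.commute)
  have L0: "L \<noteq> 0"
  proof
    assume "L = 0"
    hence "mpeval (\<lambda>a. a) (\<lambda>i. if i = i0 then 1 else 0) L = 0" by (simp add: mpeval_def)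
    moreover have "mpeval (\<lambda>a. a) (\<lambda>i. if i = i0 then 1 else 0) L = (\<Sum>i\<in>UNIV. if i = i0 then l i else 0)"
      unfolding evL by (intro sum.cong refl) simp
    ultimately have "l i0 = 0" by simp
    with m0 show False unfolding l_def by blast
  qed
  have degL: "degree_le 1 L"
  proof -
    interpret R: filtration "degree_le :: nat \<Rightarrow> ('n, 'k) mpoly \<Rightarrow> bool" by (rule filtration_degree_le)
    show ?thesis unfolding L_def by (rule R.sum, rule R.scale, rule degree_le_mconst, rule degree_le_mvar)
  qed
  define B1 where "B1 = {w \<in> V. ?z (homogeneous_part d f) w}"
  define B2 where "B2 = {w \<in> V. ?z L w}"
  define W where "W = V - B1 - B2"
  have form: "irreducible_form f d w" if "w \<in> W" for w
    by (rule irreducible_form.intro[OF irr deg d]) (use that in \<open>simp add: W_def B1_def\<close>)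
  define PD where "PD w D \<longleftrightarrow> D \<noteq> 0 \<and> degree_le ((2 * d - 1) * d) D \<and>
      (\<forall>v. \<not> ?z D v \<longrightarrow> card {x. poly (line_section v w f) x = 0} = d)" for w and D :: "('n, 'k) mpoly"
  have exD: "\<exists>D. PD w D" if w: "w \<in> W" for w
  proof -
    interpret irreducible_form f d w by (rule form[OF w])
    have "pderiv (generic_line (\<lambda>_. 0) w f) \<noteq> 0"
    proof
      assume pd0: "pderiv (generic_line (\<lambda>_. 0) w f) = 0"
      have "coeff (pderiv (generic_line (\<lambda>_. 0) w f)) 0 = 0" unfolding pd0 by simp
      hence "coeff (generic_line (\<lambda>_. 0) w f) 1 = 0" by (simp only: coeff_pderiv) simp
      hence "Poly_Mapping.lookup (\<Sum>i\<in>UNIV. mconst (w i) * partial_deriv i f) m0 = 0"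
        unfolding coeff_1_generic_line by simp
      moreover have "Poly_Mapping.lookup (mconst a * p) m = a * Poly_Mapping.lookup p m" for a m and p :: "('n, 'k) mpoly"
        unfolding mconst_def mult_map_scale_conv_mult[symmetric] by (simp add: Poly_Mapping.map.rep_eq when_def)
      ultimately have "?z L w" by (simp add: evL lookup_sum l_def)
      thus False using w unfolding W_def B2_def by blast
    qed
    then obtain D where "D \<noteq> 0" "degree_le ((2 * d - 1) * d) D"
      "\<And>v. \<not> ?z D v \<Longrightarrow> card {x. poly (line_section v w f) x = 0} = d"
      by (rule discriminant_exists) blast
    thus ?thesis unfolding PD_def by blast
  qed
  define D where "D w = (SOME D. PD w D)" for w
  have PD: "PD w (D w)" if "w \<in> W" for w
    using someI_ex[OF exD[OF that]] unfolding D_def .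
  have D: "D w \<noteq> 0" "degree_le ((2 * d - 1) * d) (D w)"
    "\<not> ?z (D w) v \<Longrightarrow> card {x. poly (line_section v w f) x = 0} = d" if "w \<in> W" for w v
    using PD[OF that] unfolding PD_def by blast+
  define B3 where "B3 w = {v \<in> V. ?z (D w) v}" for w
  define PQ where "PQ w v Q \<longleftrightarrow> Q \<noteq> 0 \<and> degree_le ((d - 1) * ((2 * d - 1) * d)) Q \<and>
      (\<forall>z. \<not> ?z Q z \<longrightarrow> \<not> reducible (plane_section (\<lambda>a. a) v z w f))" for w v and Q :: "('n, 'k) mpoly"
  have exQ: "\<exists>Q. PQ w v Q" if w: "w \<in> W" and v: "v \<in> V - B3 w" for w v
  proof -
    interpret irreducible_form f d w by (rule form[OF w])
    have "card {x. poly (line_section v w f) x = 0} = d"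
      using D(3)[OF w] v by (simp add: B3_def)
    then obtain Q where "Q \<noteq> 0" "degree_le ((d - 1) * ((2 * d - 1) * d)) Q"
      "\<And>z h u. \<not> ?z Q z \<Longrightarrow> plane_section (\<lambda>a. a) v z w f = h * u \<Longrightarrow> h dvd 1 \<or> u dvd 1"
      by (rule reducible_sections_on_hypersurface) blast
    thus ?thesis unfolding PQ_def reducible_def by blast
  qed
  define Q where "Q w v = (SOME Q. PQ w v Q)" for w v
  have PQ: "PQ w v (Q w v)" if "w \<in> W" "v \<in> V - B3 w" for w v
    using someI_ex[OF exQ[OF that]] unfolding Q_def .
  have Q: "Q w v \<noteq> 0" "degree_le ((d - 1) * ((2 * d - 1) * d)) (Q w v)"
    "\<not> ?z (Q w v) z \<Longrightarrow> \<not> reducible (plane_section (\<lambda>a. a) v z w f)"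
    if "w \<in> W" "v \<in> V - B3 w" for w v z
    using PQ[OF that] unfolding PQ_def by blast+
  define B4 where "B4 w v = {z \<in> V. ?z (Q w v) z}" for w v
  let ?bad = "{(w, v, z) \<in> V \<times> V \<times> V. reducible (plane_section (\<lambda>a. a) v z w f)}"
  let ?T1 = "B1 \<times> V \<times> V" and ?T2 = "B2 \<times> V \<times> V"
  let ?T3 = "SIGMA w:W. B3 w \<times> V" and ?T4 = "SIGMA w:W. SIGMA v:V - B3 w. B4 w v"
  have fin: "finite W" "finite B1" "finite B2" "finite (B3 w)" "finite (B4 w v)" "finite (V - B3 w)" for w v
    using finV by (auto simp: W_def B1_def B2_def B3_def B4_def)
  have "?bad \<subseteq> ?T1 \<union> ?T2 \<union> ?T3 \<union> ?T4"
  proof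
    fix t assume "t \<in> ?bad"
    then obtain w v z where t: "t = (w, v, z)" and V: "w \<in> V" "v \<in> V" "z \<in> V"
      and red: "reducible (plane_section (\<lambda>a. a) v z w f)"
      by auto
    show "t \<in> ?T1 \<union> ?T2 \<union> ?T3 \<union> ?T4"
    proof (cases "w \<in> B1 \<or> w \<in> B2")
      case True
      thus ?thesis using V by (simp add: t)
    next
      case False
      hence w: "w \<in> W" using V(1) by (simp add: W_def)
      show ?thesis
      proof (cases "v \<in> B3 w")
        case True
        thus ?thesis using V w by (simp add: t)
      next
        case False
        hence v: "v \<in> V - B3 w" using V(2) by simp
        have "?z (Q w v) z" using Q(3)[OF w v, of z] red by blast
        hence "z \<in> B4 w v" using V(3) by (simp add: B4_def)
        thus ?thesis using v w by (simp add: t)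
      qed
    qed
  qed
  hence "card ?bad \<le> card (?T1 \<union> ?T2 \<union> ?T3 \<union> ?T4)"
    using fin finV by (intro card_mono finite_UnI finite_SigmaI) auto
  also have "\<dots> \<le> card ?T1 + card ?T2 + card ?T3 + card ?T4"
    by (meson add_le_mono1 card_Un_le le_trans)
  finally have bad: "card ?bad * ?q \<le> card ?T1 * ?q + card ?T2 * ?q + card ?T3 * ?q + card ?T4 * ?q"
    unfolding add_mult_distrib[symmetric] by (rule mult_le_mono1)
  have "card B1 * ?q \<le> d * ?N"
    unfolding B1_def by (rule zeros[OF top degree_le_homogeneous_part])
  hence T1: "card ?T1 * ?q \<le> d * ?N ^ 3"
    using mult_le_mono1[of "card B1 * ?q" "d * ?N" "?N * ?N"]
    using mult_le_mono1[of "card B1 * ?q" "d * ?N" "?N * ?N"] by (simp add: card_cartesian_product cardV power3_eq_cube mult_ac)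
  have "card B2 * ?q \<le> 1 * ?N"
    unfolding B2_def by (rule zeros[OF L0 degL])
  hence T2: "card ?T2 * ?q \<le> 1 * ?N ^ 3"
    using mult_le_mono1[of "card B2 * ?q" "1 * ?N" "?N * ?N"]
    using mult_le_mono1[of "card B2 * ?q" "1 * ?N" "?N * ?N"] by (simp add: card_cartesian_product cardV power3_eq_cube mult_ac)
  have "card ?T3 * ?q \<le> card W * ((2 * d - 1) * d * ?N * ?N)"
  proof (rule card_Sigma_mult_le)
    fix w assume w: "w \<in> W"
    have "card (B3 w) * ?q \<le> (2 * d - 1) * d * ?N"
      unfolding B3_def by (rule zeros[OF D(1)[OF w] D(2)[OF w]])
    from mult_le_mono1[OF this, of ?N] show "card (B3 w \<times> V) * ?q \<le> (2 * d - 1) * d * ?N * ?N"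
      by (simp add: card_cartesian_product cardV mult_ac)
  qed (simp_all only: fin finV finite_cartesian_product)
  also have "\<dots> \<le> ?N * ((2 * d - 1) * d * ?N * ?N)"
    using card_mono[OF finV, of W] by (intro mult_le_mono1) (auto simp: W_def cardV)
  finally have T3: "card ?T3 * ?q \<le> (2 * d - 1) * d * ?N ^ 3"
    by (simp add: power3_eq_cube mult_ac)
  have "card ?T4 * ?q \<le> card W * (?N * ((d - 1) * ((2 * d - 1) * d) * ?N))"
  proof (rule card_Sigma_mult_le)
    fix w assume w: "w \<in> W"
    have "card (SIGMA v:V - B3 w. B4 w v) * ?q \<le> card (V - B3 w) * ((d - 1) * ((2 * d - 1) * d) * ?N)"
    proof (rule card_Sigma_mult_le)
      fix v assume v: "v \<in> V - B3 w"
      show "card (B4 w v) * ?q \<le> (d - 1) * ((2 * d - 1) * d) * ?N"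
        unfolding B4_def by (rule zeros[OF Q(1)[OF w v] Q(2)[OF w v]])
    qed (simp_all only: fin)
    also have "\<dots> \<le> ?N * ((d - 1) * ((2 * d - 1) * d) * ?N)"
      using card_mono[OF finV, of "V - B3 w"] by (intro mult_le_mono1) (auto simp: cardV)
    finally show "card (SIGMA v:V - B3 w. B4 w v) * ?q \<le> ?N * ((d - 1) * ((2 * d - 1) * d) * ?N)" .
  qed (simp_all only: fin finite_SigmaI)
  also have "\<dots> \<le> ?N * (?N * ((d - 1) * ((2 * d - 1) * d) * ?N))"
    using card_mono[OF finV, of W] by (intro mult_le_mono1) (auto simp: W_def cardV)
  finally have T4: "card ?T4 * ?q \<le> (d - 1) * ((2 * d - 1) * d) * ?N ^ 3"
    by (simp add: power3_eq_cube mult_ac)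
  have "bad_bound d * ?N ^ 3 = d * ?N ^ 3 + 1 * ?N ^ 3 + (2 * d - 1) * d * ?N ^ 3 + (d - 1) * ((2 * d - 1) * d) * ?N ^ 3"
    unfolding bad_bound_def add_mult_distrib by (rule refl)
  with bad T1 T2 T3 T4 show ?thesis by linarith
qed

section \<open>Reparametrisation of planes\<close>

lemma hom_is_unit: "comm_ring_hom h \<Longrightarrow> a dvd 1 \<Longrightarrow> h a dvd 1"
proof -
  assume "comm_ring_hom h" and a: "a dvd 1"
  then interpret h: comm_ring_hom h by simp
  show "h a dvd 1" using a by (rule h.hom_dvd_1)
qed

lemma irreducible_hom_image:
  assumes hom: "comm_ring_hom \<phi>" "comm_ring_hom \<psi>"
    and inv: "\<And>x. \<psi> (\<phi> x) = x" "\<And>y. \<phi> (\<psi> y) = y" and irr: "irreducible x"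
  shows "irreducible (\<phi> x)"
proof (rule irreducibleI)
  interpret q: comm_ring_hom \<psi> by fact
  show "\<phi> x \<noteq> 0"
  proof
    assume "\<phi> x = 0"
    hence "x = \<psi> 0" using inv(1)[of x] by simp
    thus False using irr by (simp add: irreducible_def)
  qed
  show "\<not> \<phi> x dvd 1"
  proof
    assume "\<phi> x dvd 1"
    from hom_is_unit[OF hom(2) this] have "x dvd 1" unfolding inv .
    thus False using irr by (simp add: irreducible_def)
  qed
  fix a b assume "\<phi> x = a * b"
  hence "x = \<psi> a * \<psi> b" using inv(1)[of x] by (simp add: q.hom_mult)
  hence "\<psi> a dvd 1 \<or> \<psi> b dvd 1" using irr by (simp add: irreducible_def)
  thus "a dvd 1 \<or> b dvd 1"
    using hom_is_unit[OF hom(1), of "\<psi> a"] hom_is_unit[OF hom(1), of "\<psi> b"] unfolding inv by blast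
qed

lemma hom_poly_map_poly:
  assumes "comm_ring_hom h" "e 0 = 0"
  shows "h (poly (map_poly e q) x) = poly (map_poly (\<lambda>a. h (e a)) q) (h x)"
proof -
  interpret h: comm_ring_hom h by fact
  have "map_poly h (map_poly e q) = map_poly (\<lambda>a. h (e a)) q"
    using assms(2) by (intro poly_eqI) (simp add: coeff_map_poly)
  thus ?thesis using h.poly_map_poly[of "map_poly e q" x] by simp
qed

definition subst2 :: "('b \<Rightarrow> 'r) \<Rightarrow> 'r \<Rightarrow> 'r \<Rightarrow> 'b::zero poly poly \<Rightarrow> 'r::comm_ring_1" where
  "subst2 c s t p = poly (map_poly (\<lambda>q. poly (map_poly c q) s) p) t"

lemma comm_ring_hom_subst2:
  assumes "comm_ring_hom c"
  shows "comm_ring_hom (subst2 c s t)"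
  unfolding subst2_def
  by (intro comm_ring_hom_comp[OF comm_ring_hom_poly] comm_ring_hom_map_poly assms)

lemma hom_subst2:
  assumes h: "comm_ring_hom h" and c: "c 0 = 0"
  shows "h (subst2 c s t p) = subst2 (\<lambda>a. h (c a)) (h s) (h t) p"
proof -
  have "h (subst2 c s t p) = poly (map_poly (\<lambda>q. h (poly (map_poly c q) s)) p) (h t)"
    unfolding subst2_def by (rule hom_poly_map_poly[OF h]) simp
  thus ?thesis unfolding subst2_def hom_poly_map_poly[where h = h and e = c, OF h c] .
qed

lemma subst2_map_poly:
  assumes "h 0 = 0" "c 0 = 0"
  shows "subst2 c s t (map_poly (map_poly h) p) = subst2 (\<lambda>a. c (h a)) s t p"
proof -
  have eq: "map_poly e (map_poly h' q) = map_poly (\<lambda>a. e (h' a)) q" if "h' 0 = 0" "e 0 = 0"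
    for e :: "'y::zero \<Rightarrow> 'z::zero" and h' :: "'x::zero \<Rightarrow> 'y" and q
    using that by (intro poly_eqI) (simp add: coeff_map_poly)
  show ?thesis unfolding subst2_def using assms by (simp add: eq)
qed

abbreviation const2 :: "'b::zero \<Rightarrow> 'b poly poly" where
  "const2 a \<equiv> [:[:a:]:]"

lemma subst2_linear:
  assumes "comm_ring_hom c"
  shows "subst2 c s t [:[:a, b:], [:e:]:] = c a + c b * s + c e * t"
    and subst2_const: "subst2 c s t [:[:a:]:] = c a"
proof -
  have "comm_ring_hom (\<lambda>q. poly (map_poly c q) s)"
    by (intro comm_ring_hom_comp[OF comm_ring_hom_poly] comm_ring_hom_map_poly assms)
  note lin = map_poly_linear[OF this] map_poly_linear[OF assms]
  show "subst2 c s t [:[:a, b:], [:e:]:] = c a + c b * s + c e * t" "subst2 c s t [:[:a:]:] = c a"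
    unfolding subst2_def lin by (simp_all add: mult.commute)
qed

lemma subst2_id: "subst2 const2 [:[:0, 1:]:] [:0, 1:] p = (p :: 'b::comm_ring_1 poly poly)"
proof -
  have inner: "poly (map_poly const2 q) [:[:0, 1:]:] = [:q:]" for q :: "'b poly"
  proof (induction q)
    case (pCons a q)
    have "[:pCons a q:] = const2 a + [:[:0, 1:]:] * [:q:]" by simp
    thus ?case using pCons by (simp add: map_poly_pCons)
  qed simp
  have "poly (map_poly (\<lambda>q. [:q:]) p) [:0, 1:] = p"
  proof (induction p)
    case (pCons a p)
    thus ?case by (simp add: map_poly_pCons)
  qed simp
  thus ?thesis unfolding subst2_def inner .
qed

lemma comm_ring_hom_const2: "comm_ring_hom (const2 :: 'b::comm_ring_1 \<Rightarrow> _)"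
  by (rule comm_ring_hom_comp[OF comm_ring_hom_const_poly comm_ring_hom_const_poly])

abbreviation lin2 :: "'b::zero \<Rightarrow> 'b \<Rightarrow> 'b \<Rightarrow> 'b poly poly" where
  "lin2 a0 a1 a2 \<equiv> [:[:a0, a1:], [:a2:]:]"

lemma subst2_lin2:
  "subst2 const2 (lin2 a0 a1 a2) (lin2 b0 b1 b2) (lin2 x y z) =
    lin2 (x + y * a0 + z * b0) (y * a1 + z * b1) (y * a2 + z * b2)"
  for x :: "'b::comm_ring_1"
  by (simp add: subst2_linear[OF comm_ring_hom_const2] algebra_simps)

lemma subst2_inverse:
  fixes s t s' t' :: "'b::comm_ring_1 poly poly"
  assumes "subst2 const2 s' t' s = [:[:0, 1:]:]" "subst2 const2 s' t' t = [:0, 1:]"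
  shows "subst2 const2 s' t' (subst2 const2 s t p) = (p :: 'b poly poly)"
proof -
  have const: "subst2 const2 s' t' (const2 a) = const2 a" for a :: 'b
    by (rule subst2_const[OF comm_ring_hom_const2])
  show ?thesis
    using hom_subst2[OF comm_ring_hom_subst2[OF comm_ring_hom_const2], of const2 s' t' s t p]
    unfolding const assms subst2_id by simp
qed

text \<open>The automorphism carries associate classes of factors to associate classes.
  Compatibility with absolute irreducibility is a separate hypothesis, since that notion refers to
  the closure, on which \<open>\<phi>\<close> itself does not act.\<close>

lemma num_abs_irr_factors_iso:
  fixes \<phi> \<psi> :: "'a::field poly poly \<Rightarrow> 'a poly poly"
  assumes hom: "comm_ring_hom \<phi>" "comm_ring_hom \<psi>"
    and inv: "\<And>x. \<psi> (\<phi> x) = x" "\<And>y. \<phi> (\<psi> y) = y"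
    and irr: "\<And>h. abs_irreducible_biv (\<phi> h) \<longleftrightarrow> abs_irreducible_biv h"
  shows "num_abs_irr_factors (\<phi> g) = num_abs_irr_factors g"
proof -
  have mult: "\<phi> (a * b) = \<phi> a * \<phi> b" "\<psi> (a * b) = \<psi> a * \<psi> b" for a b
  proof -
    interpret p: comm_ring_hom \<phi> by fact
    interpret q: comm_ring_hom \<psi> by fact
    show "\<phi> (a * b) = \<phi> a * \<phi> b" "\<psi> (a * b) = \<psi> a * \<psi> b" by (rule p.hom_mult q.hom_mult)+
  qed
  have dvd: "\<phi> a dvd \<phi> b \<longleftrightarrow> a dvd b" for a b
    unfolding dvd_def using mult inv by metis
  define cls where "cls h = {h'. h' dvd h \<and> h dvd h'}" for h :: "'a poly poly"
  have cls: "cls (\<phi> h) = \<phi> ` cls h" for h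
  proof
    show "\<phi> ` cls h \<subseteq> cls (\<phi> h)" by (auto simp: cls_def dvd)
    show "cls (\<phi> h) \<subseteq> \<phi> ` cls h"
    proof
      fix y assume "y \<in> cls (\<phi> h)"
      hence "\<phi> (\<psi> y) \<in> cls (\<phi> h)" by (simp add: inv)
      hence "\<psi> y \<in> cls h" by (simp add: cls_def dvd)
      thus "y \<in> \<phi> ` cls h" using inv(2)[of y] by (metis imageI)
    qed
  qed
  have "{cls h |h. h dvd \<phi> g \<and> abs_irreducible_biv h} = (`) \<phi> ` {cls h |h. h dvd g \<and> abs_irreducible_biv h}"
  proof -
    have "{cls h |h. h dvd \<phi> g \<and> abs_irreducible_biv h} = {cls (\<phi> h) |h. \<phi> h dvd \<phi> g \<and> abs_irreducible_biv (\<phi> h)}"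
      using inv(2) by metis
    thus ?thesis unfolding cls dvd irr by auto
  qed
  moreover have "inj ((`) \<phi>)"
    by (metis inj_def inv(1) inj_image_eq_iff)
  ultimately show ?thesis
    unfolding num_abs_irr_factors_def cls_def[symmetric] by (simp add: card_image inj_on_subset[OF _ subset_UNIV])
qed

section \<open>Extension of scalars to the algebraic closure\<close>

definition to_ac2 :: "'a::field poly poly \<Rightarrow> 'a alg_closure poly poly" where
  "to_ac2 = map_poly (map_poly to_ac)"

lemma comm_ring_hom_to_ac: "comm_ring_hom to_ac"
  by unfold_locales simp_all

lemma comm_ring_hom_to_ac2: "comm_ring_hom to_ac2"
  unfolding to_ac2_def by (intro comm_ring_hom_map_poly comm_ring_hom_to_ac)

lemma to_ac2_lin2: "to_ac2 (lin2 a b c) = lin2 (to_ac a) (to_ac b) (to_ac c)"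
  and to_ac2_const2: "to_ac2 (const2 a) = const2 (to_ac a)"
  unfolding to_ac2_def map_poly_linear[OF comm_ring_hom_map_poly[OF comm_ring_hom_to_ac]]
    map_poly_linear[OF comm_ring_hom_to_ac] by (rule refl)+

lemma to_ac2_subst2: "to_ac2 (subst2 const2 s t p) = subst2 const2 (to_ac2 s) (to_ac2 t) (to_ac2 p)"
proof -
  have "to_ac2 (subst2 const2 s t p) = subst2 (\<lambda>a. const2 (to_ac a)) (to_ac2 s) (to_ac2 t) p"
    using hom_subst2[OF comm_ring_hom_to_ac2, of const2 s t p] unfolding to_ac2_const2 by simp
  also have "\<dots> = subst2 const2 (to_ac2 s) (to_ac2 t) (to_ac2 p)"
    unfolding to_ac2_def by (rule subst2_map_poly[symmetric]) simp_all
  finally show ?thesis .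
qed

lemma restrict_plane_eq: "restrict_plane f v z w = plane_section (\<lambda>a. a) v z w f"
  by (simp add: restrict_plane_def plane_section_def mpeval_def)

text \<open>The coefficients come from Cramer's rule for the affine map of the plane. The inverse
  \<open>e\<close> of the determinant is given by an equation, which the embedding into the closure
  carries over verbatim.\<close>

lemma subst2_affine_inverse:
  fixes a0 a1 a2 b0 b1 b2 e :: "'b::field" and p :: "'b poly poly"
  assumes e: "(a1 * b2 - a2 * b1) * e = 1"
  shows "subst2 const2 (lin2 ((a2 * b0 - a0 * b2) * e) (b2 * e) (- a2 * e))
      (lin2 ((a0 * b1 - a1 * b0) * e) (- b1 * e) (a1 * e))
      (subst2 const2 (lin2 a0 a1 a2) (lin2 b0 b1 b2) p) = p" (is "subst2 _ ?s' ?t' (subst2 _ ?s ?t p) = p")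
    and "subst2 const2 (lin2 a0 a1 a2) (lin2 b0 b1 b2)
      (subst2 const2 (lin2 ((a2 * b0 - a0 * b2) * e) (b2 * e) (- a2 * e))
        (lin2 ((a0 * b1 - a1 * b0) * e) (- b1 * e) (a1 * e)) p) = p"
proof -
  have id: "lin2 0 1 0 = [:[:0, 1:]:]" "lin2 0 0 1 = [:0, 1 :: 'b poly:]"
    by (simp_all add: pCons_one)
  show "subst2 const2 ?s' ?t' (subst2 const2 ?s ?t p) = p"
  proof (rule subst2_inverse)
    have "a0 + a1 * ((a2 * b0 - a0 * b2) * e) + a2 * ((a0 * b1 - a1 * b0) * e) = a0 - a0 * ((a1 * b2 - a2 * b1) * e)"
      "a1 * (b2 * e) + a2 * (- b1 * e) = ((a1 * b2 - a2 * b1) * e)" "a1 * (- a2 * e) + a2 * (a1 * e) = 0"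
      by (simp_all add: algebra_simps)
    thus "subst2 const2 ?s' ?t' ?s = [:[:0, 1:]:]"
      unfolding subst2_lin2 id(1)[symmetric] by (simp only: e mult_1_right diff_self)
    have "b0 + b1 * ((a2 * b0 - a0 * b2) * e) + b2 * ((a0 * b1 - a1 * b0) * e) = b0 - b0 * ((a1 * b2 - a2 * b1) * e)"
      "b1 * (b2 * e) + b2 * (- b1 * e) = 0" "b1 * (- a2 * e) + b2 * (a1 * e) = ((a1 * b2 - a2 * b1) * e)"
      by (simp_all add: algebra_simps)
    thus "subst2 const2 ?s' ?t' ?t = [:0, 1:]"
      unfolding subst2_lin2 id(2)[symmetric] by (simp only: e mult_1_right diff_self)
  qed
  show "subst2 const2 ?s ?t (subst2 const2 ?s' ?t' p) = p"
  proof (rule subst2_inverse)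
    have "(a2 * b0 - a0 * b2) * e + b2 * e * a0 + - a2 * e * b0 = 0"
      "b2 * e * a1 + - a2 * e * b1 = ((a1 * b2 - a2 * b1) * e)" "b2 * e * a2 + - a2 * e * b2 = 0"
      by (simp_all add: algebra_simps)
    thus "subst2 const2 ?s ?t ?s' = [:[:0, 1:]:]"
      unfolding subst2_lin2 id(1)[symmetric] by (simp only: e mult_1_right diff_self)
    have "(a0 * b1 - a1 * b0) * e + - b1 * e * a0 + a1 * e * b0 = 0"
      "- b1 * e * a1 + a1 * e * b1 = 0" "- b1 * e * a2 + a1 * e * b2 = ((a1 * b2 - a2 * b1) * e)"
      by (simp_all add: algebra_simps)
    thus "subst2 const2 ?s ?t ?t' = [:0, 1:]"
      unfolding subst2_lin2 id(2)[symmetric] by (simp only: e mult_1_right diff_self)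
  qed
qed

text \<open>A change of parametrisation acts on the restriction by an invertible affine substitution
  of S and T. The same substitution over the closure is invertible as well, so absolute
  irreducibility is preserved.\<close>

lemma num_abs_irr_factors_affine:
  fixes f :: "('n::finite, 'a::field) mpoly"
  assumes det: "a1 * b2 - a2 * b1 \<noteq> 0"
  shows "num_abs_irr_factors (restrict_plane f (\<lambda>i. v i + a0 * z i + b0 * w i)
      (\<lambda>i. a1 * z i + b1 * w i) (\<lambda>i. a2 * z i + b2 * w i))
    = num_abs_irr_factors (restrict_plane f v z w)"
proof -
  define \<phi> :: "'a poly poly \<Rightarrow> 'a poly poly" where "\<phi> = subst2 const2 (lin2 a0 a1 a2) (lin2 b0 b1 b2)"
  define e where "e = inverse (a1 * b2 - a2 * b1)"
  have e: "(a1 * b2 - a2 * b1) * e = 1" unfolding e_def using det by (rule right_inverse)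
  define \<psi> :: "'a poly poly \<Rightarrow> 'a poly poly" where
    "\<psi> = subst2 const2 (lin2 ((a2 * b0 - a0 * b2) * e) (b2 * e) (- a2 * e))
      (lin2 ((a0 * b1 - a1 * b0) * e) (- b1 * e) (a1 * e))"
  have hom: "comm_ring_hom \<phi>" "comm_ring_hom \<psi>"
    unfolding \<phi>_def \<psi>_def by (rule comm_ring_hom_subst2[OF comm_ring_hom_const2])+
  have inv: "\<psi> (\<phi> p) = p" "\<phi> (\<psi> p) = p" for p
    unfolding \<phi>_def \<psi>_def by (rule subst2_affine_inverse[OF e])+
  define \<Phi> where "\<Phi> = subst2 const2 (to_ac2 (lin2 a0 a1 a2)) (to_ac2 (lin2 b0 b1 b2))"
  have e': "(to_ac a1 * to_ac b2 - to_ac a2 * to_ac b1) * to_ac e = 1"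
    using arg_cong[OF e, of to_ac] by simp
  have \<Phi>: "\<Phi> (to_ac2 p) = to_ac2 (\<phi> p)" for p
    unfolding \<Phi>_def \<phi>_def to_ac2_subst2 by (rule refl)
  note inv1 = subst2_affine_inverse(1)[OF e', of "to_ac b0" "to_ac a0", folded to_ac2_lin2, folded \<Phi>_def]
  note inv2 = subst2_affine_inverse(2)[OF e', of "to_ac a0" "to_ac b0", folded to_ac2_lin2, folded \<Phi>_def]
  have hom\<Phi>: "comm_ring_hom \<Phi>"
    unfolding \<Phi>_def by (rule comm_ring_hom_subst2[OF comm_ring_hom_const2])
  have "irreducible (\<Phi> x) \<longleftrightarrow> irreducible x" for x
  proof
    assume "irreducible x"
    thus "irreducible (\<Phi> x)"
      by (rule irreducible_hom_image[OF hom\<Phi> comm_ring_hom_subst2[OF comm_ring_hom_const2] inv1 inv2])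
  next
    assume "irreducible (\<Phi> x)"
    from irreducible_hom_image[OF comm_ring_hom_subst2[OF comm_ring_hom_const2] hom\<Phi> inv2 inv1 this]
    show "irreducible x" unfolding inv1 .
  qed
  hence irr: "abs_irreducible_biv (\<phi> h) \<longleftrightarrow> abs_irreducible_biv h" for h
    unfolding abs_irreducible_biv_def to_ac2_def[symmetric] \<Phi>[symmetric] by simp
  have "restrict_plane f (\<lambda>i. v i + a0 * z i + b0 * w i) (\<lambda>i. a1 * z i + b1 * w i) (\<lambda>i. a2 * z i + b2 * w i)
      = \<phi> (restrict_plane f v z w)"
    unfolding restrict_plane_eq plane_section_def comm_ring_hom.hom_mpeval[OF hom(1)]
    unfolding \<phi>_def subst2_lin2 subst2_const[OF comm_ring_hom_const2] by (simp add: mult.commute)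
  thus ?thesis using num_abs_irr_factors_iso[OF hom inv irr] by simp
qed

text \<open>The order (w, v, z) is that of the count of reducible sections: v is the base point, z
  and w are the directions of the inner and the outer variable.\<close>

definition plane_params :: "('n \<Rightarrow> 'a::field) set \<Rightarrow> (('n \<Rightarrow> 'a) \<times> ('n \<Rightarrow> 'a) \<times> ('n \<Rightarrow> 'a)) set" where
  "plane_params L = {(w, v, z). lin_indep2 z w \<and> L = affine_plane_of v z w}"

lemma plane_params_change:
  fixes v z w :: "'n \<Rightarrow> 'a::field"
  assumes "(w, v, z) \<in> plane_params L" "(w', v', z') \<in> plane_params L"
  obtains a0 a1 a2 b0 b1 b2 where "a1 * b2 - a2 * b1 \<noteq> 0" "v' = (\<lambda>i. v i + a0 * z i + b0 * w i)"
    "z' = (\<lambda>i. a1 * z i + b1 * w i)" "w' = (\<lambda>i. a2 * z i + b2 * w i)"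
proof -
  have L: "L = affine_plane_of v z w" "L = affine_plane_of v' z' w'" and li: "lin_indep2 z' w'"
    using assms by (auto simp: plane_params_def)
  have inL: "\<exists>a b. (\<lambda>i. v' i + s * z' i + t * w' i) = (\<lambda>i. v i + a * z i + b * w i)" for s t
  proof -
    have "(\<lambda>i. v' i + s * z' i + t * w' i) \<in> affine_plane_of v' z' w'"
      unfolding affine_plane_of_def by (rule CollectI, rule exI, rule exI, rule conjI[OF refl TrueI])
    hence "(\<lambda>i. v' i + s * z' i + t * w' i) \<in> affine_plane_of v z w"
      using L by (simp only:)
    thus ?thesis unfolding affine_plane_of_def by (elim CollectE exE conjE) (intro exI)
  qed
  obtain a0 b0 where "(\<lambda>i. v' i + 0 * z' i + 0 * w' i) = (\<lambda>i. v i + a0 * z i + b0 * w i)" using inL by blast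
  from fun_cong[OF this] have v': "v' i = v i + a0 * z i + b0 * w i" for i by simp
  obtain a b where "(\<lambda>i. v' i + 1 * z' i + 0 * w' i) = (\<lambda>i. v i + a * z i + b * w i)" using inL by blast
  from fun_cong[OF this] have vz: "v' i + z' i = v i + a * z i + b * w i" for i by simp
  have z': "z' i = (a - a0) * z i + (b - b0) * w i" for i
  proof -
    have "z' i = (v' i + z' i) - v' i" by simp
    also have "\<dots> = (v i + a * z i + b * w i) - v' i" by (simp only: vz)
    also have "\<dots> = (a - a0) * z i + (b - b0) * w i" unfolding v' by (simp add: algebra_simps)
    finally show ?thesis .
  qed
  obtain e g where "(\<lambda>i. v' i + 0 * z' i + 1 * w' i) = (\<lambda>i. v i + e * z i + g * w i)" using inL by blast
  from fun_cong[OF this] have vw: "v' i + w' i = v i + e * z i + g * w i" for i by simp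
  have w': "w' i = (e - a0) * z i + (g - b0) * w i" for i
  proof -
    have "w' i = (v' i + w' i) - v' i" by simp
    also have "\<dots> = (v i + e * z i + g * w i) - v' i" by (simp only: vw)
    also have "\<dots> = (e - a0) * z i + (g - b0) * w i" unfolding v' by (simp add: algebra_simps)
    finally show ?thesis .
  qed
  have "(a - a0) * (g - b0) - (e - a0) * (b - b0) \<noteq> 0"
  proof
    assume det: "(a - a0) * (g - b0) - (e - a0) * (b - b0) = 0"
    have li': "x = 0 \<and> y = 0" if "\<And>i. x * z' i + y * w' i = 0" for x y
      using li that unfolding lin_indep2_def by blast
    \<comment> \<open>If the determinant vanishes, the rows of the adjugate are linear relations
      between z' and w'. All four matrix entries are then 0, so z' = 0, contrary to
      independence.\<close>
    have "(g - b0) * z' i + (- (b - b0)) * w' i = ((a - a0) * (g - b0) - (e - a0) * (b - b0)) * z i" for i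
      unfolding z' w' by (simp add: algebra_simps)
    hence 1: "g - b0 = 0 \<and> - (b - b0) = 0" unfolding det mult_zero_left by (rule li')
    have "(e - a0) * z' i + (- (a - a0)) * w' i = - ((a - a0) * (g - b0) - (e - a0) * (b - b0)) * w i" for i
      unfolding z' w' by (simp add: algebra_simps)
    hence 2: "e - a0 = 0 \<and> - (a - a0) = 0" unfolding det minus_zero mult_zero_left by (rule li')
    have "1 * z' i + 0 * w' i = 0" for i using 1 2 unfolding z' by simp
    from li'[OF this] show False by simp
  qed
  from this ext[OF v'] ext[OF z'] ext[OF w'] show thesis by (rule that)
qed

lemma num_abs_irr_factors_plane:
  assumes "(w, v, z) \<in> plane_params L" "(w', v', z') \<in> plane_params L"
  shows "num_abs_irr_factors (restrict_plane f v' z' w') = num_abs_irr_factors (restrict_plane f v z w)"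
proof -
  obtain a0 a1 a2 b0 b1 b2 where det: "a1 * b2 - a2 * b1 \<noteq> 0" and v': "v' = (\<lambda>i. v i + a0 * z i + b0 * w i)"
    and z': "z' = (\<lambda>i. a1 * z i + b1 * w i)" and w': "w' = (\<lambda>i. a2 * z i + b2 * w i)"
    by (rule plane_params_change[OF assms])
  show ?thesis unfolding v' z' w' by (rule num_abs_irr_factors_affine[OF det])
qed

text \<open>The usual count for GL_2: a nonzero first vector x, then a second vector off the line
  spanned by x, which contains at most q vectors.\<close>

lemma card_GL2_ge:
  defines "q \<equiv> CARD('a::{finite,field})"
  shows "(q\<^sup>2 - 1) * (q\<^sup>2 - q) \<le> card (SIGMA x:UNIV - {(0, 0)}. {y :: 'a \<times> 'a. fst x * snd y - fst y * snd x \<noteq> 0})"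
proof -
  have fib: "q\<^sup>2 - q \<le> card {y :: 'a \<times> 'a. fst x * snd y - fst y * snd x \<noteq> 0}" if x: "x \<noteq> (0, 0)" for x
  proof -
    let ?C = "{y :: 'a \<times> 'a. fst x * snd y - fst y * snd x = 0}"
    have "?C \<subseteq> range (\<lambda>t. (t * fst x, t * snd x))"
    proof
      fix y assume "y \<in> ?C"
      hence y: "fst x * snd y = fst y * snd x" by simp
      show "y \<in> range (\<lambda>t. (t * fst x, t * snd x))"
      proof (cases "fst x = 0")
        case True
        hence "snd x \<noteq> 0" using x by (simp add: prod_eq_iff)
        hence "y = (snd y / snd x * fst x, snd y / snd x * snd x)"
          using True y by (simp add: prod_eq_iff)
        thus ?thesis by (rule range_eqI)
      next
        case False
        hence "y = (fst y / fst x * fst x, fst y / fst x * snd x)"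
          using y by (simp add: prod_eq_iff nonzero_eq_divide_eq mult.commute)
        thus ?thesis by (rule range_eqI)
      qed
    qed
    hence "card ?C \<le> card (range (\<lambda>t :: 'a. (t * fst x, t * snd x)))"
      by (rule card_mono[rotated]) simp
    also have "\<dots> \<le> q" unfolding q_def by (rule card_image_le) simp
    finally have "card ?C \<le> q" .
    moreover have "card {y :: 'a \<times> 'a. fst x * snd y - fst y * snd x \<noteq> 0} = q\<^sup>2 - card ?C"
    proof -
      have "{y :: 'a \<times> 'a. fst x * snd y - fst y * snd x \<noteq> 0} = UNIV - ?C" by blast
      thus ?thesis by (simp add: card_Diff_subset q_def power2_eq_square)
    qed
    ultimately show ?thesis by simp
  qed
  have "(q\<^sup>2 - 1) * (q\<^sup>2 - q) = (\<Sum>x\<in>UNIV - {(0 :: 'a, 0 :: 'a)}. q\<^sup>2 - q)"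
    by (simp add: card_Diff_subset q_def power2_eq_square)
  also have "\<dots> \<le> (\<Sum>x\<in>UNIV - {(0, 0)}. card {y :: 'a \<times> 'a. fst x * snd y - fst y * snd x \<noteq> 0})"
    by (intro sum_mono fib) simp
  also have "\<dots> = card (SIGMA x:UNIV - {(0, 0)}. {y :: 'a \<times> 'a. fst x * snd y - fst y * snd x \<noteq> 0})"
    by (rule card_SigmaI[symmetric]) simp_all
  finally show ?thesis .
qed

lemma lin_indep2_eqD:
  assumes "lin_indep2 z w" "\<And>i. a * z i + b * w i = a' * z i + b' * w i"
  shows "a = a'" "b = b'"
proof -
  have "(a - a') * z i + (b - b') * w i = 0" for i
  proof -
    have "(a - a') * z i + (b - b') * w i = (a * z i + b * w i) - (a' * z i + b' * w i)"
      by (simp add: algebra_simps)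
    thus ?thesis unfolding assms(2) by simp
  qed
  hence "a - a' = 0 \<and> b - b' = 0" using assms(1) unfolding lin_indep2_def by blast
  thus "a = a'" "b = b'" by simp_all
qed

lemma card_affine_plane_of:
  fixes v z w :: "'n \<Rightarrow> 'a::{finite,field}"
  assumes li: "lin_indep2 z w"
  shows "card (affine_plane_of v z w) = CARD('a)\<^sup>2"
proof -
  let ?p = "\<lambda>(s, t) i. v i + s * z i + t * w i"
  have eq: "affine_plane_of v z w = range ?p"
    by (auto simp: affine_plane_of_def)
  have "inj ?p"
  proof (rule injI, clarify)
    fix s t s' t' assume e: "(\<lambda>i. v i + s * z i + t * w i) = (\<lambda>i. v i + s' * z i + t' * w i)"
    have "s * z i + t * w i = s' * z i + t' * w i" for i
      using fun_cong[OF e, of i] by (simp add: add.assoc)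
    from lin_indep2_eqD[OF li this] show "s = s' \<and> t = t'" by blast
  qed
  thus ?thesis unfolding eq by (subst card_image) (simp_all add: power2_eq_square)
qed

text \<open>From one parametrisation, q^2 translations of the base point within the plane and all
  invertible changes of the two directions produce pairwise different ones. The new plane lies in
  the old one and both have q^2 points, so they are equal.\<close>

lemma card_plane_params_ge:
  fixes L :: "('n::finite \<Rightarrow> 'a::{finite,field}) set"
  assumes ne: "plane_params L \<noteq> {}"
  defines "q \<equiv> CARD('a)"
  shows "q\<^sup>2 * ((q\<^sup>2 - 1) * (q\<^sup>2 - q)) \<le> card (plane_params L)"
proof -
  obtain w v z where li: "lin_indep2 z w" and L: "L = affine_plane_of v z w"
    using ne by (auto simp: plane_params_def)
  let ?G = "SIGMA x:UNIV - {(0, 0)}. {y :: 'a \<times> 'a. fst x * snd y - fst y * snd x \<noteq> 0}"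
  define comb where "comb x = (\<lambda>i. fst x * z i + snd x * w i)" for x :: "'a \<times> 'a"
  have comb_inj: "x = y" if "comb x = comb y" for x y
  proof -
    have "fst x * z i + snd x * w i = fst y * z i + snd y * w i" for i
      using fun_cong[OF that, of i] by (simp add: comb_def)
    from lin_indep2_eqD[OF li this] show ?thesis by (rule prod_eqI)
  qed
  define J :: "('a \<times> 'a) \<times> ('a \<times> 'a) \<times> ('a \<times> 'a) \<Rightarrow> _" where "J = (\<lambda>(c, x, y). (comb y, (\<lambda>i. v i + comb c i), comb x))"
  have "inj J"
  proof (rule injI)
    fix t t' assume "J t = J t'"
    obtain c x y where t: "t = (c, x, y)" by (rule prod_cases3)
    obtain c' x' y' where t': "t' = (c', x', y')" by (rule prod_cases3)
    from \<open>J t = J t'\<close> have e: "comb y = comb y'" "(\<lambda>i. v i + comb c i) = (\<lambda>i. v i + comb c' i)" "comb x = comb x'"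
      unfolding t t' J_def by simp_all
    have "comb c = comb c'"
    proof
      fix i show "comb c i = comb c' i" using fun_cong[OF e(2), of i] by simp
    qed
    from comb_inj[OF this] comb_inj[OF e(1)] comb_inj[OF e(3)] show "t = t'" unfolding t t' by simp
  qed
  moreover have "J ` (UNIV \<times> ?G) \<subseteq> plane_params L"
  proof (rule image_subsetI)
    fix t :: "('a \<times> 'a) \<times> ('a \<times> 'a) \<times> ('a \<times> 'a)"
    assume "t \<in> UNIV \<times> ?G"
    then obtain c x y :: "'a \<times> 'a" where t: "t = (c, x, y)" and det: "fst x * snd y - fst y * snd x \<noteq> 0" by auto
    have li': "lin_indep2 (comb x) (comb y)"
      unfolding lin_indep2_def
    proof (intro allI impI)
      fix a b assume *: "\<forall>i. a * comb x i + b * comb y i = 0"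
      have "(a * fst x + b * fst y) * z i + (a * snd x + b * snd y) * w i = 0" for i
        using *[rule_format, of i] by (simp add: comb_def algebra_simps)
      hence 0: "a * fst x + b * fst y = 0" "a * snd x + b * snd y = 0"
        using li unfolding lin_indep2_def by blast+
      have "a * (fst x * snd y - fst y * snd x) = (a * fst x + b * fst y) * snd y - (a * snd x + b * snd y) * fst y"
        by (simp add: algebra_simps)
      hence "a = 0" unfolding 0 using det by simp
      moreover have "b * (fst x * snd y - fst y * snd x) = (a * snd x + b * snd y) * fst x - (a * fst x + b * fst y) * snd x"
        by (simp add: algebra_simps)
      hence "b = 0" unfolding 0 using det by simp
      ultimately show "a = 0 \<and> b = 0" by blast
    qed
    have "affine_plane_of (\<lambda>i. v i + comb c i) (comb x) (comb y) = affine_plane_of v z w"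
    proof (rule card_subset_eq)
      show "finite (affine_plane_of v z w)" by (rule finite)
      show "affine_plane_of (\<lambda>i. v i + comb c i) (comb x) (comb y) \<subseteq> affine_plane_of v z w"
      proof
        fix u assume "u \<in> affine_plane_of (\<lambda>i. v i + comb c i) (comb x) (comb y)"
        then obtain s r where "u = (\<lambda>i. v i + comb c i + s * comb x i + r * comb y i)"
          unfolding affine_plane_of_def by blast
        hence "u = (\<lambda>i. v i + (fst c + s * fst x + r * fst y) * z i + (snd c + s * snd x + r * snd y) * w i)"
          by (simp add: fun_eq_iff comb_def algebra_simps)
        thus "u \<in> affine_plane_of v z w" unfolding affine_plane_of_def by blast
      qed
      show "card (affine_plane_of (\<lambda>i. v i + comb c i) (comb x) (comb y)) = card (affine_plane_of v z w)"
        unfolding card_affine_plane_of[OF li] card_affine_plane_of[OF li'] by (rule refl)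
    qed
    thus "J t \<in> plane_params L" using li' by (simp add: t J_def plane_params_def L)
  qed
  ultimately have "card ((UNIV :: ('a \<times> 'a) set) \<times> ?G) \<le> card (plane_params L)"
    by (intro card_inj_on_le[of J]) (erule inj_on_subset[OF _ subset_UNIV], assumption, rule finite)
  moreover have "card ((UNIV :: ('a \<times> 'a) set) \<times> ?G) = q\<^sup>2 * card ?G"
    by (simp only: card_cartesian_product) (simp add: q_def power2_eq_square)
  moreover have "q\<^sup>2 * ((q\<^sup>2 - 1) * (q\<^sup>2 - q)) \<le> q\<^sup>2 * card ?G"
    unfolding q_def by (rule mult_le_mono2[OF card_GL2_ge])
  ultimately show ?thesis by linarith
qed

section \<open>Two absolutely irreducible factors force a proper factorisation\<close>

lemma is_unit_to_ac2:
  assumes "to_ac2 u dvd 1"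
  shows "u dvd 1"
proof -
  have "degree (to_ac2 u) = 0" by (rule is_unit_poly_degree[OF assms])
  then obtain p where p: "to_ac2 u = [:p:]" by (rule degree_eq_zeroE)
  hence "p dvd 1" using assms by (simp add: is_unit_const_poly_iff)
  hence "degree p = 0" by (rule is_unit_poly_degree)
  then obtain b where b: "p = [:b:]" by (rule degree_eq_zeroE)
  have c: "map_poly to_ac (coeff u i) = coeff (to_ac2 u) i" for i
    by (simp add: to_ac2_def coeff_map_poly)
  have "u = const2 (coeff (coeff u 0) 0)"
  proof (intro poly_eqI)
    fix i j
    have "to_ac (coeff (coeff u i) j) = coeff (coeff (to_ac2 u) i) j"
      unfolding c[symmetric] by (simp add: coeff_map_poly)
    hence "to_ac (coeff (coeff u i) j) = (if i = 0 \<and> j = 0 then b else 0)"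
      unfolding p b by (simp add: coeff_pCons split: nat.split)
    thus "coeff (coeff u i) j = coeff (coeff (const2 (coeff (coeff u 0) 0)) i) j"
      by (cases i; cases j) simp_all
  qed
  moreover have "coeff (coeff u 0) 0 \<noteq> 0"
  proof
    assume "coeff (coeff u 0) 0 = 0"
    with \<open>u = const2 (coeff (coeff u 0) 0)\<close> have "u = 0" by simp
    hence "to_ac2 u = 0" by (simp add: to_ac2_def)
    thus False using assms by simp
  qed
  hence "const2 (coeff (coeff u 0) 0) dvd 1"
    by (simp add: is_unit_const_poly_iff dvd_field_iff)
  ultimately show ?thesis by simp
qed

text \<open>Without a proper factorisation over the closure, the cofactor of every absolutely
  irreducible factor is a unit; all such factors are then associated to \<open>g\<close> and form at
  most one class.\<close>

lemma reducible_if_two_factors: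
  assumes "num_abs_irr_factors g \<ge> 2"
  shows "reducible (to_ac2 g)"
proof (rule ccontr)
  assume nred: "\<not> reducible (to_ac2 g)"
  interpret ac: comm_ring_hom to_ac2 by (rule comm_ring_hom_to_ac2)
  define cls where "cls h = {h'. h' dvd h \<and> h dvd h'}" for h :: "'a poly poly"
  have "cls h = cls g" if "h dvd g" "abs_irreducible_biv h" for h
  proof -
    obtain u where u: "g = h * u" using \<open>h dvd g\<close> unfolding dvd_def by blast
    have "\<not> to_ac2 h dvd 1"
      using that(2) unfolding abs_irreducible_biv_def to_ac2_def[symmetric] by (simp add: irreducible_def)
    moreover have "to_ac2 g = to_ac2 h * to_ac2 u" unfolding u by (rule ac.hom_mult)
    ultimately have "to_ac2 u dvd 1" using nred unfolding reducible_def by blast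
    hence "u dvd 1" by (rule is_unit_to_ac2)
    hence "g dvd h" unfolding u by (simp add: mult_unit_dvd_iff)
    have "h' dvd h \<longleftrightarrow> h' dvd g" "h dvd h' \<longleftrightarrow> g dvd h'" for h'
      using dvd_trans \<open>g dvd h\<close> \<open>h dvd g\<close> by (meson dvd_trans)+
    thus ?thesis unfolding cls_def by simp
  qed
  hence "{cls h |h. h dvd g \<and> abs_irreducible_biv h} \<subseteq> {cls g}" by blast
  hence "card {cls h |h. h dvd g \<and> abs_irreducible_biv h} \<le> card {cls g}"
    by (rule card_mono[rotated]) simp
  thus False using assms unfolding num_abs_irr_factors_def cls_def[symmetric] by simp
qed

section \<open>Restrictions over the finite field\<close>

text \<open>A copy of the index type carrying a linear order: without one the multivariate polynomials
  over \<open>'n\<close> are not known to form an integral domain.\<close>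

typedef ('n::finite) ix = "UNIV :: 'n set"
  by blast

lemma inj_Rep_ix: "inj Rep_ix"
  by (meson Rep_ix_inject injI)

lemma bij_Rep_ix: "bij (Rep_ix :: 'n::finite ix \<Rightarrow> 'n)"
  by (rule bijI[OF inj_Rep_ix]) (rule surjI, rule Abs_ix_inverse[OF UNIV_I])

instance ix :: (finite) finite
proof
  have "finite (range (Rep_ix :: 'a ix \<Rightarrow> 'a))" by (rule finite)
  thus "finite (UNIV :: 'a ix set)" by (rule finite_imageD) (rule inj_Rep_ix)
qed

lemma card_ix: "CARD('n::finite ix) = CARD('n)"
  using bij_betw_same_card[OF bij_Rep_ix] .

definition ix_rank :: "'n::finite ix \<Rightarrow> nat" where
  "ix_rank = (SOME e. inj e)"

lemma ix_rank_eqD: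
  assumes "ix_rank (x :: 'n::finite ix) = ix_rank y"
  shows "x = y"
proof -
  have "\<exists>e :: 'n ix \<Rightarrow> nat. inj e"
    using finite_imp_inj_to_nat_seg[OF finite[of "UNIV :: 'n ix set"]] by blast
  hence "inj (ix_rank :: 'n ix \<Rightarrow> nat)" unfolding ix_rank_def by (rule someI_ex)
  from injD[OF this assms] show ?thesis .
qed

instantiation ix :: (finite) linorder
begin

definition less_eq_ix :: "'a ix \<Rightarrow> 'a ix \<Rightarrow> bool" where
  "less_eq_ix x y \<longleftrightarrow> ix_rank x \<le> ix_rank y"

definition less_ix :: "'a ix \<Rightarrow> 'a ix \<Rightarrow> bool" where
  "less_ix x y \<longleftrightarrow> ix_rank x < ix_rank y"

instance
  by standard (auto simp: less_eq_ix_def less_ix_def intro: ix_rank_eqD)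

end

section \<open>Renaming of variables and passage to the closure\<close>

definition rename :: "('m \<Rightarrow> 'n) \<Rightarrow> ('m::finite, 'k::comm_ring_1) mpoly \<Rightarrow> ('n::finite, 'k) mpoly" where
  "rename \<rho> = mpeval mconst (\<lambda>i. mvar (\<rho> i))"

lemma comm_ring_hom_rename: "comm_ring_hom (rename \<rho>)"
  unfolding rename_def by (rule comm_ring_hom.comm_ring_hom_mpeval[OF comm_ring_hom_mconst])

lemma mpeval_rename:
  assumes "comm_ring_hom c"
  shows "mpeval c x (rename \<rho> p) = mpeval c (\<lambda>i. x (\<rho> i)) p"
  unfolding rename_def comm_ring_hom.hom_mpeval[OF comm_ring_hom.comm_ring_hom_mpeval[OF assms]]
    comm_ring_hom.mpeval_mconst[OF assms] comm_ring_hom.mpeval_mvar[OF assms] by (rule refl)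

lemma rename_inverse:
  assumes "\<And>i. \<sigma> (\<rho> i) = i"
  shows "rename \<sigma> (rename \<rho> p) = p"
  using mpeval_rename[OF comm_ring_hom_mconst, of "\<lambda>i. mvar (\<sigma> i)" \<rho> p]
  unfolding rename_def[of \<sigma>] assms mpeval_mconst_mvar .

lemma degree_le_rename:
  assumes "degree_le d p"
  shows "degree_le d (rename \<rho> p)"
  unfolding rename_def
  by (rule filtration.mpeval[OF filtration_degree_le degree_le_mconst degree_le_mvar assms])

text \<open>Turns the vanishing of the leading form into a degree bound, a property that renaming
  preserves in both directions.\<close>

lemma homogeneous_part_eq_0_iff:
  assumes "degree_le d p" "0 < d"
  shows "homogeneous_part d p = 0 \<longleftrightarrow> degree_le (d - 1) p"
proof
  assume h: "homogeneous_part d p = 0"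
  show "degree_le (d - 1) p" unfolding degree_le_def
  proof
    fix m assume m: "m \<in> Poly_Mapping.keys p"
    have "expo_degree m \<noteq> d"
    proof
      assume "expo_degree m = d"
      hence "Poly_Mapping.lookup p m = Poly_Mapping.lookup (homogeneous_part d p) m"
        by (simp add: lookup_homogeneous_part)
      thus False using m unfolding h by (simp add: in_keys_iff)
    qed
    moreover have "expo_degree m \<le> d" using assms(1) m unfolding degree_le_def by blast
    ultimately show "expo_degree m \<le> d - 1" by simp
  qed
next
  assume h: "degree_le (d - 1) p"
  show "homogeneous_part d p = 0"
  proof (rule poly_mapping_eqI)
    fix m
    have "expo_degree m = d \<Longrightarrow> m \<notin> Poly_Mapping.keys p"
      using h assms(2) unfolding degree_le_def by fastforce
    thus "Poly_Mapping.lookup (homogeneous_part d p) m = Poly_Mapping.lookup 0 m"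
      by (simp add: lookup_homogeneous_part in_keys_iff)
  qed
qed

lemma homogeneous_part_rename_nonzero:
  assumes inv: "\<And>i. \<sigma> (\<rho> i) = i" and p: "degree_le d p" "0 < d" "homogeneous_part d p \<noteq> 0"
  shows "homogeneous_part d (rename \<rho> p) \<noteq> 0"
proof
  assume "homogeneous_part d (rename \<rho> p) = 0"
  hence "degree_le (d - 1) (rename \<rho> p)"
    using homogeneous_part_eq_0_iff[OF degree_le_rename[OF p(1)] p(2)] by blast
  hence "degree_le (d - 1) (rename \<sigma> (rename \<rho> p))" by (rule degree_le_rename)
  thus False unfolding rename_inverse[of \<sigma> \<rho>, OF inv]
    using homogeneous_part_eq_0_iff[OF p(1,2)] p(3) by blast
qed

lemma lookup_map_to_ac: "Poly_Mapping.lookup (Poly_Mapping.map to_ac f) m = to_ac (Poly_Mapping.lookup f m)"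
  by (simp add: Poly_Mapping.map.rep_eq when_def)

lemma keys_map_to_ac: "Poly_Mapping.keys (Poly_Mapping.map to_ac f) = Poly_Mapping.keys f"
  by (auto simp: in_keys_iff lookup_map_to_ac)

lemma total_degree_map_to_ac: "total_degree (Poly_Mapping.map to_ac f) = total_degree f"
  by (simp add: total_degree_def keys_map_to_ac)

lemma mpeval_map_to_ac: "mpeval c x (Poly_Mapping.map to_ac f) = mpeval (\<lambda>a. c (to_ac a)) x f"
  by (simp add: mpeval_def keys_map_to_ac lookup_map_to_ac)

lemma to_ac2_restrict_plane:
  fixes f :: "('n::finite, 'a::field) mpoly"
  shows "to_ac2 (restrict_plane f v z w) =
    plane_section (\<lambda>a. a) (\<lambda>i. to_ac (v (Rep_ix i))) (\<lambda>i. to_ac (z (Rep_ix i))) (\<lambda>i. to_ac (w (Rep_ix i)))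
      (rename Abs_ix (Poly_Mapping.map to_ac f))"
proof -
  have c: "comm_ring_hom (\<lambda>a :: 'a alg_closure. [:[:a:]:])"
    by (rule comm_ring_hom_const_const(1)[OF comm_ring_hom_id])
  have "to_ac2 (restrict_plane f v z w) = plane_section to_ac (\<lambda>i. to_ac (v i)) (\<lambda>i. to_ac (z i)) (\<lambda>i. to_ac (w i)) f"
    unfolding restrict_plane_eq to_ac2_def hom_plane_section[OF comm_ring_hom_to_ac] by (rule refl)
  thus ?thesis
    unfolding plane_section_def mpeval_rename[OF c] mpeval_map_to_ac
    by (simp only: Abs_ix_inverse[OF UNIV_I])
qed

text \<open>The count over the closure is applied with \<open>S\<close> the image of the finite
  field. Triples over the finite field embed injectively, and reducibility is expressed by the same
  section after renaming the variables.\<close>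

theorem card_reducible_restrictions_le:
  fixes f :: "('n::finite, 'a::{finite,field}) mpoly"
  assumes irr: "abs_irreducible_mpoly f" and d: "0 < total_degree f"
  shows "card {(w, v, z). reducible (to_ac2 (restrict_plane f v z w))} * CARD('a)
    \<le> bad_bound (total_degree f) * (CARD('a) ^ CARD('n)) ^ 3"
proof -
  define F where "F = Poly_Mapping.map to_ac f"
  define F' :: "('n ix, 'a alg_closure) mpoly" where "F' = rename Abs_ix F"
  define S where "S = range (to_ac :: 'a \<Rightarrow> 'a alg_closure)"
  define V where "V = {z :: 'n ix \<Rightarrow> 'a alg_closure. \<forall>i. z i \<in> S}"
  let ?B = "{(w, v, z). reducible (to_ac2 (restrict_plane f v z w))}"
  let ?B' = "{(w, v, z) \<in> V \<times> V \<times> V. reducible (plane_section (\<lambda>a. a) v z w F')}"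
  define \<beta> where "\<beta> = (\<lambda>(w :: 'n \<Rightarrow> 'a) i. to_ac (w (Rep_ix i)))"
  define \<gamma> where "\<gamma> = map_prod \<beta> (map_prod \<beta> \<beta>)"
  have inv: "Rep_ix (Abs_ix i) = i" "Abs_ix (Rep_ix j) = j" for i :: 'n and j
    by (simp_all add: Abs_ix_inverse Rep_ix_inverse)
  have "inj \<beta>"
  proof (rule injI)
    fix w w' assume e: "\<beta> w = \<beta> w'"
    show "w = w'"
    proof
      fix i show "w i = w' i" using fun_cong[OF e, of "Abs_ix i"] by (simp add: \<beta>_def inv)
    qed
  qed
  hence "inj \<gamma>" unfolding \<gamma>_def by (intro prod.inj_map)
  have "finite S" unfolding S_def by simp
  hence "finite V" unfolding V_def using finite_set_of_finite_funs[of "UNIV :: 'n ix set" S undefined]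
    by simp
  have "card ?B \<le> card ?B'"
  proof (rule card_inj_on_le[of \<gamma>])
    show "inj_on \<gamma> ?B" by (rule inj_on_subset[OF \<open>inj \<gamma>\<close> subset_UNIV])
    have "finite (V \<times> V \<times> V)" using \<open>finite V\<close> by simp
    thus "finite ?B'" by (rule rev_finite_subset) blast
    have "\<beta> w \<in> V" for w by (simp add: V_def S_def \<beta>_def)
    thus "\<gamma> ` ?B \<subseteq> ?B'"
      by (auto simp: \<gamma>_def to_ac2_restrict_plane F'_def F_def \<beta>_def)
  qed
  moreover have "card S = CARD('a)" unfolding S_def by (rule card_image) (simp add: inj_def)
  moreover have "card ?B' * card S \<le> bad_bound (total_degree f) * (card S ^ CARD('n ix)) ^ 3"
    unfolding V_def
  proof (rule card_reducible_sections_le)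
    show "irreducible F'" unfolding F'_def
      by (rule irreducible_hom_image[OF comm_ring_hom_rename comm_ring_hom_rename, of Rep_ix])
        (use irr in \<open>simp_all add: rename_inverse inv F_def abs_irreducible_mpoly_def\<close>)
    have F: "degree_le (total_degree f) F" "homogeneous_part (total_degree f) F \<noteq> 0"
      using degree_le_total_degree[of F] homogeneous_part_total_degree_nonzero[of F] d
      by (simp_all add: F_def total_degree_map_to_ac)
    show "degree_le (total_degree f) F'" unfolding F'_def by (rule degree_le_rename[OF F(1)])
    show "homogeneous_part (total_degree f) F' \<noteq> 0" unfolding F'_def
      by (rule homogeneous_part_rename_nonzero[of Rep_ix, OF inv(1) F(1) d F(2)])
    show "CHAR('a alg_closure) > 0" using finite_imp_CHAR_pos[where ?'a = 'a] by simp
  qed (use d \<open>finite S\<close> in simp_all)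
  ultimately show ?thesis unfolding card_ix
    by (metis (no_types, lifting) le_trans mult_le_mono1)
qed

section \<open>Summation over the planes\<close>

lemma plane_params_disjoint: "plane_params L \<inter> plane_params L' = {}" if "L \<noteq> L'"
  using that by (auto simp: plane_params_def)

text \<open>Membership asks for one parametrisation with j + 1 factors. Invariance of the number of
  factors extends this to all of them, which makes the sets for different j disjoint and every
  parametrisation of a counted plane bad.\<close>

lemma Pi_planesD:
  assumes "L \<in> Pi_planes f j"
  shows "plane_params L \<noteq> {}"
    and "(w, v, z) \<in> plane_params L \<Longrightarrow> num_abs_irr_factors (restrict_plane f v z w) = j + 1"
proof -
  obtain v0 v1 v2 where "lin_indep2 v1 v2" "L = affine_plane_of v0 v1 v2"
    and num: "num_abs_irr_factors (restrict_plane f v0 v1 v2) = j + 1"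
    using assms unfolding Pi_planes_def by blast
  hence mem: "(v2, v0, v1) \<in> plane_params L" by (simp add: plane_params_def)
  thus "plane_params L \<noteq> {}" by blast
  assume "(w, v, z) \<in> plane_params L"
  from num_abs_irr_factors_plane[OF mem this, of f] show "num_abs_irr_factors (restrict_plane f v z w) = j + 1"
    unfolding num .
qed

lemma sum_Pi_planes_le:
  fixes f :: "('n::finite, 'a::{finite,field}) mpoly"
  defines "q \<equiv> CARD('a)"
  shows "(\<Sum>j=1..k. j * card (Pi_planes f j)) * (q\<^sup>2 * ((q\<^sup>2 - 1) * (q\<^sup>2 - q)))
    \<le> k * card {(w, v, z). reducible (to_ac2 (restrict_plane f v z w))}"
proof -
  let ?B = "{(w, v, z). reducible (to_ac2 (restrict_plane f v z w))}"
  let ?U = "\<Union>j\<in>{1..k}. Pi_planes f j"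
  let ?G = "q\<^sup>2 * ((q\<^sup>2 - 1) * (q\<^sup>2 - q))"
  have disj: "Pi_planes f i \<inter> Pi_planes f j = {}" if "i \<noteq> j" for i j
  proof (rule ccontr)
    assume "Pi_planes f i \<inter> Pi_planes f j \<noteq> {}"
    then obtain L where L: "L \<in> Pi_planes f i" "L \<in> Pi_planes f j" by blast
    obtain w v z where "(w, v, z) \<in> plane_params L" using Pi_planesD(1)[OF L(1)] by (metis ex_in_conv prod_cases3)
    from Pi_planesD(2)[OF L(1) this] Pi_planesD(2)[OF L(2) this] that show False by simp
  qed
  have "(\<Sum>j=1..k. j * card (Pi_planes f j)) \<le> (\<Sum>j=1..k. k * card (Pi_planes f j))"
    by (intro sum_mono mult_le_mono1) simp
  also have "\<dots> = k * (\<Sum>j=1..k. card (Pi_planes f j))" by (rule sum_distrib_left[symmetric])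
  also have "(\<Sum>j=1..k. card (Pi_planes f j)) = card ?U"
    by (rule card_UN_disjoint[symmetric]) (use disj in simp_all)
  finally have 1: "(\<Sum>j=1..k. j * card (Pi_planes f j)) \<le> k * card ?U" .
  have "card ?U * ?G = (\<Sum>L\<in>?U. ?G)" by simp
  also have "\<dots> \<le> (\<Sum>L\<in>?U. card (plane_params L))"
  proof (rule sum_mono)
    fix L assume "L \<in> ?U"
    then obtain j where "L \<in> Pi_planes f j" by blast
    from card_plane_params_ge[OF Pi_planesD(1)[OF this]] show "?G \<le> card (plane_params L)"
      unfolding q_def .
  qed
  also have "\<dots> = card (\<Union>L\<in>?U. plane_params L)"
    by (rule card_UN_disjoint[symmetric]) (simp, simp, intro ballI impI plane_params_disjoint)
  also have "\<dots> \<le> card ?B"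
  proof (rule card_mono)
    show "(\<Union>L\<in>?U. plane_params L) \<subseteq> ?B"
    proof
      fix t assume "t \<in> (\<Union>L\<in>?U. plane_params L)"
      then obtain j L where j: "1 \<le> j" and L: "L \<in> Pi_planes f j" and t: "t \<in> plane_params L" by auto
      obtain w v z where e: "t = (w, v, z)" by (rule prod_cases3)
      have "num_abs_irr_factors (restrict_plane f v z w) \<ge> 2"
        using Pi_planesD(2)[OF L t[unfolded e]] j by simp
      from reducible_if_two_factors[OF this] show "t \<in> ?B" by (simp add: e)
    qed
  qed (rule finite)
  finally have 2: "card ?U * ?G \<le> card ?B" .
  have "(\<Sum>j=1..k. j * card (Pi_planes f j)) * ?G \<le> k * card ?U * ?G" by (rule mult_le_mono1[OF 1])
  also have "\<dots> \<le> k * card ?B" unfolding mult.assoc by (rule mult_le_mono2[OF 2])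
  finally show ?thesis .
qed

text \<open>The factors 4 and 3 clear the estimate q^2/(q^2 - 1) \<le> 4/3, which is sharp at q = 2.
  For d = 2 the crude bound 2 d^4 would be too large, but the exact value 15 of the left-hand
  product is small enough.\<close>

lemma bad_bound_le_powr:
  assumes "2 \<le> d"
  shows "4 * real ((d - 1) * bad_bound d) \<le> 3 * (1.99 * real d powr (13/3))"
proof (cases "d = 2")
  case True
  have "(2::real) powr 4 \<le> 2 powr (13/3)" by (rule powr_mono) simp_all
  hence "16 \<le> (2::real) powr (13/3)" by (simp add: powr_numeral)
  thus ?thesis using True by (simp add: bad_bound_def)
next
  case False
  define x where "x = real d"
  have x: "3 \<le> x" using assms False by (simp add: x_def)
  have "real ((d - 1) * bad_bound d) = (x - 1) * (x + 1 + (2 * x - 1) * x + (x - 1) * ((2 * x - 1) * x))"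
  proof -
    have "real (d - 1) = x - 1" "real (2 * d - 1) = 2 * x - 1"
      using assms by (simp_all add: x_def of_nat_diff)
    thus ?thesis unfolding bad_bound_def by (simp only: of_nat_mult of_nat_add of_nat_1 x_def[symmetric])
  qed
  also have "\<dots> = 2 * x ^ 4 - (x - 3) * (3 * x\<^sup>2) - 7 * x\<^sup>2 - 1"
    by (simp add: algebra_simps power2_eq_square power4_eq_xxxx)
  also have "\<dots> \<le> 2 * x ^ 4"
  proof -
    have "0 \<le> (x - 3) * (3 * x\<^sup>2)" using x by simp
    moreover have "0 \<le> 7 * x\<^sup>2" by simp
    ultimately show ?thesis by linarith
  qed
  finally have le: "real ((d - 1) * bad_bound d) \<le> 2 * x ^ 4" .
  \<comment> \<open>27/20 lies below the cube root of 3, and 3 * 1.99 * 27/20 exceeds the required 4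
    * 2 = 8.\<close>
  have "27/20 = ((27/20) powr 3) powr (1/3 :: real)" unfolding powr_powr by simp
  also have "\<dots> \<le> x powr (1/3)" by (rule powr_mono2) (use x in \<open>simp_all add: power3_eq_cube\<close>)
  finally have "x ^ 4 * (27/20) \<le> x ^ 4 * x powr (1/3)" by (rule mult_left_mono) simp
  also have "\<dots> = x powr (13/3)"
    using x powr_add[of x 4 "1/3"] by simp
  finally have "x ^ 4 * (27/20) \<le> x powr (13/3)" .
  moreover have "0 \<le> x ^ 4" by simp
  moreover have "3 * (1.99 * x powr (13/3)) = 597/100 * x powr (13/3)" by simp
  ultimately show ?thesis using le unfolding x_def[symmetric] by linarith
qed

theorem theorem2:
  fixes f :: "('n::finite, 'a::{finite,field}) mpoly"
  assumes "CARD('n) \<ge> 2"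
    and "abs_irreducible_mpoly f"
    and "total_degree f > 1"
    and "\<not> (6 \<le> total_degree f \<and> total_degree f \<le> 37)"
  shows "real (\<Sum>j=1..total_degree f - 1. j * card (Pi_planes f j))
     \<le> 1.99 * real (total_degree f) powr (13/3)
         * real CARD('a) ^ (3 * CARD('n) - 3) / (real CARD('a) ^ 3 * (real CARD('a) - 1))"
proof -
  define d where "d = total_degree f"
  define S where "S = (\<Sum>j=1..d - 1. j * card (Pi_planes f j))"
  define q where "q = real CARD('a)"
  define Q where "Q = q ^ (3 * CARD('n) - 3)"
  define C where "C = 1.99 * real d powr (13/3)"
  let ?q = "CARD('a)" and ?b = "card {(w, v, z). reducible (to_ac2 (restrict_plane f v z w))}"
  have "card {0, 1 :: 'a} \<le> ?q" by (rule card_mono) simp_all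
  hence q2: "2 \<le> ?q" by simp
  have "S * (?q\<^sup>2 * ((?q\<^sup>2 - 1) * (?q\<^sup>2 - ?q))) * ?q \<le> (d - 1) * ?b * ?q"
    unfolding S_def by (rule mult_le_mono1[OF sum_Pi_planes_le])
  also have "\<dots> \<le> (d - 1) * (bad_bound d * (?q ^ CARD('n)) ^ 3)"
    unfolding mult.assoc d_def using assms(2,3)
    by (intro mult_le_mono2 card_reducible_restrictions_le) simp_all
  finally have "real (S * (?q\<^sup>2 * ((?q\<^sup>2 - 1) * (?q\<^sup>2 - ?q))) * ?q)
      \<le> real ((d - 1) * (bad_bound d * (?q ^ CARD('n)) ^ 3))" by (rule of_nat_mono)
  moreover have "real (?q\<^sup>2 - 1) = q\<^sup>2 - 1" "real (?q\<^sup>2 - ?q) = q\<^sup>2 - q"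
    using q2 by (simp_all add: q_def of_nat_diff power2_eq_square)
  \<comment> \<open>The subtraction in the exponent 3n - 3 is on natural numbers; it is genuine
    because n is at least 2.\<close>
  moreover have "(q ^ CARD('n)) ^ 3 = Q * q ^ 3"
    using assms(1) by (simp add: Q_def power_mult[symmetric] power_add[symmetric] mult.commute)
  ultimately have main: "real S * (q\<^sup>2 * ((q\<^sup>2 - 1) * (q\<^sup>2 - q))) * q \<le> real ((d - 1) * bad_bound d) * (Q * q ^ 3)"
    by (simp add: q_def mult.assoc)
  have q: "2 \<le> q" using q2 by (simp add: q_def)
  have sq: "4 \<le> q\<^sup>2" using power_mono[OF q, of 2] by simp
  \<comment> \<open>The claim is multiplied by 3 q^3 so that 3 q^2 \<le> 4 (q^2 - 1), valid for q
    \<ge> 2, brings in the number of parametrisations of a plane; the factor cancels at the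
    end.\<close>
  have "real S * (q ^ 3 * (q - 1)) * (3 * q ^ 3) = real S * (q ^ 4 * (q - 1)) * (3 * q\<^sup>2)"
    by (simp add: power2_eq_square power3_eq_cube power4_eq_xxxx)
  also have "\<dots> \<le> real S * (q ^ 4 * (q - 1)) * (4 * (q\<^sup>2 - 1))"
    by (rule mult_left_mono) (use q sq in simp_all)
  also have "\<dots> = 4 * (real S * (q\<^sup>2 * ((q\<^sup>2 - 1) * (q\<^sup>2 - q))) * q)"
    by (simp add: power2_eq_square power4_eq_xxxx algebra_simps)
  also have "\<dots> \<le> 4 * (real ((d - 1) * bad_bound d) * (Q * q ^ 3))"
    by (rule mult_left_mono[OF main]) simp
  also have "\<dots> = 4 * real ((d - 1) * bad_bound d) * (Q * q ^ 3)" by simp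
  also have "\<dots> \<le> 3 * C * (Q * q ^ 3)"
    unfolding C_def by (rule mult_right_mono[OF bad_bound_le_powr])
      (use assms(3) q in \<open>simp_all add: d_def Q_def\<close>)
  also have "\<dots> = C * Q * (3 * q ^ 3)" by simp
  finally have "real S * (q ^ 3 * (q - 1)) \<le> C * Q"
    by (rule mult_right_le_imp_le) (use q in simp)
  moreover have "0 < q ^ 3 * (q - 1)" using q by simp
  ultimately have "real S \<le> C * Q / (q ^ 3 * (q - 1))" by (simp only: pos_le_divide_eq)
  thus ?thesis unfolding S_def C_def Q_def q_def d_def .
qed

end
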